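(* Let $q$ be a positive integer, $k\geqslant 0$ a fixed integer and $\epsilon>0$ fixed. Let $\boldsymbol{\ell}$ be a tuple of nonnegative integers indexed by the Dirichlet characters modulo $q$ with $|\boldsymbol{\ell}|=k$. Suppose that $q^2<X\ll_\epsilon(\log T)^{2-\epsilon}$. Then for $s=1/2+it$, $$\frac1T\int_T^{2T}|\mathcal P_X^{\boldsymbol\ell}(s)|^2\,dt=b(\boldsymbol\ell)F_X(\boldsymbol\ell)\left(1+O_{q,k,\epsilon}\Big(\frac{1}{\log X}\Big)\right),$$ where $$b(\boldsymbol\ell)=\prod_{p\nmid q}\left\{\Big(1-\frac1p\Big)^{|d_{\boldsymbol\ell}(p)|^2}\sum_{m=0}^\infty\frac{|d_{\boldsymbol\ell}(p^m)|^2}{p^m}\right\},\qquad F_X(\boldsymbol\ell)=(e^\gamma\log X)^{\lambda}\prod_p\Big(1-\frac1p\Big)^{\lambda-|d_{\boldsymbol\ell}(p)|^2},$$ $\gamma$ is the Euler–Mascheroni constant and $\lambda=\sum_\chi\ell_\chi^2$.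
   Context: For a positive integer $q$, sums and products over $\chi$ run over all Dirichlet characters modulo $q$; for such $\chi$, $\chi^*$ is the primitive character inducing $\chi$. For a tuple $\boldsymbol\ell=(\ell_\chi)_\chi$ of nonnegative integers: $|\boldsymbol\ell|=\sum_\chi\ell_\chi$, $\lambda=\sum_\chi\ell_\chi^2$, $\mathcal L^{\boldsymbol\ell}(s)=\prod_\chi L(s,\chi)^{\ell_\chi}$, and $d_{\boldsymbol\ell}(n)$ is the coefficient of $n^{-s}$ in the Dirichlet series of $\mathcal L^{\boldsymbol\ell}(s)$. For $X\geqslant2$, $P_X(s,\chi)=\prod_{p\mid q}(1-\chi^*(p)p^{-s})\exp\big(\sum_{n\leqslant X}\chi^*(n)\Lambda(n)/(n^s\log n)\big)$ ($\Lambda$ the von Mangoldt function), and $\mathcal P_X^{\boldsymbol\ell}(s)=\prod_\chi P_X(s,\chi)^{\ell_\chi}$. The product over all primes $p$ in $F_X(\boldsymbol\ell)$ is taken over primes in increasing order (it converges conditionally). *)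

theory Defs
  imports "HOL-Analysis.Analysis" "HOL-Number_Theory.Number_Theory" "HOL-Number_Theory.Prime_Powers"
begin

definition dcharacter :: "nat \<Rightarrow> (nat \<Rightarrow> complex) \<Rightarrow> bool" where
  "dcharacter q chi \<longleftrightarrow>
     (\<forall>m n. chi (m * n) = chi m * chi n) \<and>
     (\<forall>n. chi (n + q) = chi n) \<and>
     (\<forall>n. chi n \<noteq> 0 \<longleftrightarrow> coprime n q)"

definition dcharacters :: "nat \<Rightarrow> (nat \<Rightarrow> complex) set" where
  "dcharacters q = {chi. dcharacter q chi}"

definition induces :: "nat \<Rightarrow> (nat \<Rightarrow> complex) \<Rightarrow> nat \<Rightarrow> (nat \<Rightarrow> complex) \<Rightarrow> bool" where
  "induces d psi q chi \<longleftrightarrow>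
     d dvd q \<and> dcharacter d psi \<and> dcharacter q chi \<and> (\<forall>n. coprime n q \<longrightarrow> chi n = psi n)"

definition primitive_dcharacter :: "nat \<Rightarrow> (nat \<Rightarrow> complex) \<Rightarrow> bool" where
  "primitive_dcharacter d psi \<longleftrightarrow>
     dcharacter d psi \<and> \<not> (\<exists>d' psi'. d' \<noteq> d \<and> induces d' psi' d psi)"

definition inducing_primitive :: "nat \<Rightarrow> (nat \<Rightarrow> complex) \<Rightarrow> (nat \<Rightarrow> complex)" where
  "inducing_primitive q chi = (THE psi. \<exists>d. primitive_dcharacter d psi \<and> induces d psi q chi)"

(* Only the half-plane Re s > 1, where the series converges absolutely, matters: these
   functions are used solely through the coefficients of the Dirichlet series of their products.
   In this and the following series over n, the term n = 0 is 0, because 0 powr s = 0 and x / 0 = 0. *)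
definition dirichlet_L :: "(nat \<Rightarrow> complex) \<Rightarrow> complex \<Rightarrow> complex" where
  "dirichlet_L chi s = (\<Sum>n. chi n / of_nat n powr s)"

definition L_prod :: "nat \<Rightarrow> ((nat \<Rightarrow> complex) \<Rightarrow> nat) \<Rightarrow> complex \<Rightarrow> complex" where
  "L_prod q l s = (\<Prod>chi\<in>dcharacters q. dirichlet_L chi s ^ l chi)"

(* The coefficients of the Dirichlet series representing F in some right half-plane; they are
   unique by the identity theorem for Dirichlet series, up to the value at 0, normalized to 0. *)
definition dirichlet_coeffs :: "(complex \<Rightarrow> complex) \<Rightarrow> nat \<Rightarrow> complex" where
  "dirichlet_coeffs F =
     (THE a. a 0 = 0 \<and> (\<exists>\<sigma>. \<forall>s. Re s > \<sigma> \<longrightarrow> (\<lambda>n. a n / of_nat n powr s) sums F s))"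

definition d_coeff :: "nat \<Rightarrow> ((nat \<Rightarrow> complex) \<Rightarrow> nat) \<Rightarrow> nat \<Rightarrow> complex" where
  "d_coeff q l = dirichlet_coeffs (L_prod q l)"

definition tuple_size :: "nat \<Rightarrow> ((nat \<Rightarrow> complex) \<Rightarrow> nat) \<Rightarrow> nat" where
  "tuple_size q l = (\<Sum>chi\<in>dcharacters q. l chi)"

definition tuple_lambda :: "nat \<Rightarrow> ((nat \<Rightarrow> complex) \<Rightarrow> nat) \<Rightarrow> nat" where
  "tuple_lambda q l = (\<Sum>chi\<in>dcharacters q. (l chi)\<^sup>2)"

(* The term n = 1 of the exponent is mangoldt 1 / ln 1 = 0 / 0 = 0. *)
definition P_X :: "real \<Rightarrow> nat \<Rightarrow> complex \<Rightarrow> (nat \<Rightarrow> complex) \<Rightarrow> complex" where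
  "P_X X q s chi =
     (let chi' = inducing_primitive q chi
      in (\<Prod>p\<in>prime_factors q. 1 - chi' p * of_nat p powr (- s)) *
         exp (\<Sum>n | n > 0 \<and> real n \<le> X.
                chi' n * mangoldt n / (of_nat n powr s * of_real (ln (real n)))))"

definition P_prod :: "real \<Rightarrow> nat \<Rightarrow> ((nat \<Rightarrow> complex) \<Rightarrow> nat) \<Rightarrow> complex \<Rightarrow> complex" where
  "P_prod X q l s = (\<Prod>chi\<in>dcharacters q. P_X X q s chi ^ l chi)"

(* Products over primes are infinite products over all n with the factor 1 at non-primes; prodinf
   takes the limit of the partial products over n < N, so primes are taken in increasing order. *)
definition b_const :: "nat \<Rightarrow> ((nat \<Rightarrow> complex) \<Rightarrow> nat) \<Rightarrow> real" where
  "b_const q l = prodinf (\<lambda>p. if prime p \<and> \<not> p dvd q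
     then (1 - 1 / real p) powr (cmod (d_coeff q l p))\<^sup>2 *
          (\<Sum>m. (cmod (d_coeff q l (p ^ m)))\<^sup>2 / real p ^ m)
     else 1)"

definition F_X :: "real \<Rightarrow> nat \<Rightarrow> ((nat \<Rightarrow> complex) \<Rightarrow> nat) \<Rightarrow> real" where
  "F_X X q l = (exp euler_mascheroni * ln X) ^ tuple_lambda q l *
     prodinf (\<lambda>p. if prime p
       then (1 - 1 / real p) powr (real (tuple_lambda q l) - (cmod (d_coeff q l p))\<^sup>2)
       else 1)"

end

theory Submission
  imports Defs "HOL-Complex_Analysis.Complex_Analysis" "HOL-Real_Asymp.Real_Asymp"
begin

text \<open>On \<open>Re s = 1/2\<close> the function \<open>P_X^\<ell>(s)\<close> is a finite Euler product over \<open>p \<le> X\<close> of exponentials of power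
  series in \<open>p^{-s}\<close>, hence an absolutely convergent Dirichlet series supported on the integers composed of
  primes \<open>p \<le> X\<close>. Expanding the square, the diagonal yields the product over \<open>p \<le> X\<close> of
  \<open>\<Sum>_m |a(p^m)|^2 / p^m\<close>, and the rest is at most \<open>T^{-\<delta>} exp (O(X^{1/2 + \<delta>}))\<close>, which is
  negligible because \<open>X \<le> A (ln T)^{2 - \<epsilon>}\<close>. Since \<open>a(p^m) = d_\<ell>(p^m)\<close> whenever \<open>p^m \<le> X\<close>, the
  diagonal differs from the corresponding product with \<open>d_\<ell>\<close> by a factor \<open>1 + O(1 / ln X)\<close>. Comparing the
  latter with \<open>b(\<ell>) F_X(\<ell>)\<close> uses Mertens' third theorem and, as
  \<open>\<lambda> - |d_\<ell>(p)|^2\<close> is for \<open>(p, q) = 1\<close> a combination of nonprincipal characters, the bound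
  \<open>\<Sum>_{p > X} \<chi>(p) / p = O(1 / ln X)\<close>, a consequence of \<open>L(1,\<chi>) \<noteq> 0\<close>.\<close>

subsection \<open>Chebyshev's bound and Mertens' first theorem\<close>

text \<open>Everything has to be uniform in the tuple, so \<open>l\<close> enters the bounds only
  through |l| = k: |d_l(p)| <= k, lambda <= k^2, and local coefficients at p^m of size O_k(2^(m/8)).
  The small exponent 1/8 keeps the Euler factors summable at every prime as far left as Re s = 1/4,
  which is the room in which the off-diagonal weight n^delta is placed. The product in
  \<open>F_X\<close> converges only conditionally. Therefore \<open>b_const\<close> and
  \<open>F_X\<close> are treated as exponentials of series over all n with terms 0 off the primes.
  In the sum of the two logarithms up to X the exponents |d_l(p)|^2 cancel; what is left are the
  local sums and -lambda times the Mertens sum, and the latter is compensated by (e^gamma ln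
  X)^lambda. The tails beyond X come from partial summation over blocks that contain no prime
  dividing q. At a prime p | q the factor 1 - chi'(p) p^(-s), with chi' the primitive character,
  cancels the truncated exponential up to the powers p^m <= X, in agreement with d_l(p^m) =
  0.\<close>

lemma abel_summation:
  fixes f :: "nat \<Rightarrow> real" and c :: "nat \<Rightarrow> 'a :: real_vector"
  assumes "a \<le> b"
  shows "(\<Sum>i=a..b. f i *\<^sub>R c i) =
    (\<Sum>i\<in>{a..<b}. (f i - f (Suc i)) *\<^sub>R (\<Sum>j=a..i. c j)) + f b *\<^sub>R (\<Sum>j=a..b. c j)"
  using assms
proof (induction b rule: dec_induct)
  case (step n)
  then show ?case by (simp add: algebra_simps)
qed simp

lemma abel_sum_bound:
  fixes f :: "nat \<Rightarrow> real" and c :: "nat \<Rightarrow> 'a :: real_normed_vector"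
  assumes "a \<le> b" and C: "\<And>n. a \<le> n \<Longrightarrow> n \<le> b \<Longrightarrow> norm (\<Sum>i=a..n. c i) \<le> K"
    and dec: "\<And>n. a \<le> n \<Longrightarrow> n < b \<Longrightarrow> f (Suc n) \<le> f n" and "f b \<ge> 0"
  shows "norm (\<Sum>i=a..b. f i *\<^sub>R c i) \<le> K * f a"
proof -
  have "norm (\<Sum>i=a..b. f i *\<^sub>R c i) \<le>
    norm (\<Sum>i\<in>{a..<b}. (f i - f (Suc i)) *\<^sub>R (\<Sum>j=a..i. c j)) + norm (f b *\<^sub>R (\<Sum>j=a..b. c j))"
    unfolding abel_summation[OF \<open>a \<le> b\<close>] by (rule norm_triangle_ineq)
  also have "\<dots> \<le> (\<Sum>i\<in>{a..<b}. (f i - f (Suc i)) * K) + f b * K"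
  proof (rule add_mono)
    show "norm (\<Sum>i\<in>{a..<b}. (f i - f (Suc i)) *\<^sub>R (\<Sum>j=a..i. c j)) \<le> (\<Sum>i\<in>{a..<b}. (f i - f (Suc i)) * K)"
      by (rule sum_norm_le) (auto intro!: mult_mono C dec)
    show "norm (f b *\<^sub>R (\<Sum>j=a..b. c j)) \<le> f b * K"
      using assms(1,4) C[of b] by (auto intro!: mult_mono)
  qed
  also have "\<dots> = K * f a"
  proof -
    have "(\<Sum>i\<in>{a..<b}. f i - f (Suc i)) = f a - f b"
      using sum_Suc_diff'[OF \<open>a \<le> b\<close>, of "\<lambda>i. - f i"] by simp
    thus ?thesis by (simp only: sum_distrib_right[symmetric]) (simp add: algebra_simps)
  qed
  finally show ?thesis .
qed

text \<open>Both sides run over the pairs (d, m) with d m <= N. It serves the convolution identity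
  ln = Lambda * 1, plain and twisted by a character.\<close>

lemma sum_divisors_swap:
  fixes f :: "nat \<Rightarrow> nat \<Rightarrow> 'a :: comm_monoid_add"
  shows "(\<Sum>n=1..N. \<Sum>d | d dvd n. f d (n div d)) = (\<Sum>d=1..N. \<Sum>m=1..N div d. f d m)"
proof -
  have "(\<Sum>n=1..N. \<Sum>d | d dvd n. f d (n div d)) = (\<Sum>(n,d)\<in>(SIGMA n:{1..N}. {d. d dvd n}). f d (n div d))"
    by (subst sum.Sigma) auto
  also have "\<dots> = (\<Sum>(d,m)\<in>(SIGMA d:{1..N}. {1..N div d}). f d m)"
  proof (rule sum.reindex_bij_witness[of _ "\<lambda>(d,m). (d * m, d)" "\<lambda>(n,d). (d, n div d)"], goal_cases)
    case (2 a)
    then obtain n d where a: "a = (n, d)" "1 \<le> n" "n \<le> N" "d dvd n" by auto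
    hence "d > 0" "d \<le> n" by (auto intro: dvd_imp_le Nat.gr0I)
    moreover have "n div d > 0" using a \<open>d \<le> n\<close> \<open>d > 0\<close> by (simp add: div_greater_zero_iff)
    ultimately show ?case using a by (auto intro: div_le_mono)
  next
    case (4 b)
    then obtain d m where b: "b = (d, m)" "1 \<le> d" "1 \<le> m" "m \<le> N div d" by auto
    hence "d * m \<le> N" by (metis less_eq_div_iff_mult_less_eq mult.commute not_less_eq_eq One_nat_def less_eq_Suc_le)
    with b show ?case by auto
  qed auto
  also have "\<dots> = (\<Sum>d=1..N. \<Sum>m=1..N div d. f d m)"
    by (subst sum.Sigma) auto
  finally show ?thesis .
qed

lemma ln_fact_eq_sum_mangoldt:
  "ln (fact N :: real) = (\<Sum>d=1..N. mangoldt d * real (N div d))"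
proof -
  have "ln (fact N :: real) = (\<Sum>n=1..N. ln (real n))"
    by (induction N) (auto simp: ln_mult add_ac simp del: of_nat_Suc)
  also have "\<dots> = (\<Sum>n=1..N. \<Sum>d | d dvd n. mangoldt d)"
    by (intro sum.cong) (auto simp: mangoldt_sum)
  also have "\<dots> = (\<Sum>d=1..N. \<Sum>m=1..N div d. mangoldt d)"
    by (rule sum_divisors_swap[of "\<lambda>d m. mangoldt d"])
  finally show ?thesis by (simp add: mult.commute)
qed

definition chebyshev_psi :: "nat \<Rightarrow> real" where
  "chebyshev_psi N = (\<Sum>n=1..N. mangoldt n)"

text \<open>In ln (2M choose M) the weight floor(2M/d) - 2 floor(M/d) of Lambda(d) is nonnegative
  throughout and equal to 1 for M < d <= 2M, so the bound 4^M for the binomial coefficient controls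
  Lambda on that range.\<close>

lemma chebyshev_psi_double: "chebyshev_psi (2 * M) \<le> chebyshev_psi M + 2 * real M * ln 2"
proof -
  have "chebyshev_psi (2 * M) - chebyshev_psi M = (\<Sum>d\<in>{M+1..2*M}. mangoldt d)"
  proof -
    have "chebyshev_psi (2 * M) = chebyshev_psi M + (\<Sum>d\<in>{M+1..2*M}. mangoldt d)"
      unfolding chebyshev_psi_def by (subst sum.union_disjoint[symmetric]) (auto intro!: sum.cong)
    thus ?thesis by simp
  qed
  also have "\<dots> = (\<Sum>d\<in>{M+1..2*M}. mangoldt d * (real (2 * M div d) - 2 * real (M div d)))"
  proof (intro sum.cong refl)
    fix d assume d: "d \<in> {M+1..2*M}"
    hence "2 * M div d = 1" by (intro div_nat_eqI) auto
    with d show "mangoldt d = mangoldt d * (real (2 * M div d) - 2 * real (M div d))" by simp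
  qed
  also have "\<dots> \<le> (\<Sum>d\<in>{1..2*M}. mangoldt d * (real (2 * M div d) - 2 * real (M div d)))"
  proof (intro sum_mono2)
    fix d
    have "M div d + M div d \<le> (M + M) div d" by (subst div_add1_eq) simp
    hence "real (M div d + M div d) \<le> real ((M + M) div d)" by (rule of_nat_mono)
    hence "real (2 * M div d) - 2 * real (M div d) \<ge> 0" by (simp only: mult_2 of_nat_add)
    thus "mangoldt d * (real (2 * M div d) - 2 * real (M div d)) \<ge> 0"
      by (intro mult_nonneg_nonneg mangoldt_nonneg)
  qed auto
  also have "\<dots> = ln (fact (2*M)) - 2 * (\<Sum>d\<in>{1..2*M}. mangoldt d * real (M div d))"
    unfolding ln_fact_eq_sum_mangoldt sum_distrib_left sum_subtractf[symmetric]
    by (intro sum.cong refl) (simp only: right_diff_distrib mult_ac)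
  also have "(\<Sum>d\<in>{1..2*M}. mangoldt d * real (M div d)) = (\<Sum>d\<in>{1..M}. mangoldt d * real (M div d))"
    by (rule sum.mono_neutral_right) auto
  also have "\<dots> = ln (fact M)" by (simp add: ln_fact_eq_sum_mangoldt)
  also have "ln (fact (2*M)) - 2 * ln (fact M :: real) = ln (real (2 * M choose M))"
  proof -
    have "real (2 * M choose M) = fact (2*M) / (fact M * fact M)"
      using binomial_fact[of M "2*M", where ?'a = real] by (simp add: mult_2)
    thus ?thesis by (simp add: ln_div ln_mult)
  qed
  also have "\<dots> \<le> ln (2 ^ (2*M))"
  proof -
    have "2 * M choose M \<le> 2 ^ (2 * M)" by (rule binomial_le_pow2)
    hence "real (2 * M choose M) \<le> 2 ^ (2*M)" by (metis of_nat_le_iff of_nat_numeral of_nat_power)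
    thus ?thesis by (intro ln_mono) (auto simp: zero_less_binomial_iff)
  qed
  also have "\<dots> = 2 * real M * ln 2" by (simp add: ln_realpow)
  finally show ?thesis by simp
qed

text \<open>Halving, with ln 2 <= 1: the doubling step gives 4M + 2M against the allowance 8M, and
  for N = 2M + 1 the slack 2M absorbs the new term, which is at most ln N <= N - 1 = 2M.\<close>

lemma chebyshev_psi_le: "chebyshev_psi N \<le> 4 * real N"
proof (induction N rule: less_induct)
  case (less N)
  have l2: "ln 2 \<le> (1::real)" using ln_le_minus_one[of "2::real"] by simp
  consider "N = 0" | M where "N = 2 * M" "M > 0" | M where "N = 2 * M + 1"
    by (metis oddE evenE mult_0_right gr0I)
  thus ?case
  proof cases
    case 1 thus ?thesis by (simp add: chebyshev_psi_def)
  next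
    case 2
    have "chebyshev_psi N \<le> 4 * real M + 2 * real M * ln 2" using chebyshev_psi_double[of M] less[of M] 2 by simp
    also have "\<dots> \<le> 4 * real M + 2 * real M * 1" using l2 by (intro add_left_mono mult_left_mono) auto
    finally show ?thesis using 2 by simp
  next
    case 3
    have "chebyshev_psi N = chebyshev_psi (2*M) + mangoldt N" using 3 by (simp add: chebyshev_psi_def)
    also have "mangoldt N \<le> ln (real N)" using 3 by (intro mangoldt_le) auto
    also have "ln (real N) \<le> real N - 1" using 3 by (intro ln_le_minus_one) auto
    also have "chebyshev_psi (2*M) \<le> 4 * real M + 2 * real M * ln 2"
    proof (cases "M = 0")
      case False thus ?thesis using chebyshev_psi_double[of M] less[of M] 3 by simp
    qed (simp add: chebyshev_psi_def)
    also have "\<dots> \<le> 4 * real M + 2 * real M * 1" using l2 by (intro add_left_mono mult_left_mono) auto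
    finally show ?thesis using 3 by simp
  qed
qed

lemma ln_fact_bounds:
  assumes "N > 0"
  shows "real N * ln (real N) - real N \<le> ln (fact N)" "ln (fact N :: real) \<le> real N * ln (real N)"
proof -
  have "real N ^ N / fact N \<le> exp (real N)"
  proof -
    have "(\<lambda>n. real N ^ n / fact n) sums exp (real N)"
      using exp_converges[of "real N"] by (simp add: field_simps)
    hence "summable (\<lambda>n. real N ^ n / fact n)" "(\<Sum>n. real N ^ n / fact n) = exp (real N)"
      by (auto simp: sums_iff)
    with sum_le_suminf[of "\<lambda>n. real N ^ n / fact n" "{N}"]
    have "sum (\<lambda>n. real N ^ n / fact n) {N} \<le> exp (real N)" by simp
    thus ?thesis by simp
  qed
  hence "ln (real N ^ N / fact N) \<le> ln (exp (real N))"
    using assms by (intro ln_mono) auto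
  thus "real N * ln (real N) - real N \<le> ln (fact N)"
    using assms by (simp add: ln_div ln_realpow)
  have "(fact N :: real) \<le> real N ^ N" using fact_le_power[of N, where ?'a = real] by simp
  hence "ln (fact N :: real) \<le> ln (real N ^ N)" using assms by (intro ln_mono) auto
  thus "ln (fact N :: real) \<le> real N * ln (real N)" using assms by (simp add: ln_realpow)
qed

text \<open>Replacing floor(N/d) by N/d in the formula for ln N! costs at most psi(N) <= 4N, and ln
  N! lies between N ln N - N and N ln N; division by N gives the 4.\<close>

lemma mertens_first_mangoldt:
  assumes "N > 0"
  shows "\<bar>(\<Sum>d=1..N. mangoldt d / real d) - ln (real N)\<bar> \<le> 4"
proof -
  let ?S = "\<Sum>d=1..N. mangoldt d / real d"
  have eq: "real N * ?S = (\<Sum>d=1..N. mangoldt d * (real N / real d))"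
    by (simp add: sum_distrib_left field_simps)
  have "ln (fact N) \<le> real N * ?S"
    unfolding eq ln_fact_eq_sum_mangoldt
    by (intro sum_mono mult_left_mono mangoldt_nonneg) (auto simp: of_nat_div_le_of_nat)
  moreover have "real N * ?S - ln (fact N) \<le> chebyshev_psi N"
  proof -
    have "real N * ?S - ln (fact N) = (\<Sum>d=1..N. mangoldt d * (real N / real d - real (N div d)))"
      unfolding eq ln_fact_eq_sum_mangoldt by (simp add: sum_subtractf algebra_simps)
    also have "\<dots> \<le> (\<Sum>d=1..N. mangoldt d * 1)"
    proof (intro sum_mono mult_left_mono mangoldt_nonneg)
      fix d assume "d \<in> {1..N}"
      hence "real N = real d * real (N div d) + real (N mod d)" "real (N mod d) \<le> real d" "d > 0"
        by (auto simp flip: of_nat_mult of_nat_add intro: less_imp_le)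
      thus "real N / real d - real (N div d) \<le> 1" by (simp add: field_simps)
    qed
    finally show ?thesis by (simp add: chebyshev_psi_def)
  qed
  ultimately have "real N * (ln (real N) - 1) \<le> real N * ?S" "real N * ?S \<le> real N * (ln (real N) + 4)"
    using chebyshev_psi_le[of N] ln_fact_bounds[OF assms] by (auto simp: algebra_simps)
  thus ?thesis using assms by (auto simp: abs_if)
qed

lemma summable_ln_over_square: "summable (\<lambda>n. ln (real n) / (real n * (real n - 1)))"
proof (rule summable_comparison_test_bigo)
  show "summable (\<lambda>n. norm (real n powr (-3/2)))"
    by (simp add: summable_real_powr_iff)
  show "(\<lambda>n. ln (real n) / (real n * (real n - 1))) \<in> O(\<lambda>n. real n powr (-3/2))"
    by real_asymp
qed

text \<open>A bound for the sum of Lambda(n)/n over proper prime powers: the powers p^j with j >= 2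
  contribute the geometric sum ln p / (p (p - 1)). It runs over all n, and the terms at n = 0 and n
  = 1 are 0.\<close>

definition prime_power_excess :: real where
  "prime_power_excess = (\<Sum>n. ln (real n) / (real n * (real n - 1)))"

lemma sum_mangoldt_nonprime_le:
  "(\<Sum>n\<in>{n\<in>{1..N}. \<not> prime n}. mangoldt n / real n) \<le> prime_power_excess"
proof -
  let ?A = "{n\<in>{1..N}. \<not> prime n \<and> primepow n}"
  let ?B = "SIGMA p:{p\<in>{2..N}. prime p}. {2..N}"
  have "(\<Sum>n\<in>{n\<in>{1..N}. \<not> prime n}. mangoldt n / real n) = (\<Sum>n\<in>?A. mangoldt n / real n)"
    by (intro sum.mono_neutral_right) (auto simp: mangoldt_def)
  also have "\<dots> \<le> (\<Sum>n\<in>(\<lambda>(p,j). p ^ j) ` ?B. mangoldt n / real n)"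
  proof (intro sum_mono2)
    show "?A \<subseteq> (\<lambda>(p,j). p ^ j) ` ?B"
    proof
      fix n assume n: "n \<in> ?A"
      then obtain p j where pj: "prime p" "j > 0" "n = p ^ j" unfolding primepow_def by auto
      have "j \<noteq> 1" using n pj by auto
      moreover have "p ^ 1 \<le> p ^ j" using pj prime_gt_0_nat[OF pj(1)] by (intro power_increasing) auto
      \<comment> \<open>A crude bound on the exponent, which places (p, j) in the finite rectangle
        \<open>?B\<close>.\<close>
      moreover have "j < p ^ j" using prime_gt_1_nat[OF pj(1)] by (simp add: power_gt_expt)
      ultimately have "(p, j) \<in> ?B" using pj n prime_ge_2_nat[OF pj(1)] by auto
      thus "n \<in> (\<lambda>(p,j). p ^ j) ` ?B" using pj by force
    qed
  qed (auto intro!: divide_nonneg_nonneg mangoldt_nonneg)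
  also have "\<dots> \<le> (\<Sum>x\<in>?B. case x of (p, j) \<Rightarrow> mangoldt (p ^ j) / real (p ^ j))"
    by (rule order.trans[OF sum_image_le]) (auto simp: o_def case_prod_unfold intro!: divide_nonneg_nonneg mangoldt_nonneg)
  also have "\<dots> = (\<Sum>p\<in>{p\<in>{2..N}. prime p}. \<Sum>j=2..N. ln (real p) / real p ^ j)"
    by (subst sum.Sigma[symmetric]) (auto intro!: sum.cong)
  also have "\<dots> \<le> (\<Sum>p\<in>{p\<in>{2..N}. prime p}. ln (real p) / (real p * (real p - 1)))"
  proof (intro sum_mono)
    fix p assume p: "p \<in> {p\<in>{2..N}. prime p}"
    hence p2: "real p \<ge> 2" by auto
    have "(\<Sum>j=2..N. ln (real p) / real p ^ j) = ln (real p) * (\<Sum>j=2..N. (1 / real p) ^ j)"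
      by (simp add: sum_distrib_left power_one_over divide_inverse power_inverse)
    also have "(\<Sum>j=2..N. (1 / real p) ^ j) \<le> 1 / (real p * (real p - 1))"
    proof -
      have "(\<Sum>j=2..N. (1 / real p) ^ j) \<le> (1 / real p) ^ 2 / (1 - 1 / real p)"
      proof (cases "N \<ge> 2")
        case True
        have "(\<Sum>j=2..N. (1 / real p) ^ j) = ((1 / real p) ^ 2 - (1 / real p) ^ Suc N) / (1 - 1 / real p)"
          using True p2 sum_gp[of "1 / real p" 2 N] by (auto simp: field_simps)
        also have "\<dots> \<le> (1 / real p) ^ 2 / (1 - 1 / real p)"
          using p2 by (intro divide_right_mono) auto
        finally show ?thesis .
      qed (use p2 in auto)
      also have "\<dots> = 1 / (real p * (real p - 1))"
        using p2 by (simp add: field_simps power2_eq_square)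
      finally show ?thesis .
    qed
    also have "ln (real p) * (1 / (real p * (real p - 1))) = ln (real p) / (real p * (real p - 1))" by simp
    finally show "(\<Sum>j=2..N. ln (real p) / real p ^ j) \<le> ln (real p) / (real p * (real p - 1))"
      using p2 by (simp add: mult_left_mono)
  qed
  also have "\<dots> \<le> prime_power_excess"
    unfolding prime_power_excess_def
  proof (intro sum_le_suminf summable_ln_over_square)
    fix n :: nat
    show "0 \<le> ln (real n) / (real n * (real n - 1))"
      by (cases "n = 0") (auto intro!: divide_nonneg_nonneg)
  qed auto
  finally show ?thesis .
qed

lemma sum_mangoldt_vs_primes:
  fixes f :: "nat \<Rightarrow> 'a :: real_normed_vector"
  assumes "\<And>n. norm (f n) \<le> 1"
  shows "norm ((\<Sum>n=1..N. (mangoldt n / real n) *\<^sub>R f n) -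
    (\<Sum>n=1..N. (if prime n then ln (real n) / real n else 0) *\<^sub>R f n)) \<le> prime_power_excess"
proof -
  have "(\<Sum>n=1..N. (mangoldt n / real n) *\<^sub>R f n) -
    (\<Sum>n=1..N. (if prime n then ln (real n) / real n else 0) *\<^sub>R f n) =
    (\<Sum>n\<in>{n\<in>{1..N}. \<not> prime n}. (mangoldt n / real n) *\<^sub>R f n)"
    unfolding sum_subtractf[symmetric] by (intro sum.mono_neutral_cong_right) auto
  also have "norm \<dots> \<le> (\<Sum>n\<in>{n\<in>{1..N}. \<not> prime n}. mangoldt n / real n)"
  proof (rule sum_norm_le)
    fix n
    have "mangoldt n / real n * norm (f n) \<le> mangoldt n / real n * 1"
      by (intro mult_left_mono divide_nonneg_nonneg mangoldt_nonneg assms) auto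
    thus "norm ((mangoldt n / real n) *\<^sub>R f n) \<le> mangoldt n / real n" by simp
  qed
  also note sum_mangoldt_nonprime_le
  finally show ?thesis .
qed

lemma mertens_first_primes:
  assumes "N > 0"
  shows "\<bar>(\<Sum>n=1..N. if prime n then ln (real n) / real n else 0) - ln (real N)\<bar> \<le> 4 + prime_power_excess"
  using sum_mangoldt_vs_primes[of "\<lambda>_. 1::real" N] mertens_first_mangoldt[OF assms] by simp

subsection \<open>Euler products\<close>

lemma summable_on_prod_PiE_nonneg:
  fixes f :: "'a \<Rightarrow> 'b \<Rightarrow> real"
  assumes "finite S" "\<And>x. x \<in> S \<Longrightarrow> f x summable_on B x" "\<And>x y. f x y \<ge> 0"
  shows "(\<lambda>g. \<Prod>x\<in>S. f x (g x)) summable_on PiE S B"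
  using assms(1,2)
proof (induction S rule: finite_induct)
  case (insert x F)
  have inj: "inj_on (\<lambda>(g, y). g(x := y)) (Pi\<^sub>E F B \<times> B x)"
    using insert.hyps by (intro inj_combinator') auto
  have pi: "Pi\<^sub>E (insert x F) B = (\<lambda>(g,y). g(x:=y)) ` (Pi\<^sub>E F B \<times> B x)"
    unfolding PiE_insert_eq
    by (subst swap_product [symmetric]) (simp add: image_image case_prod_unfold)
  have "(\<lambda>(g, y). (\<Prod>z\<in>F. f z (g z)) * f x y) summable_on (Pi\<^sub>E F B \<times> B x)"
  proof (rule summable_on_SigmaI)
    fix g assume "g \<in> Pi\<^sub>E F B"
    show "((\<lambda>y. case (g, y) of (g, y) \<Rightarrow> (\<Prod>z\<in>F. f z (g z)) * f x y) has_sum ((\<Prod>z\<in>F. f z (g z)) * infsum (f x) (B x))) (B x)"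
      unfolding prod.case by (intro has_sum_cmult_right has_sum_infsum insert.prems) auto
  next
    show "(\<lambda>g. (\<Prod>z\<in>F. f z (g z)) * infsum (f x) (B x)) summable_on Pi\<^sub>E F B"
      by (intro summable_on_cmult_left insert.IH insert.prems) auto
  qed (auto intro!: mult_nonneg_nonneg prod_nonneg assms(3))
  moreover have "(\<lambda>(g, y). (\<Prod>z\<in>F. f z (g z)) * f x y) =
     ((\<lambda>g. \<Prod>x\<in>insert x F. f x (g x)) \<circ> (\<lambda>(g,y). g(x:=y)))"
  proof -
    have "(\<Prod>z\<in>F. f z ((g(x := y)) z)) = (\<Prod>z\<in>F. f z (g z))" for g y
      using insert.hyps by (intro prod.cong) auto
    thus ?thesis using insert.hyps by (auto simp: fun_eq_iff mult.commute)
  qed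
  ultimately show ?case unfolding pi by (subst summable_on_reindex[OF inj]) simp
qed auto

text \<open>The analytic half of an Euler product: a finite product of absolutely convergent local
  series is one sum over exponent vectors. The arithmetic half is
  \<open>bij_betw_smooth_numbers\<close>.\<close>

lemma prod_PiE_has_sum:
  fixes f :: "'a \<Rightarrow> 'b \<Rightarrow> complex"
  assumes "finite S" "\<And>x. x \<in> S \<Longrightarrow> (\<lambda>y. norm (f x y)) summable_on B x"
  shows "(\<lambda>g. norm (\<Prod>x\<in>S. f x (g x))) summable_on PiE S B"
    and "((\<lambda>g. \<Prod>x\<in>S. f x (g x)) has_sum (\<Prod>x\<in>S. infsum (f x) (B x))) (PiE S B)"
proof -
  show s: "(\<lambda>g. norm (\<Prod>x\<in>S. f x (g x))) summable_on PiE S B"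
    unfolding prod_norm[symmetric] by (rule summable_on_prod_PiE_nonneg) (use assms in auto)
  have "infsum (\<lambda>g. \<Prod>x\<in>S. f x (g x)) (PiE S B) = (\<Prod>x\<in>S. infsum (f x) (B x))"
    by (rule infsum_prod_PiE_abs) (use assms in auto)
  moreover have "(\<lambda>g. \<Prod>x\<in>S. f x (g x)) summable_on PiE S B"
    using s by (rule abs_summable_summable)
  ultimately show "((\<lambda>g. \<Prod>x\<in>S. f x (g x)) has_sum (\<Prod>x\<in>S. infsum (f x) (B x))) (PiE S B)"
    by (simp add: has_sum_iff)
qed

text \<open>Unique factorization as a reindexing of sums. The extensional function space
  \<open>PiE\<close> fixes the value of g outside S, without which the map would not be
  injective.\<close>

lemma bij_betw_smooth_numbers:
  fixes S :: "nat set"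
  assumes "finite S" "\<And>p. p \<in> S \<Longrightarrow> prime p"
  shows "bij_betw (\<lambda>g. \<Prod>p\<in>S. p ^ g p) (PiE S (\<lambda>_. UNIV)) {n. n > 0 \<and> prime_factors n \<subseteq> S}"
proof (rule bij_betwI')
  fix g h assume g: "g \<in> PiE S (\<lambda>_. UNIV :: nat set)" and h: "h \<in> PiE S (\<lambda>_. UNIV :: nat set)"
  show "((\<Prod>p\<in>S. p ^ g p) = (\<Prod>p\<in>S. p ^ h p)) = (g = h)"
  proof
    assume eq: "(\<Prod>p\<in>S. p ^ g p) = (\<Prod>p\<in>S. p ^ h p)"
    show "g = h"
    proof (rule PiE_ext[OF g h])
      fix p assume "p \<in> S"
      thus "g p = h p"
        using multiplicity_prod_prime_powers[OF assms, where p = p and f = g]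
          multiplicity_prod_prime_powers[OF assms, where p = p and f = h] assms(2) eq by auto
    qed
  qed auto
next
  fix g assume "g \<in> PiE S (\<lambda>_. UNIV :: nat set)"
  have pos: "(\<Prod>p\<in>S. p ^ g p) > 0" using assms(2) by (intro prod_pos) (auto simp: prime_gt_0_nat)
  have "p \<in> S" if "p \<in> prime_factors (\<Prod>p\<in>S. p ^ g p)" for p
  proof (rule ccontr)
    assume "p \<notin> S"
    moreover have "prime p" "multiplicity p (\<Prod>p\<in>S. p ^ g p) > 0"
      using that by (auto simp: prime_factors_multiplicity)
    ultimately show False using multiplicity_prod_prime_powers[OF assms, where p = p and f = g] by auto
  qed
  with pos show "(\<Prod>p\<in>S. p ^ g p) \<in> {n. n > 0 \<and> prime_factors n \<subseteq> S}" by auto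
next
  fix n assume n: "n \<in> {n. n > 0 \<and> prime_factors n \<subseteq> S}"
  define g where "g = restrict (\<lambda>p. multiplicity p n) S"
  have "n = (\<Prod>p\<in>prime_factors n. p ^ multiplicity p n)"
    using n by (intro prime_factorization_nat) auto
  also have "\<dots> = (\<Prod>p\<in>S. p ^ g p)"
    using n assms by (intro prod.mono_neutral_cong_left)
      (auto simp: g_def prime_factors_multiplicity)
  finally have "n = (\<Prod>p\<in>S. p ^ g p)" .
  moreover have "g \<in> PiE S (\<lambda>_. UNIV)" by (auto simp: g_def)
  ultimately show "\<exists>g\<in>PiE S (\<lambda>_. UNIV). n = (\<Prod>p\<in>S. p ^ g p)" by blast
qed

lemma completely_multiplicative_prod_power:
  fixes f :: "nat \<Rightarrow> 'a :: comm_monoid_mult"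
  assumes "\<And>m n. f (m * n) = f m * f n" "f 1 = 1"
  shows "f (p ^ m) = f p ^ m" "f (\<Prod>x\<in>S. g x) = (\<Prod>x\<in>S. f (g x))"
proof -
  show "f (p ^ m) = f p ^ m" by (induction m) (use assms in auto)
  show "f (\<Prod>x\<in>S. g x) = (\<Prod>x\<in>S. f (g x))"
    by (induction S rule: infinite_finite_induct) (use assms in auto)
qed

text \<open>Real arguments suffice for the nonvanishing of L(1,chi). The term at n = 0 vanishes
  because \<open>real 0 powr - s\<close> is 0.\<close>

definition real_dirichlet :: "(nat \<Rightarrow> complex) \<Rightarrow> real \<Rightarrow> complex" where
  "real_dirichlet f s = (\<Sum>n. (real n powr - s) *\<^sub>R f n)"

lemma real_dirichlet_has_sum:
  assumes "s > 1" "\<And>n. norm (f n) \<le> 1"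
  shows "(\<lambda>n. norm ((real n powr - s) *\<^sub>R f n)) summable_on UNIV"
    "((\<lambda>n. (real n powr - s) *\<^sub>R f n) has_sum real_dirichlet f s) UNIV"
    "(\<lambda>n. real n powr - s) summable_on UNIV"
proof -
  have le: "norm ((real n powr - s) *\<^sub>R f n) \<le> real n powr - s" for n
    using mult_left_mono[OF assms(2)[of n], of "real n powr - s"] by simp
  have sm: "summable (\<lambda>n. real n powr - s)"
    using assms by (simp add: summable_real_powr_iff)
  thus "(\<lambda>n. real n powr - s) summable_on UNIV"
    by (intro norm_summable_imp_summable_on) auto
  have *: "summable (\<lambda>n. norm ((real n powr - s) *\<^sub>R f n))"
    by (rule summable_comparison_test[OF _ sm]) (use le in auto)
  thus "(\<lambda>n. norm ((real n powr - s) *\<^sub>R f n)) summable_on UNIV"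
    by (intro norm_summable_imp_summable_on) auto
  show "((\<lambda>n. (real n powr - s) *\<^sub>R f n) has_sum real_dirichlet f s) UNIV"
    unfolding real_dirichlet_def
    by (rule norm_summable_imp_has_sum[OF * summable_sums]) (rule summable_norm_cancel[OF *])
qed

lemma geometric_has_sum:
  fixes z :: complex
  assumes "norm z < 1"
  shows "(\<lambda>m. norm (z ^ m)) summable_on UNIV" "((\<lambda>m. z ^ m) has_sum (1 / (1 - z))) UNIV"
proof -
  have "summable (\<lambda>m. norm (z ^ m))" using assms by (simp add: norm_power summable_geometric)
  thus "(\<lambda>m. norm (z ^ m)) summable_on UNIV" "((\<lambda>m. z ^ m) has_sum (1 / (1 - z))) UNIV"
    using geometric_sums[OF assms] by (auto intro!: norm_summable_imp_summable_on norm_summable_imp_has_sum)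
qed

definition primes_le :: "nat \<Rightarrow> nat set" where
  "primes_le N = {p. prime p \<and> p \<le> N}"

lemma finite_primes_le [simp]: "finite (primes_le N)"
  by (rule finite_subset[of _ "{..N}"]) (auto simp: primes_le_def)

text \<open>The product over p <= N expands into the sum over the integers built from these primes.
  A positive integer that is missing has a prime factor above N, hence exceeds N, so the error is at
  most the tail of zeta(s) beyond N.\<close>

lemma euler_product_tendsto:
  fixes f :: "nat \<Rightarrow> complex"
  assumes mult: "\<And>m n. f (m * n) = f m * f n" "f 1 = 1" and le: "\<And>n. norm (f n) \<le> 1" and "s > 1"
  shows "(\<lambda>N. \<Prod>p\<in>primes_le N. 1 / (1 - (real p powr - s) *\<^sub>R f p)) \<longlonglongrightarrow> real_dirichlet f s"
proof -
  define h where "h n = (real n powr - s) *\<^sub>R f n" for n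
  define Z where "Z = (\<Sum>n. real n powr - s)"
  have sm: "summable (\<lambda>n. real n powr - s)"
    using assms by (simp add: summable_real_powr_iff)
  have bound: "norm (real_dirichlet f s - (\<Prod>p\<in>primes_le N. 1 / (1 - h p))) \<le> Z - (\<Sum>n<Suc N. real n powr - s)" for N
  proof -
    let ?S = "primes_le N" and ?A = "{n. n > 0 \<and> prime_factors n \<subseteq> primes_le N}"
    have hm: "h (m * n) = h m * h n" for m n by (simp add: h_def mult powr_mult)
    have h1: "h 1 = 1" using mult(2) by (simp add: h_def)
    have hlt: "norm (h p) < 1" if "p \<in> ?S" for p
    proof -
      have "p > 1" using that prime_gt_1_nat by (auto simp: primes_le_def)
      hence "real p powr - s < real p powr 0" using \<open>s > 1\<close> by (intro powr_less_mono) auto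
      moreover have "norm (h p) \<le> real p powr - s"
        using mult_left_mono[OF le[of p], of "real p powr - s"] by (simp add: h_def)
      ultimately show ?thesis using \<open>p > 1\<close> by simp
    qed
    have inf: "(\<Prod>p\<in>?S. infsum (\<lambda>m. h p ^ m) UNIV) = (\<Prod>p\<in>?S. 1 / (1 - h p))"
      by (intro prod.cong refl infsumI geometric_has_sum hlt)
    have "((\<lambda>g. \<Prod>p\<in>?S. h p ^ g p) has_sum (\<Prod>p\<in>?S. infsum (\<lambda>m. h p ^ m) UNIV)) (PiE ?S (\<lambda>_. UNIV))"
      by (rule prod_PiE_has_sum) (auto intro!: geometric_has_sum hlt)
    hence "((\<lambda>g. h (\<Prod>p\<in>?S. p ^ g p)) has_sum (\<Prod>p\<in>?S. 1 / (1 - h p))) (PiE ?S (\<lambda>_. UNIV))"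
      unfolding inf completely_multiplicative_prod_power[of h, OF hm h1] .
    moreover have "bij_betw (\<lambda>g. \<Prod>p\<in>?S. p ^ g p) (PiE ?S (\<lambda>_. UNIV)) ?A"
      by (rule bij_betw_smooth_numbers) (auto simp: primes_le_def)
    ultimately have "(h has_sum (\<Prod>p\<in>?S. 1 / (1 - h p))) ?A"
      by (simp add: has_sum_reindex_bij_betw[where f = h])
    moreover have "(h has_sum real_dirichlet f s) UNIV"
      unfolding h_def using assms by (intro real_dirichlet_has_sum) auto
    ultimately have D: "(h has_sum (real_dirichlet f s - (\<Prod>p\<in>?S. 1 / (1 - h p)))) (UNIV - ?A)"
      by (intro has_sum_Diff) auto
    have zs: "((\<lambda>n. real n powr - s) has_sum Z) UNIV"
      unfolding Z_def by (intro norm_summable_imp_has_sum summable_sums sm) (use sm in auto)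
    have Z: "((\<lambda>n. real n powr - s) has_sum (Z - (\<Sum>n<Suc N. real n powr - s))) (UNIV - {..<Suc N})"
      by (intro has_sum_Diff zs has_sum_finite) auto
    \<comment> \<open>The number 0 is outside \<open>?A\<close> without being large; it is removed
      here and its term is 0.\<close>
    have sub: "UNIV - ?A - {0} \<subseteq> UNIV - {..<Suc N}"
    proof
      fix n assume n: "n \<in> UNIV - ?A - {0}"
      then obtain p where p: "p \<in> prime_factors n" "p \<notin> ?S" by auto
      hence "prime p" "p dvd n" by (auto simp: prime_factors_dvd)
      moreover have "p > N" using p \<open>prime p\<close> by (auto simp: primes_le_def)
      ultimately show "n \<in> UNIV - {..<Suc N}" using n dvd_imp_le[of p n] by auto
    qed
    have sm': "(\<lambda>n. real n powr - s) summable_on B" for B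
      using zs summable_on_subset_banach by (auto simp: has_sum_iff)
    have "norm (real_dirichlet f s - (\<Prod>p\<in>?S. 1 / (1 - h p))) \<le> (\<Sum>\<^sub>\<infinity>n\<in>UNIV-?A. real n powr - s)"
    proof (rule norm_infsum_le[OF D])
      show "((\<lambda>n. real n powr - s) has_sum (\<Sum>\<^sub>\<infinity>n\<in>UNIV-?A. real n powr - s)) (UNIV-?A)"
        by (rule has_sum_infsum[OF sm'])
      show "norm (h n) \<le> real n powr - s" for n
        using mult_left_mono[OF le[of n], of "real n powr - s"] by (simp add: h_def)
    qed
    also have "\<dots> = (\<Sum>\<^sub>\<infinity>n\<in>UNIV-?A-{0}. real n powr - s)"
      by (rule infsum_cong_neutral) auto
    also have "\<dots> \<le> (\<Sum>\<^sub>\<infinity>n\<in>UNIV-{..<Suc N}. real n powr - s)"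
      by (intro infsum_mono2 sm' sub) auto
    also have "\<dots> = Z - (\<Sum>n<Suc N. real n powr - s)" using Z by (rule infsumI)
    finally show ?thesis .
  qed
  have "(\<lambda>N. Z - (\<Sum>n<Suc N. real n powr - s)) \<longlonglongrightarrow> Z - Z"
    using summable_LIMSEQ[OF sm] unfolding Z_def
    by (intro tendsto_diff tendsto_const) (rule LIMSEQ_Suc)
  hence lim: "(\<lambda>N. Z - (\<Sum>n<Suc N. real n powr - s)) \<longlonglongrightarrow> 0" by simp
  have "(\<lambda>N. real_dirichlet f s - (\<Prod>p\<in>primes_le N. 1 / (1 - h p))) \<longlonglongrightarrow> 0"
    by (rule Lim_null_comparison[OF always_eventually lim]) (use bound in auto)
  from tendsto_minus[OF this]
  have "(\<lambda>N. (\<Prod>p\<in>primes_le N. 1 / (1 - h p)) - real_dirichlet f s) \<longlonglongrightarrow> 0" by simp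
  thus ?thesis by (simp add: h_def LIM_zero_iff)
qed

subsection \<open>Dirichlet characters\<close>

lemma
  assumes "dcharacter q chi"
  shows dcharacter_mult: "chi (m * n) = chi m * chi n"
    and dcharacter_add: "chi (n + q) = chi n"
    and dcharacter_eq_0_iff: "chi n = 0 \<longleftrightarrow> \<not> coprime n q"
  using assms unfolding dcharacter_def by blast+

lemma dcharacter_1 [simp]:
  assumes "dcharacter q chi"
  shows "chi (Suc 0) = 1"
  using dcharacter_mult[OF assms, of 1 1] dcharacter_eq_0_iff[OF assms, of 1] by auto

lemma dcharacter_add_mult:
  assumes "dcharacter q chi"
  shows "chi (n + q * k) = chi n"
  by (induction k) (use dcharacter_add[OF assms, of "n + q * k" for k] in \<open>auto simp: algebra_simps\<close>)

lemma dcharacter_mod: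
  assumes "dcharacter q chi"
  shows "chi (n mod q) = chi n"
  using dcharacter_add_mult[OF assms, of "n mod q" "n div q"] by (simp add: mult.commute)

lemma dcharacter_cong:
  assumes "dcharacter q chi" "[m = n] (mod q)"
  shows "chi m = chi n"
  using assms(2) dcharacter_mod[OF assms(1), of m] dcharacter_mod[OF assms(1), of n]
  by (simp add: cong_def)

lemma dcharacter_power:
  assumes "dcharacter q chi"
  shows "chi (n ^ k) = chi n ^ k"
  by (induction k) (use assms in \<open>auto simp: dcharacter_mult[OF assms]\<close>)

lemma dcharacter_power_totient:
  assumes "dcharacter q chi" "coprime n q"
  shows "chi n ^ totient q = 1"
proof -
  have "chi n ^ totient q = chi (n ^ totient q)"
    by (rule dcharacter_power[OF assms(1), symmetric])
  also have "\<dots> = chi 1"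
    by (rule dcharacter_cong[OF assms(1)]) (rule euler_theorem[OF assms(2)])
  finally show ?thesis using assms(1) by simp
qed

lemma norm_dcharacter:
  assumes "dcharacter q chi" "q > 0" "coprime n q"
  shows "norm (chi n) = 1"
proof -
  have "norm (chi n) ^ totient q = 1"
    using dcharacter_power_totient[OF assms(1,3)] by (metis norm_one norm_power)
  moreover have "totient q > 0" using assms(2) by simp
  ultimately show ?thesis by (metis norm_ge_zero power_eq_1_iff power_eq_imp_eq_base power_one zero_le_one)
qed

lemma norm_dcharacter_le:
  assumes "dcharacter q chi" "q > 0"
  shows "norm (chi n) \<le> 1"
  using norm_dcharacter[OF assms] dcharacter_eq_0_iff[OF assms(1), of n] by (cases "coprime n q") auto

text \<open>A character is determined by its values on 0, ..., q - 1, and each value is 0 or a root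
  of unity of order dividing phi(q).\<close>

lemma finite_dcharacters:
  assumes "q > 0"
  shows "finite (dcharacters q)"
proof -
  let ?R = "insert 0 {z :: complex. z ^ totient q = 1}"
  have "finite {z :: complex. z ^ totient q = 1}"
    using assms finite_roots_unity[of "totient q"] by (simp add: Suc_le_eq)
  hence "finite (PiE {..<q} (\<lambda>_. ?R))" by (intro finite_PiE) auto
  moreover have "chi n \<in> ?R" if "dcharacter q chi" for chi n
    using dcharacter_power_totient[OF that] dcharacter_eq_0_iff[OF that] by auto
  hence "(\<lambda>chi. restrict chi {..<q}) ` dcharacters q \<subseteq> PiE {..<q} (\<lambda>_. ?R)"
    unfolding dcharacters_def by (intro image_subsetI PiE_I) (simp_all only: restrict_apply mem_Collect_eq if_True if_False)
  ultimately have "finite ((\<lambda>chi. restrict chi {..<q}) ` dcharacters q)"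
    by (rule rev_finite_subset)
  moreover have "inj_on (\<lambda>chi. restrict chi {..<q}) (dcharacters q)"
  proof (rule inj_onI, rule ext)
    fix chi chi' n
    assume chi: "chi \<in> dcharacters q" "chi' \<in> dcharacters q" and "restrict chi {..<q} = restrict chi' {..<q}"
    hence "restrict chi {..<q} (n mod q) = restrict chi' {..<q} (n mod q)" by simp
    hence "chi (n mod q) = chi' (n mod q)" using assms by simp
    thus "chi n = chi' n"
      using chi dcharacter_mod[of q chi n] dcharacter_mod[of q chi' n] by (simp add: dcharacters_def)
  qed
  ultimately show ?thesis by (rule finite_imageD)
qed

lemma dcharacter_cnj: "dcharacter q chi \<Longrightarrow> dcharacter q (\<lambda>n. cnj (chi n))"
  by (auto simp: dcharacter_def)

lemma dcharacter_times:
  "dcharacter q chi \<Longrightarrow> dcharacter q chi' \<Longrightarrow> dcharacter q (\<lambda>n. chi n * chi' n)"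
  by (auto simp: dcharacter_def)

definition principal_dcharacter :: "nat \<Rightarrow> nat \<Rightarrow> complex" where
  "principal_dcharacter q n = (if coprime n q then 1 else 0)"

lemma dcharacter_principal: "dcharacter q (principal_dcharacter q)"
proof -
  have "coprime (n + q) q = coprime n q" for n by (simp only: coprime_iff_gcd_eq_1 gcd_add1)
  thus ?thesis unfolding dcharacter_def principal_dcharacter_def by simp
qed

lemma dcharacter_times_cnj:
  assumes "dcharacter q chi" "q > 0"
  shows "chi n * cnj (chi n) = principal_dcharacter q n"
  using norm_dcharacter[OF assms, of n] dcharacter_eq_0_iff[OF assms(1), of n]
  by (auto simp: principal_dcharacter_def complex_norm_square[symmetric])

lemma dcharacter_times_principal:
  assumes "dcharacter q chi"
  shows "chi n * principal_dcharacter q n = chi n"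
  using dcharacter_eq_0_iff[OF assms, of n] by (auto simp: principal_dcharacter_def)

text \<open>The part of orthogonality that positivity requires. If every character is 1 at n, the
  sum counts them; if some psi has psi(n) different from 1 and nonzero, multiplication by psi
  permutes the characters and multiplies the sum by psi(n), so the sum is 0.\<close>

lemma sum_dcharacters_nonneg:
  assumes "q > 0"
  shows "\<exists>r\<ge>0. (\<Sum>chi\<in>dcharacters q. chi n) = of_real r"
proof (cases "\<forall>chi\<in>dcharacters q. chi n = 1 \<or> \<not> coprime n q")
  case True
  show ?thesis
  proof (cases "coprime n q")
    case True
    with \<open>\<forall>chi\<in>dcharacters q. chi n = 1 \<or> \<not> coprime n q\<close>
    have "(\<Sum>chi\<in>dcharacters q. chi n) = (\<Sum>chi\<in>dcharacters q. 1)" by (intro sum.cong) auto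
    hence "(\<Sum>chi\<in>dcharacters q. chi n) = of_real (real (card (dcharacters q)))" by simp
    thus ?thesis by (intro exI[of _ "real (card (dcharacters q))"]) auto
  next
    case False
    hence "(\<Sum>chi\<in>dcharacters q. chi n) = of_real 0"
      using dcharacter_eq_0_iff[of q _ n] by (auto simp: dcharacters_def intro!: sum.neutral)
    thus ?thesis by blast
  qed
next
  case False
  then obtain psi where psi: "dcharacter q psi" "psi n \<noteq> 1" "coprime n q" by (auto simp: dcharacters_def)
  have canc: "cnj (psi m) * (psi m * chi m) = chi m" "psi m * (cnj (psi m) * chi m) = chi m"
    if "dcharacter q chi" for chi m
  proof -
    have "psi m * cnj (psi m) * chi m = chi m"
      unfolding dcharacter_times_cnj[OF psi(1) assms] using dcharacter_times_principal[OF that, of m]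
      by (simp only: mult.commute)
    thus "cnj (psi m) * (psi m * chi m) = chi m" "psi m * (cnj (psi m) * chi m) = chi m"
      by (simp_all only: mult_ac)
  qed
  have "(\<Sum>chi\<in>dcharacters q. chi n) = (\<Sum>chi\<in>dcharacters q. psi n * chi n)"
  proof (rule sum.reindex_bij_witness[of _ "\<lambda>chi m. psi m * chi m" "\<lambda>chi m. cnj (psi m) * chi m"])
    fix chi assume "chi \<in> dcharacters q"
    hence chi: "dcharacter q chi" by (simp add: dcharacters_def)
    show "(\<lambda>m. psi m * (cnj (psi m) * chi m)) = chi" "(\<lambda>m. cnj (psi m) * (psi m * chi m)) = chi"
      "psi n * (cnj (psi n) * chi n) = chi n"
      using canc[OF chi] by auto
    show "(\<lambda>m. cnj (psi m) * chi m) \<in> dcharacters q" "(\<lambda>m. psi m * chi m) \<in> dcharacters q"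
      using dcharacter_times[OF psi(1) chi] dcharacter_times[OF dcharacter_cnj[OF psi(1)] chi]
      by (simp_all add: dcharacters_def)
  qed
  also have "\<dots> = psi n * (\<Sum>chi\<in>dcharacters q. chi n)" by (simp only: sum_distrib_left)
  finally have "(1 - psi n) * (\<Sum>chi\<in>dcharacters q. chi n) = 0" by (simp add: left_diff_distrib)
  hence "(\<Sum>chi\<in>dcharacters q. chi n) = of_real 0" using psi by simp
  thus ?thesis by blast
qed

text \<open>For m coprime to q with chi(m) different from 1, multiplication by m permutes the
  residues and multiplies the sum by chi(m).\<close>

lemma sum_dcharacter_period:
  assumes "dcharacter q chi" "q > 0" "chi \<noteq> principal_dcharacter q"
  shows "(\<Sum>n<q. chi n) = 0"
proof -
  obtain m where m: "chi m \<noteq> principal_dcharacter q m" using assms(3) by auto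
  hence cop: "coprime m q" and "chi m \<noteq> 1"
    using dcharacter_eq_0_iff[OF assms(1), of m] by (auto simp: principal_dcharacter_def split: if_splits)
  have inj: "inj_on (\<lambda>n. (m * n) mod q) {..<q}"
  proof (rule inj_onI)
    fix a b assume "a \<in> {..<q}" "b \<in> {..<q}" "(m * a) mod q = (m * b) mod q"
    hence "[m * a = m * b] (mod q)" "a < q" "b < q" by (auto simp: cong_def)
    thus "a = b" using cop by (simp add: cong_mult_lcancel_nat coprime_commute cong_less_modulus_unique_nat)
  qed
  moreover have "(\<lambda>n. (m * n) mod q) ` {..<q} \<subseteq> {..<q}" using assms(2) by auto
  ultimately have "bij_betw (\<lambda>n. (m * n) mod q) {..<q} {..<q}"
    by (metis bij_betw_def endo_inj_surj finite_lessThan)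
  hence "(\<Sum>n<q. chi n) = (\<Sum>n<q. chi ((m * n) mod q))"
    by (rule sum.reindex_bij_betw[symmetric])
  also have "\<dots> = chi m * (\<Sum>n<q. chi n)"
    by (simp add: dcharacter_mod[OF assms(1)] dcharacter_mult[OF assms(1)] sum_distrib_left)
  finally show ?thesis using \<open>chi m \<noteq> 1\<close> by simp
qed

text \<open>The partial sums from 0 are q-periodic, hence bounded by q in norm; a block is a
  difference of two of them.\<close>

lemma norm_sum_dcharacter_le:
  assumes "dcharacter q chi" "q > 0" "chi \<noteq> principal_dcharacter q"
  shows "norm (\<Sum>n=a..b. chi n) \<le> 2 * real q"
proof -
  define F where "F n = (\<Sum>i<n. chi i)" for n
  have F_add: "F (q + n) = F n" for n
  proof (induction n)
    case 0 thus ?case using sum_dcharacter_period[OF assms] by (simp add: F_def)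
  next
    case (Suc n) thus ?case using dcharacter_add[OF assms(1), of n] by (simp add: F_def add.commute)
  qed
  have "F (q * k + n) = F n" for k n
    by (induction k) (use F_add in \<open>auto simp: add.assoc\<close>)
  from this[of "n div q" "n mod q" for n] have F_mod: "F n = F (n mod q)" for n by simp
  have F_le: "norm (F n) \<le> real q" for n
  proof -
    have "norm (F (n mod q)) \<le> (\<Sum>i<n mod q. 1)"
      unfolding F_def by (intro sum_norm_le norm_dcharacter_le[OF assms(1,2)])
    also have "\<dots> \<le> real q" using assms(2) by (simp add: less_imp_le)
    finally show ?thesis using F_mod[of n] by simp
  qed
  show ?thesis
  proof (cases "a \<le> b")
    case True
    have "F (Suc b) = F a + (\<Sum>n=a..b. chi n)"
      using True unfolding F_def by (induction b rule: dec_induct) auto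
    hence "norm (\<Sum>n=a..b. chi n) = norm (F (Suc b) - F a)" by simp
    also have "\<dots> \<le> real q + real q" by (rule order.trans[OF norm_triangle_ineq4]) (intro add_mono F_le)
    finally show ?thesis by simp
  qed auto
qed

section \<open>Tails of series from bounds on blocks, and zeta near 1\<close>

text \<open>The Cauchy criterion with a rate: since \<open>g a\<close> does not depend on the right
  end of the block, the same bound survives for the infinite tail. This is how the O(1/ln X) tails
  of the conditionally convergent series over primes are obtained.\<close>

lemma summable_block_bound:
  fixes f :: "nat \<Rightarrow> 'a :: banach" and g :: "nat \<Rightarrow> real"
  assumes block: "\<And>a b. n0 \<le> a \<Longrightarrow> norm (\<Sum>i=a..b. f i) \<le> g a" and lim: "g \<longlonglongrightarrow> 0"
  shows "summable f" and "\<And>a. n0 \<le> a \<Longrightarrow> norm (suminf f - (\<Sum>i<a. f i)) \<le> g a"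
proof -
  have part: "norm (\<Sum>i\<in>{a..<b}. f i) \<le> g a" if "n0 \<le> a" for a b
  proof (cases b)
    case 0
    thus ?thesis using order.trans[OF norm_ge_zero block[OF that]] by simp
  next
    case (Suc b')
    thus ?thesis using block[OF that, of b'] by (simp add: atLeastLessThanSuc_atLeastAtMost)
  qed
  show sm: "summable f"
    unfolding summable_Cauchy
  proof (intro allI impI)
    fix e :: real assume "e > 0"
    hence "eventually (\<lambda>n. g n < e) sequentially" using lim by (intro order_tendstoD) auto
    hence "eventually (\<lambda>n. g n < e \<and> n0 \<le> n) sequentially"
      by (intro eventually_conj eventually_ge_at_top)
    then obtain N where "\<And>n. n \<ge> N \<Longrightarrow> g n < e \<and> n0 \<le> n" by (auto simp: eventually_at_top_linorder)
    thus "\<exists>N. \<forall>m\<ge>N. \<forall>n. norm (\<Sum>i = m..<n. f i) < e"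
      using part by (meson le_less_trans)
  qed
  fix a assume a: "n0 \<le> a"
  have "(\<lambda>b. (\<Sum>i<b. f i) - (\<Sum>i<a. f i)) \<longlonglongrightarrow> suminf f - (\<Sum>i<a. f i)"
    using summable_LIMSEQ[OF sm] by (rule tendsto_diff[OF _ tendsto_const])
  hence lim': "(\<lambda>b. norm ((\<Sum>i<b. f i) - (\<Sum>i<a. f i))) \<longlonglongrightarrow> norm (suminf f - (\<Sum>i<a. f i))"
    by (rule tendsto_norm)
  have "norm ((\<Sum>i<b. f i) - (\<Sum>i<a. f i)) \<le> g a" if "b \<ge> a" for b
    using sum_diff_nat_ivl[of 0 a b f] that part[OF a, of b] by (simp add: atLeast0LessThan)
  thus "norm (suminf f - (\<Sum>i<a. f i)) \<le> g a"
    by (intro LIMSEQ_le_const2[OF lim']) blast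
qed

lemma abel_summable:
  fixes c :: "nat \<Rightarrow> 'a :: banach" and f :: "nat \<Rightarrow> real"
  assumes C: "\<And>a b. n0 \<le> a \<Longrightarrow> norm (\<Sum>i=a..b. c i) \<le> K"
    and dec: "\<And>n. n0 \<le> n \<Longrightarrow> f (Suc n) \<le> f n" and lim: "f \<longlonglongrightarrow> 0"
  shows "summable (\<lambda>i. f i *\<^sub>R c i)"
    and "\<And>a. n0 \<le> a \<Longrightarrow> norm ((\<Sum>i. f i *\<^sub>R c i) - (\<Sum>i<a. f i *\<^sub>R c i)) \<le> K * f a"
proof -
  have "K \<ge> 0" using C[of n0 n0] norm_ge_zero order.trans by blast
  have mono: "f m \<le> f n" if "n0 \<le> n" "n \<le> m" for n m
    using that(2)
  proof (induction m rule: dec_induct)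
    case (step m)
    thus ?case using dec[of m] that(1) by linarith
  qed simp
  have nonneg: "f n \<ge> 0" if "n0 \<le> n" for n
    by (rule LIMSEQ_le_const2[OF lim]) (use mono that in blast)
  have block: "norm (\<Sum>i=a..b. f i *\<^sub>R c i) \<le> K * f a" if "n0 \<le> a" for a b
  proof (cases "a \<le> b")
    case True
    thus ?thesis using that by (intro abel_sum_bound C dec nonneg) auto
  qed (use \<open>K \<ge> 0\<close> nonneg[OF that] in auto)
  have lim': "(\<lambda>n. K * f n) \<longlonglongrightarrow> 0" using tendsto_mult[OF tendsto_const lim] by simp
  note * = summable_block_bound[where g = "\<lambda>n. K * f n", OF block lim']
  show "summable (\<lambda>i. f i *\<^sub>R c i)" by (rule *(1))
  show "norm ((\<Sum>i. f i *\<^sub>R c i) - (\<Sum>i<a. f i *\<^sub>R c i)) \<le> K * f a" if "n0 \<le> a" for a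
    by (rule *(2)[OF _ that])
qed

text \<open>Regroups a double sum over (d, m) by the product n = d m. It is used for Lambert series
  and for products of Dirichlet series.\<close>

lemma has_sum_divisors:
  fixes h :: "nat \<times> nat \<Rightarrow> 'a :: {topological_comm_monoid_add, t3_space}"
  assumes "(h has_sum S) ({1..} \<times> {1..})"
  shows "((\<lambda>n. \<Sum>d | d dvd n. h (d, n div d)) has_sum S) {1..}"
proof -
  have "bij_betw (\<lambda>(n, d). (d, n div d)) (SIGMA n:{1::nat..}. {d. d dvd n}) ({1::nat..} \<times> {1::nat..})"
  proof (rule bij_betw_byWitness[where f' = "\<lambda>(d, m). (d * m, d)"])
    show "(\<lambda>(n, d). (d, n div d)) ` (SIGMA n:{1..}. {d. d dvd n}) \<subseteq> {1::nat..} \<times> {1::nat..}"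
    proof
      fix x :: "nat \<times> nat" assume "x \<in> (\<lambda>(n, d). (d, n div d)) ` (SIGMA n:{1..}. {d. d dvd n})"
      then obtain n d where x: "x = (d, n div d)" "n \<ge> 1" "d dvd n" by auto
      hence "d * (n div d) > 0" by simp
      thus "x \<in> {1..} \<times> {1..}" using x(1) by (simp add: Suc_le_eq del: div_greater_zero_iff)
    qed
  qed (auto simp: Suc_le_eq)
  from has_sum_reindex_bij_betw[OF this, of h S] assms
  have "((\<lambda>(n, d). h (d, n div d)) has_sum S) (SIGMA n:{1..}. {d. d dvd n})"
    by (simp add: case_prod_unfold)
  thus ?thesis
  proof (rule has_sum_SigmaD)
    fix n :: nat assume "n \<in> {1..}"
    thus "((\<lambda>d. case (n, d) of (n, d) \<Rightarrow> h (d, n div d)) has_sum (\<Sum>d | d dvd n. h (d, n div d))) {d. d dvd n}"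
      by (auto intro!: has_sum_finite)
  qed
qed

lemma powr_neg_diff_bounds:
  fixes d :: real
  assumes "d > 0" "n \<ge> 1"
  shows "real n powr - d - real (Suc n) powr - d \<le> d * real n powr - (1 + d)"
    and "d * real (Suc n) powr - (1 + d) \<le> real n powr - d - real (Suc n) powr - d"
proof -
  have "\<exists>z. real n < z \<and> z < real (Suc n) \<and> real (Suc n) powr - d - real n powr - d =
      (real (Suc n) - real n) * (- d * z powr (- d - 1))"
    using assms by (intro MVT2) (auto intro!: derivative_eq_intros simp: powr_diff)
  then obtain z where z: "real n < z" "z < real (Suc n)"
    "real n powr - d - real (Suc n) powr - d = d * z powr (- d - 1)"
    by (auto simp: algebra_simps)
  have "z powr - (1 + d) \<le> real n powr - (1 + d)" "real (Suc n) powr - (1 + d) \<le> z powr - (1 + d)"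
    using z assms by (auto intro!: powr_mono2')
  hence "d * z powr - (1 + d) \<le> d * real n powr - (1 + d)" "d * real (Suc n) powr - (1 + d) \<le> d * z powr - (1 + d)"
    using assms by (auto intro!: mult_left_mono)
  moreover have "real n powr - d - real (Suc n) powr - d = d * z powr - (1 + d)"
  proof -
    have "- (1 + d) = - d - 1" by simp
    thus ?thesis using z(3) by (simp only:)
  qed
  ultimately show "real n powr - d - real (Suc n) powr - d \<le> d * real n powr - (1 + d)"
     "d * real (Suc n) powr - (1 + d) \<le> real n powr - d - real (Suc n) powr - d"
    by (simp_all only:)
qed

text \<open>Comparison with the telescoping series of (n^(-d) - (n+1)^(-d)) / d, whose sum is 1/d;
  this is the simple pole of zeta at 1 seen from the right.\<close>

lemma zeta_real_bounds:
  fixes d :: real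
  assumes "d > 0"
  shows "(\<Sum>n. real n powr - (1 + d)) \<le> 1 + 1 / d" "1 / d \<le> (\<Sum>n. real n powr - (1 + d))"
proof -
  define u where "u n = real n powr - (1 + d)" for n
  define t where "t n = real (Suc n) powr - d" for n
  have sm: "summable u" unfolding u_def using assms by (simp add: summable_real_powr_iff)
  hence sm1: "summable (\<lambda>n. u (Suc n))" by (subst summable_Suc_iff)
  hence sm2: "summable (\<lambda>n. u (Suc (Suc n)))" by (subst summable_Suc_iff)
  have "t \<longlonglongrightarrow> 0" unfolding t_def using assms by real_asymp
  from sums_divide[OF telescope_sums'[OF this], of d]
  have tel: "(\<lambda>n. (t n - t (Suc n)) / d) sums (1 / d)" by (simp add: t_def)
  hence tsm: "summable (\<lambda>n. (t n - t (Suc n)) / d)" and tsum: "(\<Sum>n. (t n - t (Suc n)) / d) = 1 / d"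
    by (auto simp: sums_iff)
  have le1: "(t n - t (Suc n)) / d \<le> u (Suc n)" and le2: "u (Suc (Suc n)) \<le> (t n - t (Suc n)) / d" for n
    using powr_neg_diff_bounds[OF assms, of "Suc n"] assms
    unfolding u_def t_def by (simp_all add: field_simps del: of_nat_Suc)
  have "suminf u = (\<Sum>n. u (Suc n))" using suminf_split_head[OF sm] by (simp add: u_def)
  moreover have "(\<Sum>n. u (Suc n)) = (\<Sum>n. u (Suc (Suc n))) + 1"
    using suminf_split_head[OF sm1] by (simp add: u_def)
  moreover have "(\<Sum>n. u (Suc (Suc n))) \<le> 1 / d"
    unfolding tsum[symmetric] by (intro suminf_le le2 sm2 tsm)
  moreover have "1 / d \<le> (\<Sum>n. u (Suc n))"
    unfolding tsum[symmetric] by (intro suminf_le le1 sm1 tsm)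
  ultimately show "(\<Sum>n. real n powr - (1 + d)) \<le> 1 + 1 / d" "1 / d \<le> (\<Sum>n. real n powr - (1 + d))"
    unfolding u_def[symmetric] by linarith+
qed

subsection \<open>Nonvanishing of \<open>L(1,\<chi>)\<close>\<close>

definition L_one :: "(nat \<Rightarrow> complex) \<Rightarrow> complex" where
  "L_one chi = (\<Sum>n. (1 / real n) *\<^sub>R chi n)"

lemma L_one_summable:
  assumes "dcharacter q chi" "q > 0" "chi \<noteq> principal_dcharacter q"
  shows "summable (\<lambda>n. (1 / real n) *\<^sub>R chi n)"
    and "a \<ge> 1 \<Longrightarrow> norm (L_one chi - (\<Sum>n<a. (1 / real n) *\<^sub>R chi n)) \<le> 2 * real q * (1 / real a)"
proof -
  have lim: "(\<lambda>n. 1 / real n) \<longlonglongrightarrow> 0" by real_asymp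
  have dec: "1 / real (Suc n) \<le> 1 / real n" if "1 \<le> n" for n
    using that by (intro divide_left_mono) auto
  note * = abel_summable[of 1 chi "2 * real q" "\<lambda>n. 1 / real n", OF norm_sum_dcharacter_le[OF assms] dec lim]
  show "summable (\<lambda>n. (1 / real n) *\<^sub>R chi n)" by (rule *(1))
  show "norm (L_one chi - (\<Sum>n<a. (1 / real n) *\<^sub>R chi n)) \<le> 2 * real q * (1 / real a)" if "a \<ge> 1"
    unfolding L_one_def by (rule *(2)[OF _ that])
qed

lemma norm_real_dirichlet_principal_le:
  assumes "d > 0" "q > 0"
  shows "norm (real_dirichlet (principal_dcharacter q) (1 + d)) \<le> 1 + 1 / d"
proof -
  have "norm (real_dirichlet (principal_dcharacter q) (1 + d)) \<le> (\<Sum>n. real n powr - (1 + d))"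
    unfolding real_dirichlet_def
  proof (rule norm_suminf_le)
    show "summable (\<lambda>n. real n powr - (1 + d))" using assms by (simp add: summable_real_powr_iff)
  qed (auto simp: principal_dcharacter_def)
  thus ?thesis using zeta_real_bounds(1)[OF assms(1)] by linarith
qed

lemma norm_real_dirichlet_nonprincipal_le:
  assumes "dcharacter q chi" "q > 0" "chi \<noteq> principal_dcharacter q" "d > 0"
  shows "norm (real_dirichlet chi (1 + d)) \<le> 2 * real q"
proof -
  have "norm ((\<Sum>i. (real i powr - (1 + d)) *\<^sub>R chi i) - (\<Sum>i<1. (real i powr - (1 + d)) *\<^sub>R chi i))
    \<le> 2 * real q * (real 1 powr - (1 + d))"
  proof (intro abel_summable[of 1] norm_sum_dcharacter_le assms)
    show "(\<lambda>n. real n powr - (1 + d)) \<longlonglongrightarrow> 0" using assms by real_asymp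
  qed (use assms in \<open>auto intro!: powr_mono2'\<close>)
  thus ?thesis by (simp add: real_dirichlet_def)
qed

text \<open>If L(1,chi) = 0, the partial sums of chi(i)/i are minus the tails and hence O(1/n).
  Partial summation against i^(-d), whose increments are at most d/i, then leaves d times a
  convergent sum of 1/i^2: a zero at 1 has order at least one.\<close>

lemma norm_real_dirichlet_zero_le:
  assumes "dcharacter q chi" "q > 0" "chi \<noteq> principal_dcharacter q" "L_one chi = 0"
  obtains C where "C > 0" "\<And>d. d > 0 \<Longrightarrow> norm (real_dirichlet chi (1 + d)) \<le> C * d"
proof
  define Z where "Z = (\<Sum>n. 1 / real n ^ 2)"
  have smZ: "summable (\<lambda>n. 1 / real n ^ 2)"
    using inverse_power_summable[of 2, where ?'a = real] by (simp add: divide_inverse)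
  show "2 * real q * Z + 1 > 0"
    using assms unfolding Z_def by (intro add_nonneg_pos mult_nonneg_nonneg suminf_nonneg smZ) auto
  fix d :: real assume "d > 0"
  define M where "M n = (\<Sum>i=1..n. (1 / real i) *\<^sub>R chi i)" for n
  have M_le: "norm (M n) \<le> 2 * real q / real n" if "n \<ge> 1" for n
  proof -
    have "(\<Sum>i<Suc n. (1 / real i) *\<^sub>R chi i) = M n"
      unfolding M_def lessThan_Suc_atMost by (rule sum.mono_neutral_right) auto
    hence "norm (M n) \<le> 2 * real q * (1 / real (Suc n))"
      using L_one_summable(2)[OF assms(1-3), of "Suc n"] assms(4) by simp
    also have "\<dots> \<le> 2 * real q / real n" using that by (simp add: field_simps)
    finally show ?thesis .
  qed
  have part: "norm (\<Sum>i<Suc N. (real i powr - (1 + d)) *\<^sub>R chi i) \<le> 2 * real q * Z * d + 2 * real q / real N" if "N \<ge> 1" for N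
  proof -
    have "(\<Sum>i<Suc N. (real i powr - (1 + d)) *\<^sub>R chi i) = (\<Sum>i=1..N. (real i powr - (1 + d)) *\<^sub>R chi i)"
      unfolding lessThan_Suc_atMost by (rule sum.mono_neutral_right) auto
    also have "\<dots> = (\<Sum>i=1..N. (real i powr - d) *\<^sub>R ((1 / real i) *\<^sub>R chi i))"
      by (intro sum.cong refl) (simp add: powr_diff powr_minus field_simps powr_add)
    also have "\<dots> = (\<Sum>i\<in>{1..<N}. (real i powr - d - real (Suc i) powr - d) *\<^sub>R M i) + (real N powr - d) *\<^sub>R M N"
      unfolding M_def by (rule abel_summation[OF that])
    also have "norm \<dots> \<le> (\<Sum>i\<in>{1..<N}. 2 * real q * d * (1 / real i ^ 2)) + 2 * real q / real N"
    proof (rule order.trans[OF norm_triangle_ineq], rule add_mono)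
      show "norm (\<Sum>i\<in>{1..<N}. (real i powr - d - real (Suc i) powr - d) *\<^sub>R M i) \<le> (\<Sum>i\<in>{1..<N}. 2 * real q * d * (1 / real i ^ 2))"
      proof (rule sum_norm_le)
        fix i assume i: "i \<in> {1..<N}"
        have "real i powr - d - real (Suc i) powr - d \<le> d * real i powr - (1 + d)"
          using i \<open>d > 0\<close> by (intro powr_neg_diff_bounds) auto
        also have "\<dots> \<le> d * real i powr - 1"
          using i \<open>d > 0\<close> by (intro mult_left_mono powr_mono) auto
        also have "\<dots> = d / real i" using i by (simp add: powr_minus divide_inverse)
        finally have "real i powr - d - real (Suc i) powr - d \<le> d / real i" .
        moreover have "real (Suc i) powr - d \<le> real i powr - d"
          using i \<open>d > 0\<close> by (intro powr_mono2') auto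
        ultimately have "\<bar>real i powr - d - real (Suc i) powr - d\<bar> * norm (M i) \<le> (d / real i) * (2 * real q / real i)"
          using i \<open>d > 0\<close> by (intro mult_mono M_le) auto
        thus "norm ((real i powr - d - real (Suc i) powr - d) *\<^sub>R M i) \<le> 2 * real q * d * (1 / real i ^ 2)"
          by (simp add: power2_eq_square mult_ac)
      qed
      have "real N powr - d \<le> real N powr 0" using that \<open>d > 0\<close> by (intro powr_mono) auto
      hence "\<bar>real N powr - d\<bar> * norm (M N) \<le> 1 * (2 * real q / real N)"
        using that by (intro mult_mono M_le) auto
      thus "norm ((real N powr - d) *\<^sub>R M N) \<le> 2 * real q / real N" by simp
    qed
    also have "(\<Sum>i\<in>{1..<N}. 2 * real q * d * (1 / real i ^ 2)) \<le> 2 * real q * d * Z"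
      unfolding sum_distrib_left[symmetric] Z_def using \<open>d > 0\<close>
      by (intro mult_left_mono sum_le_suminf smZ) auto
    finally show ?thesis by (simp add: mult_ac)
  qed
  have "summable (\<lambda>n. (real n powr - (1 + d)) *\<^sub>R chi n)"
    using real_dirichlet_has_sum(1)[of "1 + d" chi] \<open>d > 0\<close> norm_dcharacter_le[OF assms(1,2)]
    by (auto intro: summable_norm_cancel[OF summable_on_imp_summable])
  hence "(\<lambda>N. \<Sum>i<Suc N. (real i powr - (1 + d)) *\<^sub>R chi i) \<longlonglongrightarrow> real_dirichlet chi (1 + d)"
    unfolding real_dirichlet_def by (rule LIMSEQ_Suc[OF summable_LIMSEQ])
  hence "(\<lambda>N. norm (\<Sum>i<Suc N. (real i powr - (1 + d)) *\<^sub>R chi i)) \<longlonglongrightarrow> norm (real_dirichlet chi (1 + d))"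
    by (rule tendsto_norm)
  moreover have "(\<lambda>N. 2 * real q * Z * d + 2 * real q / real N) \<longlonglongrightarrow> 2 * real q * Z * d" by real_asymp
  moreover have "\<exists>N. \<forall>n\<ge>N. norm (\<Sum>i<Suc n. (real i powr - (1 + d)) *\<^sub>R chi i) \<le> 2 * real q * Z * d + 2 * real q / real n"
    using part by blast
  ultimately have "norm (real_dirichlet chi (1 + d)) \<le> 2 * real q * Z * d" by (rule LIMSEQ_le)
  also have "\<dots> \<le> (2 * real q * Z + 1) * d" using \<open>d > 0\<close> by (simp add: algebra_simps)
  finally show "norm (real_dirichlet chi (1 + d)) \<le> (2 * real q * Z + 1) * d" .
qed

text \<open>The summation may start at j = 0 because that term is z^0 / 0 = 0. The same convention
  is behind \<open>log_fps\<close> and \<open>log_series\<close>.\<close>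

lemma Ln_one_minus_sums:
  fixes z :: complex
  assumes "norm z < 1"
  shows "(\<lambda>j. z ^ j / of_nat j) sums (- Ln (1 - z))"
proof -
  have "(\<lambda>n. (-1) ^ Suc n / of_nat n * (- z) ^ n) sums Ln (1 + - z)"
    by (rule Ln_series) (use assms in simp)
  from sums_minus[OF this] have "(\<lambda>n. - ((-1) ^ Suc n / of_nat n * (- z) ^ n)) sums (- Ln (1 - z))"
    by simp
  moreover have "- ((-1) ^ Suc n / of_nat n * (- z) ^ n) = z ^ n / of_nat n" for n
    by (cases "even n") auto
  ultimately show ?thesis by (simp only:)
qed

text \<open>Minus the logarithm of the product is the sum over j of x^j / j times the sum of
  chi(n^j) over all characters, and every such character sum is nonnegative.\<close>

lemma prod_dcharacters_local_le_1:
  assumes "q > 0" "0 \<le> x" "x < 1"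
  shows "(\<Prod>chi\<in>dcharacters q. norm (1 - x *\<^sub>R chi n)) \<le> 1"
    and "(\<Prod>chi\<in>dcharacters q. norm (1 - x *\<^sub>R chi n)) > 0"
proof -
  define z where "z chi = x *\<^sub>R (chi n :: complex)" for chi
  have z: "norm (z chi) < 1" if "chi \<in> dcharacters q" for chi
  proof -
    have "x * norm (chi n) \<le> x * 1"
      using that assms by (intro mult_left_mono norm_dcharacter_le) (auto simp: dcharacters_def)
    thus ?thesis using assms by (simp add: z_def)
  qed
  have nz: "1 - z chi \<noteq> 0" if "chi \<in> dcharacters q" for chi using z[OF that] by auto
  have sums: "(\<lambda>j. Re (\<Sum>chi\<in>dcharacters q. z chi ^ j / of_nat j)) sums Re (\<Sum>chi\<in>dcharacters q. - Ln (1 - z chi))"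
    by (intro sums_Re sums_sum Ln_one_minus_sums z)
  have nonneg: "0 \<le> Re (\<Sum>chi\<in>dcharacters q. z chi ^ j / of_nat j)" for j
  proof -
    obtain r where r: "r \<ge> 0" "(\<Sum>chi\<in>dcharacters q. chi (n ^ j)) = of_real r"
      using sum_dcharacters_nonneg[OF assms(1)] by blast
    have "(\<Sum>chi\<in>dcharacters q. z chi ^ j / of_nat j) = (\<Sum>chi\<in>dcharacters q. of_real (x ^ j / real j) * chi (n ^ j))"
      by (intro sum.cong refl) (simp add: z_def dcharacters_def dcharacter_power scaleR_conv_of_real power_mult_distrib)
    also have "\<dots> = of_real (x ^ j / real j * r)"
      unfolding sum_distrib_left[symmetric] r(2) by simp
    finally have eq: "(\<Sum>chi\<in>dcharacters q. z chi ^ j / of_nat j) = of_real (x ^ j / real j * r)" .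
    show ?thesis unfolding eq using r(1) assms by simp
  qed
  have "0 \<le> Re (\<Sum>chi\<in>dcharacters q. - Ln (1 - z chi))"
    by (rule sums_le[OF nonneg sums_zero sums])
  hence le: "(\<Sum>chi\<in>dcharacters q. Re (Ln (1 - z chi))) \<le> 0"
    by (simp only: sum_negf uminus_complex.sel Re_sum neg_0_le_iff_le)
  have "(\<Prod>chi\<in>dcharacters q. norm (1 - z chi)) = (\<Prod>chi\<in>dcharacters q. exp (Re (Ln (1 - z chi))))"
    by (intro prod.cong refl) (metis exp_Ln norm_exp_eq_Re nz)
  also have "\<dots> = exp (\<Sum>chi\<in>dcharacters q. Re (Ln (1 - z chi)))"
    by (rule exp_sum[symmetric]) (rule finite_dcharacters[OF assms(1)])
  finally show "(\<Prod>chi\<in>dcharacters q. norm (1 - x *\<^sub>R chi n)) \<le> 1"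
    "(\<Prod>chi\<in>dcharacters q. norm (1 - x *\<^sub>R chi n)) > 0"
    using le by (simp_all add: z_def)
qed

lemma prod_real_dirichlet_ge_1:
  assumes "q > 0" "s > 1"
  shows "1 \<le> (\<Prod>chi\<in>dcharacters q. norm (real_dirichlet chi s))"
proof -
  have lim: "(\<lambda>N. \<Prod>chi\<in>dcharacters q. norm (\<Prod>p\<in>primes_le N. 1 / (1 - (real p powr - s) *\<^sub>R chi p)))
     \<longlonglongrightarrow> (\<Prod>chi\<in>dcharacters q. norm (real_dirichlet chi s))"
    using assms
    by (intro tendsto_prod tendsto_norm euler_product_tendsto)
      (auto simp: dcharacters_def dcharacter_mult norm_dcharacter_le)
  show ?thesis
  proof (rule LIMSEQ_le_const[OF lim], intro exI allI impI)
    fix N :: nat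
    have "(\<Prod>chi\<in>dcharacters q. norm (\<Prod>p\<in>primes_le N. 1 / (1 - (real p powr - s) *\<^sub>R chi p))) =
      (\<Prod>chi\<in>dcharacters q. \<Prod>p\<in>primes_le N. 1 / norm (1 - (real p powr - s) *\<^sub>R chi p))"
      by (intro prod.cong refl) (simp add: prod_norm[symmetric] norm_divide)
    also have "\<dots> = (\<Prod>p\<in>primes_le N. \<Prod>chi\<in>dcharacters q. 1 / norm (1 - (real p powr - s) *\<^sub>R chi p))"
      by (rule prod.swap)
    also have "\<dots> \<ge> 1"
    proof (rule prod_ge_1)
      fix p assume "p \<in> primes_le N"
      hence "p > 1" by (auto simp: primes_le_def prime_gt_Suc_0_nat)
      hence "real p powr - s < real p powr 0" using \<open>s > 1\<close> by (intro powr_less_mono) auto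
      hence "real p powr - s < 1" using \<open>p > 1\<close> by simp
      from prod_dcharacters_local_le_1[OF assms(1) _ this, of p]
      show "1 \<le> (\<Prod>chi\<in>dcharacters q. 1 / norm (1 - (real p powr - s) *\<^sub>R chi p))"
        by (simp add: prod_dividef)
    qed
    finally show "1 \<le> (\<Prod>chi\<in>dcharacters q. norm (\<Prod>p\<in>primes_le N. 1 / (1 - (real p powr - s) *\<^sub>R chi p)))" .
  qed
qed

lemma L_one_cnj:
  assumes "dcharacter q chi" "q > 0" "chi \<noteq> principal_dcharacter q"
  shows "L_one (\<lambda>n. cnj (chi n)) = cnj (L_one chi)"
proof -
  have "(\<lambda>n. (1 / real n) *\<^sub>R chi n) sums L_one chi"
    unfolding L_one_def by (rule summable_sums[OF L_one_summable(1)[OF assms]])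
  hence "(\<lambda>n. cnj ((1 / real n) *\<^sub>R chi n)) sums cnj (L_one chi)" by (simp only: sums_cnj)
  thus ?thesis unfolding L_one_def by (simp add: sums_iff scaleR_conv_of_real)
qed

text \<open>If \<open>L(1,\<chi>) = 0\<close> for a nonreal character, then \<open>L(s,\<chi>)\<close> and its conjugate both vanish
  at 1, which the simple pole of the principal factor cannot compensate.\<close>

lemma L_one_nonzero_nonreal:
  assumes chi: "dcharacter q chi" "q > 0" and nonreal: "(\<lambda>n. cnj (chi n)) \<noteq> chi"
  shows "L_one chi \<noteq> 0"
proof
  assume L0: "L_one chi = 0"
  let ?chi' = "\<lambda>n. cnj (chi n)" and ?chi0 = "principal_dcharacter q"
  have np: "chi \<noteq> ?chi0" 
  proof
    assume "chi = ?chi0"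
    hence "(\<lambda>n. cnj (chi n)) = chi" by (simp add: fun_eq_iff principal_dcharacter_def)
    with nonreal show False by blast
  qed
  have np': "?chi' \<noteq> ?chi0"
  proof
    assume "?chi' = ?chi0"
    hence "cnj (chi n) = ?chi0 n" for n by metis
    hence "chi n = cnj (?chi0 n)" for n by (metis complex_cnj_cnj)
    thus False using np by (auto simp: principal_dcharacter_def fun_eq_iff split: if_splits)
  qed
  have chi': "dcharacter q ?chi'" by (rule dcharacter_cnj[OF chi(1)])
  have L0': "L_one ?chi' = 0" using L_one_cnj[OF chi np] L0 by simp
  obtain C where C: "C > 0" "\<And>d. d > 0 \<Longrightarrow> norm (real_dirichlet chi (1 + d)) \<le> C * d"
    using norm_real_dirichlet_zero_le[OF chi np L0] by blast
  obtain C' where C': "C' > 0" "\<And>d. d > 0 \<Longrightarrow> norm (real_dirichlet ?chi' (1 + d)) \<le> C' * d"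
    using norm_real_dirichlet_zero_le[OF chi' chi(2) np' L0'] by blast
  \<comment> \<open>The remaining characters are nonprincipal, so each contributes a factor of norm
    at most 2q.\<close>
  define R where "R = dcharacters q - {?chi0, chi, ?chi'}"
  define K where "K = (2 * real q) ^ card R"
  have fin: "finite (dcharacters q)" by (rule finite_dcharacters[OF chi(2)])
  have split: "(\<Prod>psi\<in>dcharacters q. g psi) = g ?chi0 * (g chi * (g ?chi' * (\<Prod>psi\<in>R. g psi)))"
    for g :: "(nat \<Rightarrow> complex) \<Rightarrow> real"
  proof -
    have "dcharacters q = insert ?chi0 (insert chi (insert ?chi' R))"
      using chi chi' dcharacter_principal[of q] by (auto simp: R_def dcharacters_def)
    moreover have "finite R" using fin by (simp add: R_def)
    moreover have "?chi' \<notin> R" "chi \<notin> insert ?chi' R" "?chi0 \<notin> insert chi (insert ?chi' R)"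
      using np np' nonreal[symmetric] by (auto simp: R_def simp del: fun_eq_iff)
    ultimately show ?thesis by (metis (no_types, lifting) finite_insert prod.insert)
  qed
  have K: "K > 0" using chi by (simp add: K_def)
  have main: "1 \<le> (1 + 1 / d) * (C * d * (C' * d * K))" if "d > 0" for d
  proof -
    have "1 \<le> (\<Prod>psi\<in>dcharacters q. norm (real_dirichlet psi (1 + d)))"
      using that chi by (intro prod_real_dirichlet_ge_1) auto
    also have "\<dots> \<le> (1 + 1 / d) * (C * d * (C' * d * K))"
      unfolding split
    proof (intro mult_mono norm_real_dirichlet_principal_le C C' that chi)
      show "(\<Prod>psi\<in>R. norm (real_dirichlet psi (1 + d))) \<le> K"
        unfolding K_def by (intro prod_le_power norm_real_dirichlet_nonprincipal_le)
          (use that chi in \<open>auto simp: R_def dcharacters_def intro!: norm_real_dirichlet_nonprincipal_le\<close>)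
    qed (use that C C' K in \<open>auto intro!: mult_nonneg_nonneg prod_nonneg\<close>)
    finally show ?thesis .
  qed
  \<comment> \<open>With d <= 1 the right side of \<open>main\<close> is at most 2 d C C' K, which
    this choice makes less than 1/2.\<close>
  define d where "d = 1 / (1 + 4 * C * C' * K)"
  have D: "4 * C * C' * K > 0" using C(1) C'(1) K by (intro mult_pos_pos) auto
  have d: "d > 0" "d \<le> 1" unfolding d_def using D by (simp_all only: divide_le_eq_1 zero_less_divide_1_iff) linarith+
  have "(1 + 1 / d) * (C * d * (C' * d * K)) = C * C' * K * (d * d + d)"
    using d by (simp add: field_simps)
  also have "\<dots> \<le> C * C' * K * (d + d)"
    using d C(1) C'(1) K by (intro mult_left_mono add_right_mono) (auto intro: mult_left_le)
  also have "\<dots> < 1"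
  proof -
    have "0 < C * C' * K" using C(1) C'(1) K by simp
    thus ?thesis by (simp add: d_def field_simps)
  qed
  finally show False using main[OF d(1)] by simp
qed

text \<open>Monsky's argument: if \<open>L(1,\<chi>) = 0\<close> for a real character, then \<open>\<Sum> \<chi>(n) x^n / (1 - x^n)\<close>
  stays bounded as \<open>x \<rightarrow> 1\<close>, since the weights below decrease to 0; but its power series has
  nonnegative coefficients, infinitely many of which are 1.\<close>

definition monsky_weight :: "real \<Rightarrow> nat \<Rightarrow> real" where
  "monsky_weight x n = 1 / (real n * (1 - x)) - x ^ n / (1 - x ^ n)"

text \<open>The arithmetic-geometric mean inequality for the terms i and n - 1 - i, whose product is
  always y^(2(n-1)). Writing the base as a square avoids half-integral powers.\<close>

lemma geometric_sum_ge:
  fixes y :: real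
  assumes "y \<ge> 0"
  shows "real n * y ^ (n - 1) \<le> (\<Sum>i<n. (y ^ 2) ^ i)"
proof -
  have "2 * (\<Sum>i<n. (y ^ 2) ^ i) = (\<Sum>i<n. (y ^ 2) ^ i) + (\<Sum>i<n. (y ^ 2) ^ (n - Suc i))"
    by (simp add: sum.nat_diff_reindex[of "\<lambda>i. (y ^ 2) ^ i"])
  also have "\<dots> = (\<Sum>i<n. (y ^ i) ^ 2 + (y ^ (n - Suc i)) ^ 2)"
    by (simp add: sum.distrib power_mult[symmetric] mult.commute)
  also have "\<dots> \<ge> (\<Sum>i<n. 2 * y ^ (n - 1))"
  proof (rule sum_mono)
    fix i assume "i \<in> {..<n}"
    hence "y ^ (n - 1) = y ^ i * y ^ (n - Suc i)" by (simp add: power_add[symmetric])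
    thus "2 * y ^ (n - 1) \<le> (y ^ i) ^ 2 + (y ^ (n - Suc i)) ^ 2"
      using sum_squares_bound[of "y ^ i" "y ^ (n - Suc i)"] by simp
  qed
  finally show ?thesis by simp
qed

text \<open>Put S_m = 1 + x + ... + x^(m-1). Up to the factor 1/(1 - x) the weight is 1/n - x^n /
  S_n; here 1/n drops by 1/(n (n+1)) and x^n / S_n drops by x^n / (S_n S_(n+1)). So the claim is n
  (n+1) x^n <= S_n S_(n+1), which follows from two instances of \<open>geometric_sum_ge\<close> with
  y = sqrt x.\<close>

lemma monsky_weight_decreasing:
  assumes x: "0 < x" "x < 1" and "n \<ge> 1"
  shows "monsky_weight x (Suc n) \<le> monsky_weight x n"
proof -
  define S where "S n = (\<Sum>i<n. x ^ i)" for n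
  have S: "1 - x ^ m = (1 - x) * S m" for m
    using x by (simp add: S_def sum_gp_strict)
  have S_pos: "S m > 0" if "m \<ge> 1" for m
    unfolding S_def using that x by (intro sum_pos) (auto simp: lessThan_empty_iff)
  define y where "y = sqrt x"
  have y: "y \<ge> 0" "y ^ 2 = x" "y \<le> 1" using x by (auto simp: y_def)
  have "(real n * y ^ (n - 1)) * (real (Suc n) * y ^ (Suc n - 1)) \<le> S n * S (Suc n)"
    unfolding S_def y(2)[symmetric] using y by (intro mult_mono geometric_sum_ge sum_nonneg) auto
  moreover have "x ^ n \<le> y ^ (n - 1) * y ^ n"
  proof -
    have "x ^ n = y ^ (n + n)" unfolding y(2)[symmetric] by (simp add: power_mult[symmetric] mult_2)
    also have "\<dots> \<le> y ^ (n - 1 + n)" using y by (intro power_decreasing) auto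
    finally show ?thesis by (simp add: power_add)
  qed
  ultimately have key: "real n * real (Suc n) * x ^ n \<le> S n * S (Suc n)"
    using mult_left_mono[of "x ^ n" "y ^ (n - 1) * y ^ n" "real n * real (Suc n)"] by (simp add: mult_ac)
  have "x ^ n / (S n * S (Suc n)) \<le> 1 / (real n * real (Suc n))"
  proof -
    have "a / D \<le> 1 / E" if "E * a \<le> D" "D > 0" "E > 0" for a D E :: real
      using that by (simp add: field_simps)
    from this[OF key] show ?thesis using assms S_pos[of n] S_pos[of "Suc n"] by simp
  qed
  moreover have "x ^ n / S n - x ^ Suc n / S (Suc n) = x ^ n / (S n * S (Suc n))"
  proof -
    have "S (Suc n) - x * S n = 1"
      unfolding S_def sum.lessThan_Suc_shift by (simp add: sum_distrib_left)
    hence "x ^ n * S (Suc n) - x ^ Suc n * S n = x ^ n"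
    proof -
      have "x ^ n * S (Suc n) - x ^ Suc n * S n = x ^ n * (S (Suc n) - x * S n)" by (simp add: algebra_simps)
      thus ?thesis using \<open>S (Suc n) - x * S n = 1\<close> by simp
    qed
    thus ?thesis using S_pos[of n] S_pos[of "Suc n"] assms by (simp add: diff_frac_eq mult_ac)
  qed
  moreover have "1 / real n - 1 / real (Suc n) = 1 / (real n * real (Suc n))"
    using assms by (simp add: field_simps)
  ultimately have "1 / real (Suc n) - x ^ Suc n / S (Suc n) \<le> 1 / real n - x ^ n / S n" by linarith
  hence "(1 / real (Suc n) - x ^ Suc n / S (Suc n)) / (1 - x) \<le> (1 / real n - x ^ n / S n) / (1 - x)"
    using x by (intro divide_right_mono) auto
  moreover have "monsky_weight x m = (1 / real m - x ^ m / S m) / (1 - x)" for m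
    unfolding monsky_weight_def S by (simp add: diff_divide_distrib mult.commute)
  ultimately show ?thesis by simp
qed

lemma monsky_weight_1: "0 < x \<Longrightarrow> x < 1 \<Longrightarrow> monsky_weight x 1 = 1"
  by (simp add: monsky_weight_def field_simps)

lemma monsky_weight_tendsto_0:
  assumes "0 < x" "x < 1"
  shows "monsky_weight x \<longlonglongrightarrow> 0"
proof -
  have p: "(\<lambda>n. x ^ n) \<longlonglongrightarrow> 0" using assms by (intro LIMSEQ_power_zero) auto
  have q: "(\<lambda>n. 1 / (real n * (1 - x))) \<longlonglongrightarrow> 0" using assms by real_asymp
  have "(\<lambda>n. 1 / (real n * (1 - x)) - x ^ n / (1 - x ^ n)) \<longlonglongrightarrow> 0 - 0 / (1 - 0)"
    by (rule tendsto_diff[OF q tendsto_divide[OF p tendsto_diff[OF tendsto_const p]]]) simp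
  thus ?thesis unfolding monsky_weight_def[abs_def] by simp
qed

lemma sum_divisors_mult_coprime:
  fixes f :: "nat \<Rightarrow> 'a :: comm_monoid_add"
  assumes "coprime a b" "a > 0" "b > 0"
  shows "(\<Sum>d | d dvd a * b. f d) = (\<Sum>x | x dvd a. \<Sum>y | y dvd b. f (x * y))"
proof -
  have gcds: "gcd (x * y) a = x" "gcd (x * y) b = y" if "x dvd a" "y dvd b" for x y
  proof -
    have "coprime a y" "coprime b x"
      using that assms(1) by (meson coprime_commute coprime_divisors dvd_refl)+
    thus "gcd (x * y) a = x" "gcd (x * y) b = y"
      using that by (simp_all add: gcd_mult_left_right_cancel gcd_mult_left_left_cancel gcd_nat.absorb1)
  qed
  have "(\<Sum>x | x dvd a. \<Sum>y | y dvd b. f (x * y)) = (\<Sum>(x, y)\<in>{x. x dvd a} \<times> {y. y dvd b}. f (x * y))"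
    by (rule sum.cartesian_product)
  also have "\<dots> = (\<Sum>d | d dvd a * b. f d)"
  proof (rule sum.reindex_bij_witness[of _ "\<lambda>d. (gcd d a, gcd d b)" "\<lambda>(x, y). x * y"], goal_cases)
    case (1 p)
    then show ?case using gcds by auto
  next
    case (3 d)
    then obtain x y where "d = x * y" "x dvd a" "y dvd b" using division_decomp[of d a b] by auto
    thus ?case using gcds by auto
  qed (auto intro: mult_dvd_mono)
  finally show ?thesis ..
qed

lemma sum_divisors_prime_power:
  fixes f :: "nat \<Rightarrow> 'a :: comm_monoid_add"
  assumes "prime p"
  shows "(\<Sum>d | d dvd p ^ k. f d) = (\<Sum>i\<le>k. f (p ^ i))"
proof -
  have "{d. d dvd p ^ k} = (\<lambda>i. p ^ i) ` {..k}"
    using assms divides_primepow_nat[OF assms] by (auto simp: image_iff)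
  moreover have "inj_on (\<lambda>i. p ^ i) {..k}"
    using prime_gt_1_nat[OF assms] by (auto simp: inj_on_def)
  ultimately show ?thesis by (simp add: sum.reindex)
qed

lemma sum_powers_nonneg:
  fixes t :: real
  assumes "\<bar>t\<bar> \<le> 1"
  shows "(\<Sum>i\<le>k. t ^ i) \<ge> 0"
proof (cases "t \<ge> 0")
  case False
  have "\<bar>t ^ Suc k\<bar> \<le> 1" using assms power_le_one[of "\<bar>t\<bar>" "Suc k"] by (simp only: power_abs abs_ge_zero)
  hence "1 - t ^ Suc k \<ge> 0" by linarith
  thus ?thesis using False by (simp add: sum_gp0)
qed (auto intro: sum_nonneg)

text \<open>The divisor sum is multiplicative, and at a prime power it is a finite geometric sum
  with ratio f(p) in [-1, 1].\<close>

lemma sum_divisors_multiplicative_nonneg: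
  fixes f :: "nat \<Rightarrow> real"
  assumes mult: "\<And>m n. f (m * n) = f m * f n" "f 1 = 1" and le: "\<And>n. \<bar>f n\<bar> \<le> 1" and "n > 0"
  shows "(\<Sum>d | d dvd n. f d) \<ge> 0"
  using \<open>n > 0\<close>
proof (induction n rule: less_induct)
  case (less n)
  show ?case
  proof (cases "n = 1")
    case True thus ?thesis using mult(2) by simp
  next
    case False
    then obtain p where p: "prime p" "p dvd n" using prime_factor_nat by blast
    define k where "k = multiplicity p n"
    obtain m where m: "n = p ^ k * m" "\<not> p dvd m"
      unfolding k_def using less.prems p by (metis multiplicity_decompose' not_prime_unit less_numeral_extra(3))
    have "k > 0" using m p by (cases k) auto
    hence "p ^ k > 1" using prime_gt_1_nat[OF p(1)] by (intro one_less_power) auto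
    hence "m < n" "m > 0" using m less.prems by (auto intro!: Nat.gr0I)
    have "coprime (p ^ k) m" using p m by (simp add: prime_imp_coprime_nat)
    hence "(\<Sum>d | d dvd n. f d) = (\<Sum>x | x dvd p ^ k. \<Sum>y | y dvd m. f (x * y))"
      unfolding m(1) using \<open>m > 0\<close> prime_gt_0_nat[OF p(1)] by (intro sum_divisors_mult_coprime) auto
    also have "\<dots> = (\<Sum>i\<le>k. f p ^ i) * (\<Sum>y | y dvd m. f y)"
      by (simp add: sum_divisors_prime_power[OF p(1)] mult sum_product
        completely_multiplicative_prod_power(1)[of f, OF mult])
    also have "\<dots> \<ge> 0"
      using le \<open>m < n\<close> \<open>m > 0\<close> less.IH by (intro mult_nonneg_nonneg sum_powers_nonneg) auto
    finally show ?thesis .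
  qed
qed

text \<open>Expanding x^n / (1 - x^n) geometrically and collecting the exponents n j gives one value
  G for the Lambert series and for the power series with divisor sums as coefficients.\<close>

lemma lambert_series_sums:
  fixes a :: "nat \<Rightarrow> real"
  assumes x: "0 < x" "x < 1" and le: "\<And>n. \<bar>a n\<bar> \<le> 1"
  obtains G where "(\<lambda>n. a (Suc n) * (x ^ Suc n / (1 - x ^ Suc n))) sums G"
    "((\<lambda>n. (\<Sum>d | d dvd n. a d) * x ^ n) has_sum G) {1..}"
proof -
  define h where "h = (\<lambda>(n, j). a n * x ^ (n * j))"
  have geo: "((\<lambda>j. (x ^ n) ^ j) has_sum (x ^ n / (1 - x ^ n))) {1..}" if "n \<ge> 1" for n
    using has_sum_geometric_from_1[of "x ^ n"] x that by (auto simp: power_less_one_iff)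
  have pow_less: "x ^ n < 1" if "n \<ge> 1" for n using x that by (simp add: power_less_one_iff)
  have "(\<lambda>n. x ^ n) summable_on {1..}"
    using has_sum_geometric_from_1[of x] x by (auto simp: has_sum_iff)
  hence bnd: "(\<lambda>n. x ^ n * (1 / (1 - x))) summable_on {1..}" by (rule summable_on_cmult_left)
  have "(\<lambda>(n, j). (x ^ n) ^ j) summable_on {1..} \<times> {1..}"
  proof (rule summable_on_SigmaI)
    show "((\<lambda>y. case (n, y) of (n, j) \<Rightarrow> (x ^ n) ^ j) has_sum (x ^ n / (1 - x ^ n))) {1..}" if "n \<in> {1..}" for n
      using geo[of n] that by simp
    show "(\<lambda>n. x ^ n / (1 - x ^ n)) summable_on {1..}"
    proof (rule summable_on_comparison_test[OF bnd])
      fix n :: nat assume n: "n \<in> {1..}"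
      have "x ^ n \<le> x ^ 1" using n x by (intro power_decreasing) auto
      thus "x ^ n / (1 - x ^ n) \<le> x ^ n * (1 / (1 - x))"
        using x by (auto intro!: divide_left_mono mult_pos_pos)
      show "0 \<le> x ^ n / (1 - x ^ n)" using pow_less[of n] n x by auto
    qed
  qed (use x in auto)
  hence "(\<lambda>p. norm (h p)) summable_on {1..} \<times> {1..}"
    by (rule summable_on_comparison_test)
      (use le x in \<open>auto simp: h_def abs_mult power_mult intro!: mult_left_le_one_le\<close>)
  hence "h summable_on {1..} \<times> {1..}" by (rule abs_summable_summable)
  then obtain G where G: "(h has_sum G) ({1..} \<times> {1..})" by (auto simp: summable_on_def)
  have "((\<lambda>n. a n * (x ^ n / (1 - x ^ n))) has_sum G) {1..}"
  proof (rule has_sum_SigmaD[OF G])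
    fix n :: nat assume "n \<in> {1..}"
    thus "((\<lambda>j. h (n, j)) has_sum (a n * (x ^ n / (1 - x ^ n)))) {1..}"
      using has_sum_cmult_right[OF geo[of n], of "a n"] by (simp add: h_def power_mult)
  qed
  moreover have "bij_betw Suc UNIV {1..}" by (rule bij_betwI[of _ _ _ "\<lambda>n. n - 1"]) auto
  ultimately have "((\<lambda>n. a (Suc n) * (x ^ Suc n / (1 - x ^ Suc n))) has_sum G) UNIV"
    using has_sum_reindex_bij_betw[of Suc UNIV "{1..}" "\<lambda>n. a n * (x ^ n / (1 - x ^ n))" G] by simp
  hence 1: "(\<lambda>n. a (Suc n) * (x ^ Suc n / (1 - x ^ Suc n))) sums G" by (rule has_sum_imp_sums)
  have "((\<lambda>n. \<Sum>d | d dvd n. h (d, n div d)) has_sum G) {1..}" by (rule has_sum_divisors[OF G])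
  moreover have "(\<Sum>d | d dvd n. h (d, n div d)) = (\<Sum>d | d dvd n. a d) * x ^ n" for n
    unfolding sum_distrib_right by (intro sum.cong) (auto simp: h_def)
  ultimately show ?thesis using that 1 by simp
qed

lemma L_one_nonzero_real:
  assumes chi: "dcharacter q chi" "q > 0" "chi \<noteq> principal_dcharacter q" and real: "(\<lambda>n. cnj (chi n)) = chi"
  shows "L_one chi \<noteq> 0"
proof
  assume L0: "L_one chi = 0"
  define a where "a n = Re (chi n)" for n
  have cnj: "cnj (chi n) = chi n" for n using real by metis
  have chi_a: "chi n = of_real (a n)" for n
    unfolding a_def using cnj[of n] by (metis complex_cnj_cancel_iff complex_is_Real_iff of_real_Re Reals_cnj_iff)
  have a_mult: "a (m * n) = a m * a n" for m n
    using dcharacter_mult[OF chi(1), of m n] unfolding chi_a by (metis of_real_eq_iff of_real_mult)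
  have a_1: "a 1 = 1" using dcharacter_1[OF chi(1)] by (simp add: a_def)
  have a_le: "\<bar>a n\<bar> \<le> 1" for n
    using norm_dcharacter_le[OF chi(1,2), of n] unfolding chi_a by simp
  have "q \<noteq> 1"
  proof
    assume "q = 1"
    hence "chi n = chi 1" for n by (intro dcharacter_cong[OF chi(1)]) (simp add: cong_def)
    hence "chi = principal_dcharacter q"
      using \<open>q = 1\<close> dcharacter_1[OF chi(1)] by (auto simp: principal_dcharacter_def fun_eq_iff)
    with chi(3) show False by blast
  qed
  then obtain p where p: "prime p" "p dvd q" using prime_factor_nat by blast
  have a_p: "a (p ^ i) = 0" if "i > 0" for i
  proof -
    have "\<not> coprime (p ^ i) q" using p that by (auto simp: coprime_commute[of q] prime_imp_coprime_nat dest: coprime_common_divisor_nat)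
    thus ?thesis using dcharacter_eq_0_iff[OF chi(1), of "p ^ i"] by (simp add: a_def)
  qed
  \<comment> \<open>The values of chi vanish at the positive powers of p, so only the divisor 1
    counts. This gives the infinitely many coefficients equal to 1.\<close>
  have c_p: "(\<Sum>d | d dvd p ^ i. a d) = 1" for i
  proof -
    have "(\<Sum>d | d dvd p ^ i. a d) = (\<Sum>j\<le>i. a (p ^ j))" by (rule sum_divisors_prime_power[OF p(1)])
    also have "\<dots> = (\<Sum>j\<in>{0}. a (p ^ j))" by (rule sum.mono_neutral_right) (auto simp: a_p)
    finally show ?thesis using a_1 by simp
  qed
  have c_nonneg: "(\<Sum>d | d dvd n. a d) \<ge> 0" if "n > 0" for n
    by (rule sum_divisors_multiplicative_nonneg) (use a_mult a_1 a_le that in auto)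
  have block: "norm (\<Sum>i=m..n. a i) \<le> 2 * real q" for m n
  proof -
    have "norm (\<Sum>i=m..n. chi i) \<le> 2 * real q" by (rule norm_sum_dcharacter_le[OF chi])
    thus ?thesis unfolding chi_a by (simp flip: of_real_sum)
  qed
  \<comment> \<open>K powers of p, each contributing at least 1/2, give 2q + 1, which exceeds the
    bound 2q for the weighted sum. The point x is then chosen so that x^(p^K) is exactly
    1/2.\<close>
  define K where "K = 4 * q + 2"
  have pK: "p ^ K > 0" using prime_gt_0_nat[OF p(1)] by simp
  define x where "x = root (p ^ K) (1 / 2)"
  have x: "0 < x" "x < 1" using pK by (simp_all add: x_def)
  have xK: "x ^ (p ^ K) = 1 / 2" using pK by (simp add: x_def)
  obtain G where G: "(\<lambda>n. a (Suc n) * (x ^ Suc n / (1 - x ^ Suc n))) sums G"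
    "((\<lambda>n. (\<Sum>d | d dvd n. a d) * x ^ n) has_sum G) {1..}"
    using lambert_series_sums[OF x, of a] a_le by blast
  have G_ge: "2 * real q + 1 \<le> G"
  proof -
    have inj: "inj_on (\<lambda>i. p ^ i) {1..K}" using prime_gt_1_nat[OF p(1)] by (auto simp: inj_on_def)
    have "2 * real q + 1 = (\<Sum>i=1..K. 1 / 2)" by (simp add: K_def)
    also have "\<dots> \<le> (\<Sum>i=1..K. x ^ (p ^ i))"
      unfolding xK[symmetric] using x prime_gt_0_nat[OF p(1)]
      by (intro sum_mono power_decreasing power_increasing) auto
    also have "\<dots> = (\<Sum>i=1..K. (\<Sum>d | d dvd p ^ i. a d) * x ^ (p ^ i))" by (simp add: c_p)
    also have "\<dots> = (\<Sum>n\<in>(\<lambda>i. p ^ i) ` {1..K}. (\<Sum>d | d dvd n. a d) * x ^ n)"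
      by (subst sum.reindex[OF inj]) simp
    also have "\<dots> \<le> G"
      by (rule finite_sum_le_has_sum[OF G(2)])
        (use x c_nonneg prime_gt_0_nat[OF p(1)] in \<open>auto simp: Suc_le_eq\<close>)
    finally show ?thesis .
  qed
  note abel = abel_summable[of 1 a "2 * real q" "monsky_weight x",
      OF block monsky_weight_decreasing[OF x] monsky_weight_tendsto_0[OF x]]
  have w: "norm ((\<Sum>i. monsky_weight x i *\<^sub>R a i) - (\<Sum>i<1. monsky_weight x i *\<^sub>R a i)) \<le> 2 * real q * monsky_weight x 1"
    by (rule abel(2)) auto
  have w_sm: "summable (\<lambda>i. monsky_weight x i *\<^sub>R a i)"
    by (rule abel(1))
  have "(\<lambda>n. (1 / real n) *\<^sub>R chi n) sums 0"
    using summable_sums[OF L_one_summable(1)[OF chi]] L0 by (simp add: L_one_def)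
  hence "(\<lambda>n. (1 / real n) * a n) sums 0"
    by (subst sums_of_real_iff[symmetric, where ?'a = complex]) (simp add: chi_a scaleR_conv_of_real)
  hence "(\<lambda>n. (1 / real (Suc n)) * a (Suc n)) sums 0"
    using sums_Suc_iff[of "\<lambda>n. (1 / real n) * a n" 0] by simp
  \<comment> \<open>Since L(1,chi) = 0, the part a(n) / (n (1 - x)) of the weights sums to 0, and
    only minus the Lambert series is left.\<close>
  from sums_diff[OF sums_divide[OF this, of "1 - x"] G(1)]
  have "(\<lambda>n. monsky_weight x (Suc n) * a (Suc n)) sums (- G)"
    by (simp add: monsky_weight_def algebra_simps)
  moreover have "(\<Sum>i. monsky_weight x i *\<^sub>R a i) - (\<Sum>i<1. monsky_weight x i *\<^sub>R a i) = (\<Sum>n. monsky_weight x (Suc n) * a (Suc n))"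
    using suminf_split_head[OF w_sm] by simp
  ultimately have "\<bar>- G\<bar> \<le> 2 * real q"
    using w monsky_weight_1[OF x] by (simp add: sums_iff)
  with G_ge show False by linarith
qed

theorem L_one_nonzero:
  assumes "dcharacter q chi" "q > 0" "chi \<noteq> principal_dcharacter q"
  shows "L_one chi \<noteq> 0"
  using L_one_nonzero_real[OF assms] L_one_nonzero_nonreal[OF assms(1,2)] by blast

subsection \<open>Primes weighted by characters\<close>

text \<open>Summing \<open>\<chi>(n) ln n / n\<close>, with \<open>ln = \<Lambda> * 1\<close>, gives \<open>L(1,\<chi>) \<Sum> \<chi>(d) \<Lambda>(d) / d\<close> up to a
  bounded error.\<close>

lemma mangoldt_dcharacter_sum_bounded:
  assumes chi: "dcharacter q chi" "q > 0" "chi \<noteq> principal_dcharacter q"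
  obtains B where "\<And>N. norm (\<Sum>n=1..N. (mangoldt n / real n) *\<^sub>R chi n) \<le> B"
proof -
  define f where "f n = ln (real n) / real n" for n
  \<comment> \<open>The decrease of ln n / n relies on ln n >= 1, hence the start at 3 > e.\<close>
  have f_dec: "f (Suc n) \<le> f n" if "3 \<le> n" for n
  proof -
    have "ln (real n * (1 + 1 / real n)) = ln (real n) + ln (1 + 1 / real n)"
      using that by (intro ln_mult_pos) (auto intro: add_pos_nonneg)
    moreover have "real n * (1 + 1 / real n) = real (Suc n)" using that by (simp add: field_simps)
    ultimately have "ln (real (Suc n)) = ln (real n) + ln (1 + 1 / real n)" by simp
    also have "ln (1 + 1 / real n) \<le> 1 / real n" by (rule ln_add_one_self_le_self) simp
    finally have "real n * ln (real (Suc n)) \<le> real n * (ln (real n) + 1 / real n)"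
      using that by (intro mult_left_mono) auto
    also have "\<dots> = real n * ln (real n) + 1" using that by (simp add: field_simps)
    also have "1 \<le> ln (real n)"
      using that exp_le by (subst ln_ge_iff) auto
    finally have "real n * ln (real (Suc n)) \<le> real (Suc n) * ln (real n)" by (simp add: algebra_simps)
    thus ?thesis using that by (simp add: f_def field_simps)
  qed
  have "f \<longlonglongrightarrow> 0" unfolding f_def by real_asymp
  hence "summable (\<lambda>n. f n *\<^sub>R chi n)"
    using abel_summable(1)[of 3 chi "2 * real q" f, OF norm_sum_dcharacter_le[OF chi] f_dec] by simp
  hence "Bseq (\<lambda>N. \<Sum>n<N. f n *\<^sub>R chi n)"
    by (intro convergent_imp_Bseq) (simp add: summable_iff_convergent)
  then obtain B1 where B1: "\<And>N. norm (\<Sum>n<N. f n *\<^sub>R chi n) \<le> B1" by (auto simp: Bseq_def)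
  define S where "S N = (\<Sum>n=1..N. (mangoldt n / real n) *\<^sub>R chi n)" for N
  have main: "norm (L_one chi * S N) \<le> B1 + 16 * real q" for N
  proof (cases "N = 0")
    case True
    thus ?thesis using B1[of 0] by (simp add: S_def)
  next
    case False
    have "(\<Sum>n<Suc N. f n *\<^sub>R chi n) = (\<Sum>n=1..N. f n *\<^sub>R chi n)"
      unfolding lessThan_Suc_atMost by (rule sum.mono_neutral_right) (auto simp: f_def)
    also have "\<dots> = (\<Sum>n=1..N. \<Sum>d | d dvd n. ((mangoldt d / real d) *\<^sub>R chi d) * ((1 / real (n div d)) *\<^sub>R chi (n div d)))"
    proof (intro sum.cong refl)
      fix n assume n: "n \<in> {1..N}"
      have "(\<Sum>d | d dvd n. ((mangoldt d / real d) *\<^sub>R chi d) * ((1 / real (n div d)) *\<^sub>R chi (n div d))) =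
        (\<Sum>d | d dvd n. (mangoldt d / real n) *\<^sub>R chi n)"
      proof (intro sum.cong refl)
        fix d assume "d \<in> {d. d dvd n}"
        then obtain m where m: "n = d * m" by auto
        hence "d > 0" "m > 0" using n by auto
        thus "((mangoldt d / real d) *\<^sub>R chi d) * ((1 / real (n div d)) *\<^sub>R chi (n div d)) = (mangoldt d / real n) *\<^sub>R chi n"
          using m by (simp add: dcharacter_mult[OF chi(1)])
      qed
      also have "\<dots> = f n *\<^sub>R chi n"
        using n by (simp add: f_def mangoldt_sum scaleR_sum_left[symmetric] sum_divide_distrib[symmetric])
      finally show "f n *\<^sub>R chi n = (\<Sum>d | d dvd n. ((mangoldt d / real d) *\<^sub>R chi d) * ((1 / real (n div d)) *\<^sub>R chi (n div d)))" ..
    qed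
    also have "\<dots> = (\<Sum>d=1..N. \<Sum>m=1..N div d. ((mangoldt d / real d) *\<^sub>R chi d) * ((1 / real m) *\<^sub>R chi m))"
      by (rule sum_divisors_swap)
    also have "\<dots> = (\<Sum>d=1..N. ((mangoldt d / real d) *\<^sub>R chi d) * (\<Sum>m=1..N div d. (1 / real m) *\<^sub>R chi m))"
      by (simp only: sum_distrib_left)
    finally have eq: "(\<Sum>n<Suc N. f n *\<^sub>R chi n) = \<dots>" .
    \<comment> \<open>Completing each inner sum to L(1,chi) costs at most 2q d / N, because N div d
      + 1 > N/d. Weighted with Lambda(d)/d the total cost is 2q psi(N) / N.\<close>
    have "L_one chi * S N - (\<Sum>n<Suc N. f n *\<^sub>R chi n) =
      (\<Sum>d=1..N. ((mangoldt d / real d) *\<^sub>R chi d) * (L_one chi - (\<Sum>m=1..N div d. (1 / real m) *\<^sub>R chi m)))"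
      unfolding eq S_def sum_distrib_left[of "L_one chi"] sum_subtractf[symmetric]
      by (intro sum.cong refl) (simp add: right_diff_distrib mult.commute)
    also have "norm \<dots> \<le> (\<Sum>d=1..N. mangoldt d / real d * (2 * real q * real d / real N))"
    proof (rule sum_norm_le)
      fix d assume d: "d \<in> {1..N}"
      have "(\<Sum>m<Suc (N div d). (1 / real m) *\<^sub>R chi m) = (\<Sum>m=1..N div d. (1 / real m) *\<^sub>R chi m)"
        unfolding lessThan_Suc_atMost by (rule sum.mono_neutral_right) auto
      hence "norm (L_one chi - (\<Sum>m=1..N div d. (1 / real m) *\<^sub>R chi m)) \<le> 2 * real q * (1 / real (Suc (N div d)))"
        using L_one_summable(2)[OF chi, of "Suc (N div d)"] by simp
      also have "\<dots> \<le> 2 * real q * (real d / real N)"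
      proof (intro mult_left_mono)
        have "N < d * Suc (N div d)" using d dividend_less_times_div[of d N] by simp
        hence "real N \<le> real d * real (Suc (N div d))" by (metis less_imp_le of_nat_le_iff of_nat_mult)
        thus "1 / real (Suc (N div d)) \<le> real d / real N" using False by (simp add: field_simps)
      qed simp
      finally have "norm (L_one chi - (\<Sum>m=1..N div d. (1 / real m) *\<^sub>R chi m)) \<le> 2 * real q * real d / real N" by simp
      moreover have "norm ((mangoldt d / real d) *\<^sub>R chi d) \<le> mangoldt d / real d"
        using mult_left_mono[OF norm_dcharacter_le[OF chi(1,2), of d], of "mangoldt d / real d"]
        by (simp add: mangoldt_nonneg)
      ultimately show "norm (((mangoldt d / real d) *\<^sub>R chi d) * (L_one chi - (\<Sum>m=1..N div d. (1 / real m) *\<^sub>R chi m)))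
         \<le> mangoldt d / real d * (2 * real q * real d / real N)"
        unfolding norm_mult by (intro mult_mono) (auto simp: mangoldt_nonneg)
    qed
    also have "\<dots> = (2 * real q / real N) * chebyshev_psi N"
      unfolding chebyshev_psi_def sum_distrib_left by (intro sum.cong) auto
    also have "\<dots> \<le> (2 * real q / real N) * (4 * real N)" by (intro mult_left_mono chebyshev_psi_le) auto
    also have "\<dots> = 8 * real q" using False by simp
    finally have "norm (L_one chi * S N - (\<Sum>n<Suc N. f n *\<^sub>R chi n)) \<le> 8 * real q" .
    hence "norm (L_one chi * S N) \<le> B1 + 8 * real q"
      using B1[of "Suc N"] norm_triangle_sub[of "L_one chi * S N" "\<Sum>n<Suc N. f n *\<^sub>R chi n"] by linarith
    thus ?thesis by simp
  qed
  \<comment> \<open>The nonvanishing of L(1,chi) enters here.\<close>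
  have "norm (S N) \<le> (B1 + 16 * real q) / norm (L_one chi)" for N
    using main[of N] L_one_nonzero[OF chi] by (simp add: norm_mult field_simps)
  thus ?thesis using that unfolding S_def by blast
qed

text \<open>The sums of chi(p) ln p / p are bounded; partial summation with the decreasing weight
  1/ln p leaves its value at the left end of the block.\<close>

lemma primes_dcharacter_sum_bound:
  assumes chi: "dcharacter q chi" "q > 0" "chi \<noteq> principal_dcharacter q"
  obtains K where "K \<ge> 0"
    "\<And>a b. a \<ge> 2 \<Longrightarrow> norm (\<Sum>p=a..b. (if prime p then 1 / real p else 0) *\<^sub>R chi p) \<le> K / ln (real a)"
proof -
  obtain B where B: "\<And>N. norm (\<Sum>n=1..N. (mangoldt n / real n) *\<^sub>R chi n) \<le> B"
    using mangoldt_dcharacter_sum_bounded[OF chi] by blast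
  define c where "c n = (if prime n then ln (real n) / real n else 0) *\<^sub>R chi n" for n
  have part: "norm (\<Sum>n=1..N. c n) \<le> B + prime_power_excess" for N
    using B[of N] sum_mangoldt_vs_primes[of chi N] norm_dcharacter_le[OF chi(1,2)]
      norm_triangle_sub[of "\<Sum>n=1..N. c n" "\<Sum>n=1..N. (mangoldt n / real n) *\<^sub>R chi n"]
    by (simp add: c_def norm_minus_commute)
  have C: "norm (\<Sum>n=a..b. c n) \<le> 2 * (B + prime_power_excess)" if "a \<ge> 1" for a b
  proof (cases "a \<le> b")
    case True
    have "(\<Sum>n=1..b. c n) = (\<Sum>n=1..a-1. c n) + (\<Sum>n=a..b. c n)"
      using True that by (subst sum.union_disjoint[symmetric]) (auto intro!: sum.cong)
    hence "norm (\<Sum>n=a..b. c n) \<le> norm (\<Sum>n=1..b. c n) + norm (\<Sum>n=1..a-1. c n)"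
      by (metis add_diff_cancel_left' norm_triangle_ineq4)
    also have "\<dots> \<le> (B + prime_power_excess) + (B + prime_power_excess)"
      by (intro add_mono part)
    finally show ?thesis by simp
  next
    case False
    thus ?thesis using order.trans[OF norm_ge_zero part[of 0]] by simp
  qed
  show ?thesis
  proof (rule that[of "2 * (B + prime_power_excess)"])
    show K: "0 \<le> 2 * (B + prime_power_excess)" using order.trans[OF norm_ge_zero C[of 1 1]] by simp
    fix a b :: nat assume a: "a \<ge> 2"
    show "norm (\<Sum>p=a..b. (if prime p then 1 / real p else 0) *\<^sub>R chi p) \<le> 2 * (B + prime_power_excess) / ln (real a)"
    proof (cases "a \<le> b")
      case True
      have "(\<Sum>p=a..b. (if prime p then 1 / real p else 0) *\<^sub>R chi p) = (\<Sum>p=a..b. (1 / ln (real p)) *\<^sub>R c p)"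
        using a by (intro sum.cong refl) (auto simp: c_def)
      also have "norm \<dots> \<le> 2 * (B + prime_power_excess) * (1 / ln (real a))"
        using True a by (intro abel_sum_bound C) (auto intro!: divide_left_mono mult_pos_pos)
      finally show ?thesis by simp
    qed (use K a in auto)
  qed
qed

subsection \<open>Mertens' third theorem\<close>

text \<open>Abel's theorem: by partial summation the power series converges uniformly on [0, 1], so
  its sum is continuous up to the end point 1.\<close>

lemma abel_power_series_limit:
  fixes r :: "nat \<Rightarrow> real"
  assumes "r sums R"
  shows "((\<lambda>x. \<Sum>m. r m * x ^ m) \<longlongrightarrow> R) (at_left 1)"
proof -
  let ?f = "\<lambda>M x. \<Sum>m<M. r m * x ^ m"
  have bound: "\<bar>\<Sum>m\<in>{a..<b}. r m * x ^ m\<bar> \<le> e"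
    if "\<And>n. a \<le> n \<Longrightarrow> \<bar>\<Sum>m=a..n. r m\<bar> \<le> e" "x \<in> {0..1}" "e \<ge> 0" for a b x e
  proof (cases "a < b")
    case True
    then obtain b' where b: "b = Suc b'" "a \<le> b'" by (cases b) auto
    have "norm (\<Sum>m=a..b'. x ^ m *\<^sub>R r m) \<le> e * x ^ a"
      using that b by (intro abel_sum_bound) (auto intro: mult_left_le_one_le)
    also have "\<dots> \<le> e * 1" using that by (intro mult_left_mono power_le_one) auto
    finally show ?thesis using b by (simp add: atLeastLessThanSuc_atLeastAtMost mult.commute)
  qed (use that in auto)
  have "uniformly_Cauchy_on {0..1} ?f"
    unfolding uniformly_Cauchy_on_def
  proof (intro allI impI)
    fix e :: real assume "e > 0"
    have "Cauchy (\<lambda>n. \<Sum>m<n. r m)"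
      using assms by (intro convergent_Cauchy) (auto simp: sums_def convergent_def)
    then obtain N where N: "\<And>m n. m \<ge> N \<Longrightarrow> n \<ge> N \<Longrightarrow> dist (\<Sum>i<m. r i) (\<Sum>i<n. r i) < e / 2"
      using \<open>e > 0\<close> by (metis Cauchy_def half_gt_zero)
    have part: "\<bar>\<Sum>m\<in>{a..<b}. r m * x ^ m\<bar> \<le> e / 2" if "a \<ge> N" "x \<in> {0..1}" for a b x
    proof (rule bound)
      fix n assume "a \<le> n"
      have "(\<Sum>i<Suc n. r i) - (\<Sum>i<a. r i) = (\<Sum>m=a..n. r m)"
        using \<open>a \<le> n\<close> by (induction n rule: dec_induct) auto
      thus "\<bar>\<Sum>m=a..n. r m\<bar> \<le> e / 2"
        using N[of "Suc n" a] that \<open>a \<le> n\<close> by (simp add: dist_real_def del: sum.lessThan_Suc)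
    qed (use that \<open>e > 0\<close> in auto)
    have ordered: "dist (?f m x) (?f n x) < e" if "x \<in> {0..1}" "m \<ge> N" "m \<le> n" for x m n
    proof -
      have "?f n x - ?f m x = (\<Sum>i\<in>{m..<n}. r i * x ^ i)"
        using sum_diff_nat_ivl[of 0 m n "\<lambda>i. r i * x ^ i"] that by (simp add: atLeast0LessThan)
      thus ?thesis using part[of m x n] that \<open>e > 0\<close> by (simp add: dist_real_def abs_minus_commute)
    qed
    show "\<exists>M. \<forall>x\<in>{0..1}. \<forall>m\<ge>M. \<forall>n\<ge>M. dist (?f m x) (?f n x) < e"
      using ordered by (metis dist_commute nle_le)
  qed
  hence "uniform_limit {0..1} ?f (\<lambda>x. lim (\<lambda>M. ?f M x)) sequentially"
    by (intro Cauchy_uniformly_convergent[THEN uniformly_convergent_uniform_limit_iff[THEN iffD1]])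
  hence ul: "uniform_limit {0..1} ?f (\<lambda>x. \<Sum>m. r m * x ^ m) sequentially"
    by (simp add: suminf_eq_lim)
  have "continuous_on {0..1} (\<lambda>x. \<Sum>m. r m * x ^ m)"
    by (rule uniform_limit_theorem[OF _ ul]) (auto intro!: always_eventually continuous_intros)
  hence "((\<lambda>x. \<Sum>m. r m * x ^ m) \<longlongrightarrow> (\<Sum>m. r m * 1 ^ m)) (at 1 within {0..1})"
    unfolding continuous_on_def by (rule bspec) auto
  moreover have "at 1 within {0..1} = at_left (1::real)"
    by (rule at_within_Icc_at_left) auto
  moreover have "(\<Sum>m. r m * 1 ^ m) = R" using assms by (simp add: sums_iff)
  ultimately show ?thesis by simp
qed

lemma neg_ln_one_minus_bounds:
  fixes x :: real
  assumes "0 \<le> x" "x \<le> 1 / 2"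
  shows "x \<le> - ln (1 - x)" "- ln (1 - x) \<le> x + 2 * x\<^sup>2"
proof -
  show "x \<le> - ln (1 - x)" using ln_one_minus_pos_upper_bound[of x] assms by linarith
  show "- ln (1 - x) \<le> x + 2 * x\<^sup>2" using ln_one_minus_pos_lower_bound[of x] assms by linarith
qed

section \<open>Partial sums of -ln (1 - 1/p) up to a constant\<close>

text \<open>The exact logarithm in place of 1/p: its sum is the logarithm of the Mertens product,
  and the constant is then gamma itself.\<close>

definition mertens_term :: "nat \<Rightarrow> real" where
  "mertens_term n = (if prime n then - ln (1 - 1 / real n) else 0)"

lemma mertens_term_nonneg: "mertens_term n \<ge> 0"
  using neg_ln_one_minus_bounds(1)[of "1 / real n"] prime_ge_2_nat[of n]
  by (auto simp: mertens_term_def field_simps intro: order.trans[rotated])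

lemma sum_inverse_squares_le:
  assumes "a \<ge> 2"
  shows "(\<Sum>n=a..b. 1 / real n ^ 2) \<le> 2 / real a"
proof (cases "a \<le> b")
  case True
  have "(\<Sum>n=a..b. 1 / real n ^ 2) \<le> 1 / (real a - 1) - 1 / real b"
    using True
  proof (induction b rule: dec_induct)
    case base
    have "1 / real a ^ 2 \<le> 1 / (real a * (real a - 1))"
      using assms by (intro divide_left_mono) (auto simp: power2_eq_square)
    also have "\<dots> = 1 / (real a - 1) - 1 / real a" using assms by (simp add: field_simps)
    finally show ?case by simp
  next
    case (step n)
    have "1 / real (Suc n) ^ 2 \<le> 1 / (real (Suc n) * real n)"
      using step assms by (intro divide_left_mono) (auto simp: power2_eq_square)
    also have "\<dots> = 1 / real n - 1 / real (Suc n)" using step assms by (simp add: field_simps)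
    finally show ?case using step by simp
  qed
  also have "\<dots> \<le> 1 / (real a - 1)" by simp
  also have "\<dots> \<le> 2 / real a" using assms by (simp add: field_simps)
  finally show ?thesis .
qed auto

lemma lnln_diff_bounds:
  assumes "n \<ge> 2"
  shows "1 / (real (Suc n) * ln (real (Suc n))) \<le> ln (ln (real (Suc n))) - ln (ln (real n))"
    and "ln (ln (real (Suc n))) - ln (ln (real n)) \<le> 1 / (real n * ln (real n))"
proof -
  have "\<exists>z. real n < z \<and> z < real (Suc n) \<and> ln (ln (real (Suc n))) - ln (ln (real n)) =
      (real (Suc n) - real n) * (1 / (z * ln z))"
    using assms by (intro MVT2) (auto intro!: derivative_eq_intros simp: field_simps)
  then obtain z where z: "real n < z" "z < real (Suc n)"
    "ln (ln (real (Suc n))) - ln (ln (real n)) = 1 / (z * ln z)" by auto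
  have "1 / (real (Suc n) * ln (real (Suc n))) \<le> 1 / (z * ln z)"
    using z(1,2) assms by (intro divide_left_mono mult_mono mult_pos_pos ln_mono) (auto intro: less_imp_le)
  thus "1 / (real (Suc n) * ln (real (Suc n))) \<le> ln (ln (real (Suc n))) - ln (ln (real n))" using z(3) by simp
  have "1 / (z * ln z) \<le> 1 / (real n * ln (real n))"
    using z(1,2) assms by (intro divide_left_mono mult_mono mult_pos_pos ln_mono) (auto intro: less_imp_le)
  thus "ln (ln (real (Suc n))) - ln (ln (real n)) \<le> 1 / (real n * ln (real n))" using z(3) by simp
qed

lemma ln_le_real: "n \<ge> 1 \<Longrightarrow> ln (real n) \<le> real n"
  using ln_le_minus_one[of "real n"] by simp

text \<open>The passage from -ln (1 - 1/p) to the increments of ln ln goes through 1/p and 1/(n ln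
  n). The decisive comparison is between these two: ln p / p on the primes minus 1/n on all n has
  bounded partial sums by Mertens' first theorem, and the weight 1/ln n turns this into
  decay.\<close>

lemma sum_mertens_term_block_bound:
  obtains K where "\<And>a b. a \<ge> 2 \<Longrightarrow>
    \<bar>\<Sum>n=a..b. mertens_term n - (ln (ln (real (Suc n))) - ln (ln (real n)))\<bar> \<le> K / ln (real a)"
proof -
  define c where "c n = (if prime n then ln (real n) / real n else 0) - 1 / real n" for n
  \<comment> \<open>Mertens' first theorem contributes 4 + \<open>prime_power_excess\<close>, and
    \<open>harm N\<close> - ln N, which lies in [0, 1], contributes 1.\<close>
  define B where "B = 5 + prime_power_excess"
  have B0: "\<bar>\<Sum>n=1..N. c n\<bar> \<le> B" for N
  proof (cases "N = 0")
    case False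
    have h: "(\<Sum>n=1..N. 1 / real n) = harm N" by (simp add: harm_def divide_inverse)
    have "harm N - ln (real N) \<le> harm 1 - ln (real 1)"
      using False by (intro euler_mascheroni_sequence_decreasing) auto
    hence "harm N - ln (real N) \<le> 1" by (simp add: harm_def)
    moreover have "ln (real N) \<le> harm N"
      using ln_le_harm[of N] False by (smt (verit) ln_le_cancel_iff of_nat_0_less_iff neq0_conv)
    ultimately show ?thesis
      using mertens_first_primes[of N] False unfolding c_def sum_subtractf h B_def by linarith
  next
    case True
    have "prime_power_excess \<ge> 0" using sum_mangoldt_nonprime_le[of 0] by simp
    thus ?thesis using True by (simp add: B_def)
  qed
  have C: "\<bar>\<Sum>n=a..b. c n\<bar> \<le> 2 * B" if "a \<ge> 1" "a \<le> b" for a b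
  proof -
    have "(\<Sum>n=1..b. c n) = (\<Sum>n=1..a-1. c n) + (\<Sum>n=a..b. c n)"
      using that by (subst sum.union_disjoint[symmetric]) (auto intro!: sum.cong)
    thus ?thesis using B0[of b] B0[of "a - 1"] by (simp only: abs_le_iff) linarith
  qed
  have "B \<ge> 0" using B0[of 0] by simp
  show ?thesis
  \<comment> \<open>The three comparisons cost 2B, 1 and 4, each divided by ln a.\<close>
  proof (rule that[of "2 * B + 5"])
    fix a b :: nat assume a: "a \<ge> 2"
    have lna: "ln (real a) > 0" "ln (real a) \<le> real a" using a ln_le_real[of a] by auto
    show "\<bar>\<Sum>n=a..b. mertens_term n - (ln (ln (real (Suc n))) - ln (ln (real n)))\<bar> \<le> (2 * B + 5) / ln (real a)"
    proof (cases "a \<le> b")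
      case True
      define x where "x n = (if prime n then 1 / real n else 0)" for n
      have 1: "\<bar>\<Sum>n=a..b. x n - 1 / (real n * ln (real n))\<bar> \<le> 2 * B / ln (real a)"
      proof -
        have "(\<Sum>n=a..b. x n - 1 / (real n * ln (real n))) = (\<Sum>n=a..b. (1 / ln (real n)) *\<^sub>R c n)"
          using a by (intro sum.cong refl) (auto simp: c_def x_def field_simps)
        also have "norm \<dots> \<le> 2 * B * (1 / ln (real a))"
          using True a C by (intro abel_sum_bound) (auto intro!: divide_left_mono mult_pos_pos)
        finally show ?thesis by simp
      qed
      have 2: "0 \<le> (\<Sum>n=a..b. 1 / (real n * ln (real n)) - (ln (ln (real (Suc n))) - ln (ln (real n))))"
        using a lnln_diff_bounds(2) by (intro sum_nonneg) auto
      have 3: "(\<Sum>n=a..b. 1 / (real n * ln (real n)) - (ln (ln (real (Suc n))) - ln (ln (real n)))) \<le> 1 / ln (real a)"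
      proof -
        have "(\<Sum>n=a..b. 1 / (real n * ln (real n)) - (ln (ln (real (Suc n))) - ln (ln (real n)))) \<le>
          (\<Sum>n=a..b. 1 / (real n * ln (real n)) - 1 / (real (Suc n) * ln (real (Suc n))))"
          using a lnln_diff_bounds(1) by (intro sum_mono diff_left_mono) auto
        also have "\<dots> = 1 / (real a * ln (real a)) - 1 / (real (Suc b) * ln (real (Suc b)))"
          using True sum_Suc_diff[of a b "\<lambda>n. - (1 / (real n * ln (real n)))"] by simp
        also have "\<dots> \<le> 1 / (real a * ln (real a))" using a True by auto
        also have "\<dots> \<le> 1 / (1 * ln (real a))"
          using a lna by (intro divide_left_mono mult_right_mono mult_pos_pos) auto
        finally show ?thesis by simp
      qed
      have 4: "0 \<le> (\<Sum>n=a..b. mertens_term n - x n)" "(\<Sum>n=a..b. mertens_term n - x n) \<le> 4 / ln (real a)"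
      proof -
        have "0 \<le> mertens_term n - x n \<and> mertens_term n - x n \<le> 2 * (1 / real n ^ 2)" if "n \<ge> 2" for n
          using neg_ln_one_minus_bounds[of "1 / real n"] that
          by (auto simp: mertens_term_def x_def power_divide field_simps)
        hence e: "0 \<le> mertens_term n - x n" "mertens_term n - x n \<le> 2 * (1 / real n ^ 2)" if "n \<ge> 2" for n
          using that by blast+
        show "0 \<le> (\<Sum>n=a..b. mertens_term n - x n)" using e a by (intro sum_nonneg) auto
        have "(\<Sum>n=a..b. mertens_term n - x n) \<le> 2 * (\<Sum>n=a..b. 1 / real n ^ 2)"
          unfolding sum_distrib_left using e a by (intro sum_mono) auto
        also have "\<dots> \<le> 4 / real a" using sum_inverse_squares_le[OF a, of b] by simp
        also have "\<dots> \<le> 4 / ln (real a)" using a lna by (intro divide_left_mono) auto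
        finally show "(\<Sum>n=a..b. mertens_term n - x n) \<le> 4 / ln (real a)" .
      qed
      have "(\<Sum>n=a..b. mertens_term n - (ln (ln (real (Suc n))) - ln (ln (real n)))) =
        (\<Sum>n=a..b. x n - 1 / (real n * ln (real n))) +
        (\<Sum>n=a..b. 1 / (real n * ln (real n)) - (ln (ln (real (Suc n))) - ln (ln (real n)))) +
        (\<Sum>n=a..b. mertens_term n - x n)"
        unfolding sum.distrib[symmetric] by (intro sum.cong) auto
      moreover have "(2 * B + 5) / ln (real a) = 2 * B / ln (real a) + 1 / ln (real a) + 4 / ln (real a)"
        by (simp add: add_divide_distrib)
      ultimately show ?thesis using 1 2 3 4 by (simp only: abs_le_iff) linarith
    qed (use \<open>B \<ge> 0\<close> lna in auto)
  qed
qed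

lemma mertens_second:
  obtains c K where "\<And>N. N \<ge> 2 \<Longrightarrow>
    \<bar>(\<Sum>n=1..N. mertens_term n) - ln (ln (real N)) - c\<bar> \<le> K / ln (real N)"
proof -
  obtain K where K: "\<And>a b. a \<ge> 2 \<Longrightarrow>
    \<bar>\<Sum>n=a..b. mertens_term n - (ln (ln (real (Suc n))) - ln (ln (real n)))\<bar> \<le> K / ln (real a)"
    using sum_mertens_term_block_bound by blast
  \<comment> \<open>With \<open>Suc N\<close> in the double logarithm the increments of F are
    exactly the block terms. Returning to ln (ln N) costs at most 1/ln N, hence the final constant K
    + 1.\<close>
  define F where "F N = (\<Sum>n=1..N. mertens_term n) - ln (ln (real (Suc N)))" for N
  have F: "F b - F a = (\<Sum>n=Suc a..b. mertens_term n - (ln (ln (real (Suc n))) - ln (ln (real n))))" if "1 \<le> a" "a \<le> b" for a b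
    using that(2)
  proof (induction b rule: dec_induct)
    case (step n)
    thus ?case by (simp add: F_def)
  qed simp
  have F_le: "\<bar>F b - F a\<bar> \<le> K / ln (real (Suc a))" if "1 \<le> a" "a \<le> b" for a b
    unfolding F[OF that] using that by (intro K) auto
  have "Cauchy F"
  proof (rule metric_CauchyI)
    fix e :: real assume "e > 0"
    have "(\<lambda>n. K / ln (real (Suc n))) \<longlonglongrightarrow> 0" by real_asymp
    hence "eventually (\<lambda>n. K / ln (real (Suc n)) < e / 2) sequentially"
      using \<open>e > 0\<close> by (intro order_tendstoD) auto
    then obtain M where M: "\<And>n. n \<ge> M \<Longrightarrow> K / ln (real (Suc n)) < e / 2" by (auto simp: eventually_at_top_linorder)
    have "dist (F m) (F n) < e" if "m \<ge> max 1 M" "n \<ge> max 1 M" for m n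
    proof -
      have "\<bar>F m - F (max 1 M)\<bar> < e / 2" "\<bar>F n - F (max 1 M)\<bar> < e / 2"
        using F_le[OF _ that(1)] F_le[OF _ that(2)] M[of "max 1 M"] by (meson le_less_trans max.cobounded1 max.cobounded2)+
      thus ?thesis unfolding dist_real_def by linarith
    qed
    thus "\<exists>M. \<forall>m\<ge>M. \<forall>n\<ge>M. dist (F m) (F n) < e" by blast
  qed
  then obtain c where c: "F \<longlonglongrightarrow> c" using Cauchy_convergent_iff convergent_def by blast
  show ?thesis
  proof (rule that[of c "K + 1"])
    fix N :: nat assume N: "N \<ge> 2"
    have "(\<lambda>b. \<bar>F b - F N\<bar>) \<longlonglongrightarrow> \<bar>c - F N\<bar>" by (intro tendsto_intros c)
    hence "\<bar>c - F N\<bar> \<le> K / ln (real (Suc N))"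
      using F_le[of N] N by (intro LIMSEQ_le_const2[OF \<open>(\<lambda>b. \<bar>F b - F N\<bar>) \<longlonglongrightarrow> \<bar>c - F N\<bar>\<close>]) auto
    also have "\<dots> \<le> K / ln (real N)"
    proof (rule divide_left_mono)
      have "0 \<le> K / ln (real 2)" using K[of 2 1] by simp
      thus "K \<ge> 0" by (simp add: zero_le_divide_iff)
    qed (use N in auto)
    finally have "\<bar>c - F N\<bar> \<le> K / ln (real N)" .
    moreover have "ln (ln (real (Suc N))) - ln (ln (real N)) \<le> 1 / ln (real N)"
    proof -
      have "1 / (real N * ln (real N)) \<le> 1 / (1 * ln (real N))"
        using N by (intro divide_left_mono mult_right_mono mult_pos_pos) auto
      thus ?thesis using lnln_diff_bounds(2)[OF N] by simp
    qed
    moreover have "ln (ln (real N)) \<le> ln (ln (real (Suc N)))" using N by auto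
    moreover have "(K + 1) / ln (real N) = K / ln (real N) + 1 / ln (real N)" by (simp add: add_divide_distrib)
    ultimately show "\<bar>(\<Sum>n=1..N. mertens_term n) - ln (ln (real N)) - c\<bar> \<le> (K + 1) / ln (real N)"
      by (simp only: F_def abs_le_iff) linarith
  qed
qed

section \<open>Identification of the constant with gamma\<close>

lemma zeta_log_prime_sums:
  fixes d :: real
  assumes "d > 0"
  shows "(\<lambda>n. if prime n then - ln (1 - real n powr - (1 + d)) else 0) sums ln (\<Sum>n. real n powr - (1 + d))"
proof -
  define s where "s = 1 + d"
  have s: "s > 1" using assms by (simp add: s_def)
  define Z where "Z = (\<Sum>n. real n powr - s)"
  have Z: "Z > 0"
  proof -
    have "1 / d > 0" using assms by simp
    also have "1 / d \<le> Z" unfolding Z_def s_def by (rule zeta_real_bounds(2)[OF assms])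
    finally show ?thesis .
  qed
  have lt1: "real p powr - s < 1" if "prime p" for p
  proof -
    have "real p powr - s < real p powr 0"
      using prime_gt_1_nat[OF that] s by (intro powr_less_mono) auto
    thus ?thesis using prime_gt_0_nat[OF that] by simp
  qed
  have "(\<lambda>N. \<Prod>p\<in>primes_le N. 1 / (1 - (real p powr - s) *\<^sub>R (1::complex))) \<longlonglongrightarrow> real_dirichlet (\<lambda>_. 1) s"
    by (rule euler_product_tendsto) (use s in auto)
  also have "real_dirichlet (\<lambda>_. 1) s = of_real Z"
    unfolding real_dirichlet_def Z_def using s
    by (subst suminf_of_real) (auto simp: scaleR_conv_of_real summable_real_powr_iff)
  also have "(\<lambda>N. \<Prod>p\<in>primes_le N. 1 / (1 - (real p powr - s) *\<^sub>R (1::complex))) =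
    (\<lambda>N. of_real (\<Prod>p\<in>primes_le N. 1 / (1 - real p powr - s)))"
    by (simp add: scaleR_conv_of_real fun_eq_iff)
  finally have "(\<lambda>N. \<Prod>p\<in>primes_le N. 1 / (1 - real p powr - s)) \<longlonglongrightarrow> Z"
    by (simp only: tendsto_of_real_iff)
  hence "(\<lambda>N. ln (\<Prod>p\<in>primes_le N. 1 / (1 - real p powr - s))) \<longlonglongrightarrow> ln Z"
    by (rule tendsto_ln) (use Z in auto)
  also have "(\<lambda>N. ln (\<Prod>p\<in>primes_le N. 1 / (1 - real p powr - s))) =
    (\<lambda>N. \<Sum>n\<le>N. if prime n then - ln (1 - real n powr - s) else 0)"
  proof
    fix N
    have "ln (\<Prod>p\<in>primes_le N. 1 / (1 - real p powr - s)) = (\<Sum>p\<in>primes_le N. ln (1 / (1 - real p powr - s)))"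
      by (rule ln_prod) (use lt1 in \<open>auto simp: primes_le_def dest: less_imp_neq\<close>)
    also have "\<dots> = (\<Sum>p\<in>primes_le N. - ln (1 - real p powr - s))"
      by (intro sum.cong refl) (use lt1 in \<open>auto simp: primes_le_def ln_div dest: less_imp_neq\<close>)
    also have "\<dots> = (\<Sum>n\<le>N. if prime n then - ln (1 - real n powr - s) else 0)"
      by (intro sum.mono_neutral_cong_left) (auto simp: primes_le_def)
    finally show "ln (\<Prod>p\<in>primes_le N. 1 / (1 - real p powr - s)) =
      (\<Sum>n\<le>N. if prime n then - ln (1 - real n powr - s) else 0)" .
  qed
  finally show ?thesis unfolding sums_def_le Z_def s_def .
qed

text \<open>Termwise, -ln (1 - 1/p) p^(-d) is compared with -ln (1 - p^(-1-d)), the terms of ln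
  zeta(1 + d). The difference tends to 0 for each p and is at most 2/p^2 for every d > 0, so
  dominated convergence of series (Tannery) applies.\<close>

lemma mertens_dirichlet_minus_log_zeta:
  shows "\<And>d. d > 0 \<Longrightarrow> summable (\<lambda>n. mertens_term n * real n powr - d)"
    and "((\<lambda>d. (\<Sum>n. mertens_term n * real n powr - d) - ln (\<Sum>n. real n powr - (1 + d))) \<longlongrightarrow> 0) (at_right 0)"
proof -
  define h where "h n d = (if prime n then - ln (1 - real n powr - (1 + d)) else 0)" for n :: nat and d :: real
  define a where "a n d = mertens_term n * real n powr - d - h n d" for n d
  have smM: "summable (\<lambda>n. 2 / real n ^ 2)"
    using inverse_power_summable[of 2, where ?'a = real] by (auto intro!: summable_mult simp: divide_inverse)
  have bound: "\<bar>a n d\<bar> \<le> 2 / real n ^ 2" if "d > 0" for n d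
  proof (cases "prime n")
    case True
    define x where "x = 1 / real n"
    define y where "y = real n powr - d"
    have n: "n \<ge> 2" using prime_ge_2_nat[OF True] .
    have x: "0 < x" "x \<le> 1 / 2" using n by (auto simp: x_def field_simps)
    have "real n powr - d \<le> real n powr 0" using n that by (intro powr_mono) auto
    hence y: "0 < y" "y \<le> 1" using n by (auto simp: y_def)
    have xy: "real n powr - (1 + d) = x * y"
      using n by (simp add: x_def y_def powr_diff powr_minus divide_inverse)
    have xy2: "0 \<le> x * y" "x * y \<le> 1 / 2" using x y mult_mono[of x "1/2" y 1] by auto
    have e: "a n d = (- ln (1 - x)) * y - (- ln (1 - x * y))"
      using True unfolding a_def h_def mertens_term_def xy y_def x_def by simp
    have "x * y \<le> (- ln (1 - x)) * y" "(- ln (1 - x)) * y \<le> (x + 2 * x\<^sup>2) * y"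
      using neg_ln_one_minus_bounds[of x] x y by (intro mult_right_mono; simp)+
    moreover have "2 * x\<^sup>2 * y \<le> 2 * x\<^sup>2" using x y by (intro mult_left_le) auto
    moreover have "2 * (x * y)\<^sup>2 \<le> 2 * x\<^sup>2"
      using x y by (auto simp: power_mult_distrib power_le_one intro: mult_left_le)
    moreover note neg_ln_one_minus_bounds[OF xy2]
    ultimately have "\<bar>a n d\<bar> \<le> 2 * x\<^sup>2"
      unfolding e abs_le_iff by (simp only: distrib_right) linarith
    thus ?thesis by (simp add: x_def power_divide)
  qed (simp add: a_def h_def mertens_term_def)
  have h_sums: "(\<lambda>n. h n d) sums ln (\<Sum>n. real n powr - (1 + d))" if "d > 0" for d
    unfolding h_def using zeta_log_prime_sums[OF that] by simp
  have a_sm: "summable (\<lambda>n. a n d)" if "d > 0" for d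
    by (rule summable_comparison_test[OF _ smM]) (use bound[OF that] in auto)
  have eq: "(\<lambda>n. mertens_term n * real n powr - d) = (\<lambda>n. a n d + h n d)" for d
    by (simp add: a_def)
  show sm: "summable (\<lambda>n. mertens_term n * real n powr - d)" if "d > 0" for d
    unfolding eq by (intro summable_add a_sm that sums_summable[OF h_sums])
  have lim: "((\<lambda>d. a n d) \<longlongrightarrow> 0) (at_right 0)" for n
  proof (cases "prime n")
    case True
    have n: "n \<ge> 2" using prime_ge_2_nat[OF True] .
    have "((\<lambda>d. - ln (1 - 1 / real n) * real n powr - d - (- ln (1 - real n powr - (1 + d)))) \<longlongrightarrow>
      - ln (1 - 1 / real n) * real n powr - 0 - (- ln (1 - real n powr - (1 + 0)))) (at_right 0)"
      using n by (intro tendsto_intros) (auto simp: powr_minus field_simps)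
    moreover have "real n powr - (1 + 0) = 1 / real n" using n by (simp add: powr_minus divide_inverse)
    ultimately show ?thesis using n True by (simp add: a_def h_def mertens_term_def)
  qed (simp add: a_def h_def mertens_term_def)
  have "((\<lambda>d. \<Sum>n. a n d) \<longlongrightarrow> (\<Sum>n. 0)) (at_right 0)"
  proof (rule tannerys_theorem[THEN conjunct2, THEN conjunct2])
    show "((\<lambda>d. a n d) \<longlongrightarrow> 0) (at_right 0)" for n by (rule lim)
    have "eventually (\<lambda>p. True \<and> 0 < snd p) (sequentially \<times>\<^sub>F at_right (0::real))"
      by (subst eventually_prod_filter) (auto intro!: exI[of _ "\<lambda>_. True"] exI[of _ "\<lambda>d. 0 < d"] simp: eventually_at_right_less)
    thus "eventually (\<lambda>(n, d). norm (a n d) \<le> 2 / real n ^ 2) (sequentially \<times>\<^sub>F at_right 0)"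
      by (rule eventually_mono) (use bound in auto)
  qed (use smM in auto)
  moreover have "eventually (\<lambda>d. (\<Sum>n. a n d) = (\<Sum>n. mertens_term n * real n powr - d) - ln (\<Sum>n. real n powr - (1 + d))) (at_right 0)"
    using eventually_at_right_less[of 0]
  proof eventually_elim
    case (elim d)
    have "(\<Sum>n. a n d) = (\<Sum>n. mertens_term n * real n powr - d) - (\<Sum>n. h n d)"
      unfolding a_def by (intro suminf_diff[symmetric] sm elim sums_summable[OF h_sums])
    thus ?case using h_sums[OF elim] by (simp add: sums_iff)
  qed
  ultimately show "((\<lambda>d. (\<Sum>n. mertens_term n * real n powr - d) - ln (\<Sum>n. real n powr - (1 + d))) \<longlongrightarrow> 0) (at_right 0)"
    using tendsto_cong by force
qed

text \<open>Zeta(1 + d) lies between 1/d and 1 + 1/d, and 1 - e^(-d) behaves like d. The form 1 -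
  e^(-d) matches the power series of -ln (1 - x) at x = e^(-d).\<close>

lemma log_zeta_plus_log_tendsto:
  "((\<lambda>d. ln (\<Sum>n. real n powr - (1 + d)) + ln (1 - exp (- d))) \<longlongrightarrow> 0) (at_right 0)"
proof (rule tendsto_sandwich)
  show "((\<lambda>d::real. ln (1 / d * (1 - exp (- d)))) \<longlongrightarrow> 0) (at_right 0)" by real_asymp
  show "((\<lambda>d::real. ln ((1 + 1 / d) * (1 - exp (- d)))) \<longlongrightarrow> 0) (at_right 0)" by real_asymp
  have "1 / d * (1 - exp (- d)) > 0 \<and> (\<Sum>n. real n powr - (1 + d)) > 0 \<and>
    1 / d * (1 - exp (- d)) \<le> (\<Sum>n. real n powr - (1 + d)) * (1 - exp (- d)) \<and>
    (\<Sum>n. real n powr - (1 + d)) * (1 - exp (- d)) \<le> (1 + 1 / d) * (1 - exp (- d)) \<and> 1 - exp (- d) > 0"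
    if "d > 0" for d :: real
  proof -
    have "1 / d > 0" using that by simp
    hence "(\<Sum>n. real n powr - (1 + d)) > 0" using zeta_real_bounds(2)[OF that] by linarith
    moreover have e: "1 - exp (- d) > 0" using that by simp
    moreover have "1 / d * (1 - exp (- d)) > 0" by (intro mult_pos_pos e \<open>1 / d > 0\<close>)
    moreover note mult_right_mono[OF zeta_real_bounds(1)[OF that] less_imp_le[OF e]]
      mult_right_mono[OF zeta_real_bounds(2)[OF that] less_imp_le[OF e]]
    ultimately show ?thesis by blast
  qed
  note * = this
  have "ln (1 / d * (1 - exp (- d))) \<le> ln (\<Sum>n. real n powr - (1 + d)) + ln (1 - exp (- d)) \<and>
     ln (\<Sum>n. real n powr - (1 + d)) + ln (1 - exp (- d)) \<le> ln ((1 + 1 / d) * (1 - exp (- d)))" if "d > 0" for d :: real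
    using *[OF that] by (subst (1 2) ln_mult_pos[symmetric]) (auto intro!: ln_mono)
  thus "eventually (\<lambda>d. ln (1 / d * (1 - exp (- d))) \<le> ln (\<Sum>n. real n powr - (1 + d)) + ln (1 - exp (- d))) (at_right 0)"
    "eventually (\<lambda>d. ln (\<Sum>n. real n powr - (1 + d)) + ln (1 - exp (- d)) \<le> ln ((1 + 1 / d) * (1 - exp (- d)))) (at_right 0)"
    by (auto intro: eventually_mono[OF eventually_at_right_less[of 0]])
qed

definition exp_floor :: "nat \<Rightarrow> nat" where
  "exp_floor m = nat \<lfloor>exp (real m)\<rfloor>"

lemma exp_floor_0 [simp]: "exp_floor 0 = 1"
  by (simp add: exp_floor_def)

lemma mono_exp_floor: "m \<le> n \<Longrightarrow> exp_floor m \<le> exp_floor n"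
  unfolding exp_floor_def by (intro nat_mono floor_mono) simp

lemma exp_floor_bounds: "exp_floor m < n \<Longrightarrow> exp (real m) < real n" "n \<le> exp_floor m \<Longrightarrow> real n \<le> exp (real m)"
  unfolding exp_floor_def by (auto simp: nat_less_iff less_floor_iff floor_less_iff le_nat_iff le_floor_iff)

lemma sum_exp_floor_blocks:
  fixes f :: "nat \<Rightarrow> real"
  assumes "f 0 = 0" "f 1 = 0"
  shows "(\<Sum>m<M. \<Sum>n\<in>{exp_floor m<..exp_floor (Suc m)}. f n) = (\<Sum>n\<le>exp_floor M. f n)"
proof (induction M)
  case 0
  have "{..Suc 0} = {0, 1}" by auto
  thus ?case using assms by simp
next
  case (Suc M)
  have "{..exp_floor (Suc M)} = {..exp_floor M} \<union> {exp_floor M<..exp_floor (Suc M)}"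
    using mono_exp_floor[of M "Suc M"] by auto
  hence "(\<Sum>n\<le>exp_floor (Suc M). f n) = (\<Sum>n\<le>exp_floor M. f n) + (\<Sum>n\<in>{exp_floor M<..exp_floor (Suc M)}. f n)"
    by (simp only:) (subst sum.union_disjoint, auto)
  thus ?case using Suc by simp
qed

lemma filterlim_exp_floor: "filterlim exp_floor at_top sequentially"
proof -
  have "real m \<le> real (exp_floor m)" for m
    using exp_ge_add_one_self[of "real m"] unfolding exp_floor_def by linarith
  hence "m \<le> exp_floor m" for m by simp
  thus ?thesis by (intro filterlim_at_top_mono[OF filterlim_ident]) auto
qed

text \<open>The constant is found by comparing \<open>\<Sum> -ln (1 - 1/p) p^{-d}\<close>, which is \<open>-ln d + o(1)\<close> by the Euler product,
  with the power series of \<open>-ln (1 - x)\<close> at \<open>x = e^{-d}\<close>, after grouping the primes into the blocks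
  \<open>e^m < p \<le> e^{m+1}\<close>.\<close>

lemma mertens_constant:
  assumes c: "\<And>N. N \<ge> 2 \<Longrightarrow> \<bar>(\<Sum>n=1..N. mertens_term n) - ln (ln (real N)) - c\<bar> \<le> K / ln (real N)"
  shows "c = euler_mascheroni"
proof -
  define b where "b m = (\<Sum>n\<in>{exp_floor m<..exp_floor (Suc m)}. mertens_term n)" for m
  \<comment> \<open>1/(m + 1) is the coefficient of x^m in -ln (1 - x) / x, and its partial sums are
    harmonic numbers; gamma enters through them.\<close>
  define r where "r m = b m - 1 / real (Suc m)" for m
  have mt01: "mertens_term 0 = 0" "mertens_term 1 = 0" by (auto simp: mertens_term_def)
  have r_sums: "r sums (c - euler_mascheroni)"
  proof -
    have G: "(\<lambda>N. (\<Sum>n=1..N. mertens_term n) - ln (ln (real N)) - c) \<longlonglongrightarrow> 0"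
    proof (rule Lim_null_comparison)
      show "eventually (\<lambda>N. norm ((\<Sum>n=1..N. mertens_term n) - ln (ln (real N)) - c) \<le> K / ln (real N)) sequentially"
        using c by (auto intro!: eventually_sequentiallyI[of 2])
      show "(\<lambda>N. K / ln (real N)) \<longlonglongrightarrow> 0" by real_asymp
    qed
    have 1: "(\<lambda>M. (\<Sum>n=1..exp_floor M. mertens_term n) - ln (ln (real (exp_floor M))) - c) \<longlonglongrightarrow> 0"
      using filterlim_compose[OF G filterlim_exp_floor] by simp
    have 2: "(\<lambda>M. ln (ln (real (exp_floor M))) - ln (real M)) \<longlonglongrightarrow> 0"
    proof (rule tendsto_sandwich)
      show "(\<lambda>M. ln (ln (exp (real M) - 1)) - ln (real M)) \<longlonglongrightarrow> 0" by real_asymp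
      show "(\<lambda>M. ln (ln (exp (real M))) - ln (real M)) \<longlonglongrightarrow> 0" by simp
      have "exp (real M) - 1 \<le> real (exp_floor M)" for M unfolding exp_floor_def by linarith
      moreover have "real (exp_floor M) \<le> exp (real M)" for M using exp_floor_bounds(2)[of "exp_floor M" M] by simp
      moreover have "exp (real M) - 1 > 1" if "M \<ge> 2" for M
        using that exp_ge_add_one_self[of "real M"] by linarith
      ultimately have "1 < exp (real M) - 1 \<and> exp (real M) - 1 \<le> real (exp_floor M) \<and> real (exp_floor M) \<le> exp (real M)"
        if "M \<ge> 2" for M using that by blast
      moreover have "ln (ln u) \<le> ln (ln v)" if "1 < u" "u \<le> v" for u v :: real using that by auto
      ultimately have "ln (ln (exp (real M) - 1)) \<le> ln (ln (real (exp_floor M))) \<and> ln (ln (real (exp_floor M))) \<le> ln (ln (exp (real M)))"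
        if "M \<ge> 2" for M using that by (meson order.strict_trans2)
      thus "eventually (\<lambda>M. ln (ln (exp (real M) - 1)) - ln (real M) \<le> ln (ln (real (exp_floor M))) - ln (real M)) sequentially"
        "eventually (\<lambda>M. ln (ln (real (exp_floor M))) - ln (real M) \<le> ln (ln (exp (real M))) - ln (real M)) sequentially"
        by (auto intro!: eventually_sequentiallyI[of 2])
    qed
    have 3: "(\<lambda>M. harm M - ln (real M) - euler_mascheroni) \<longlonglongrightarrow> (0::real)"
      using tendsto_diff[OF euler_mascheroni_LIMSEQ tendsto_const[of "euler_mascheroni::real"]] by simp
    have "(\<Sum>m<M. r m) = (\<Sum>n=1..exp_floor M. mertens_term n) - harm M" for M
    proof -
      have "(\<Sum>m<M. b m) = (\<Sum>n\<le>exp_floor M. mertens_term n)"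
        unfolding b_def by (rule sum_exp_floor_blocks[OF mt01])
      also have "\<dots> = (\<Sum>n=1..exp_floor M. mertens_term n)"
        by (rule sum.mono_neutral_right) (auto simp: mt01 not_le)
      finally show ?thesis by (simp add: r_def sum_subtractf harm_altdef divide_inverse)
    qed
    hence eq: "(\<Sum>m<M. r m) = ((\<Sum>n=1..exp_floor M. mertens_term n) - ln (ln (real (exp_floor M))) - c)
        + (ln (ln (real (exp_floor M))) - ln (real M)) - (harm M - ln (real M) - euler_mascheroni) + (c - euler_mascheroni)" for M
      by simp
    show ?thesis unfolding sums_def eq
      using tendsto_add[OF tendsto_diff[OF tendsto_add[OF 1 2] 3] tendsto_const[of "c - euler_mascheroni"]] by simp
  qed
  define Z where "Z d = (\<Sum>n. mertens_term n * real n powr - d)" for d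
  \<comment> \<open>On block m one has x^(m+1) <= n^(-d) <= x^m for x = e^(-d). Hence
    \<open>Z d\<close> lies between x B and B, where B is the power series with coefficients
    \<open>b m\<close>, and B differs from the series of r by -ln (1 - x) / x.\<close>
  have main: "Z d + ln (1 - exp (- d)) / exp (- d) \<le> (\<Sum>m. r m * exp (- d) ^ m) \<and>
     (\<Sum>m. r m * exp (- d) ^ m) \<le> (Z d + ln (1 - exp (- d))) / exp (- d)" if d: "d > 0" for d
  proof -
    define x where "x = exp (- d)"
    have x: "0 < x" "x < 1" using d by (auto simp: x_def)
    have "(\<lambda>j. x ^ j / real j) sums (- ln (1 - x))"
    proof -
      have "(\<lambda>j. complex_of_real x ^ j / of_nat j) sums (- Ln (1 - complex_of_real x))"
        by (rule Ln_one_minus_sums) (use x in auto)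
      moreover have "Ln (1 - complex_of_real x) = of_real (ln (1 - x))"
        using x by (subst Ln_of_real[symmetric]) auto
      ultimately have "(\<lambda>j. complex_of_real (x ^ j / real j)) sums complex_of_real (- ln (1 - x))" by simp
      thus ?thesis by (simp only: sums_of_real_iff)
    qed
    hence "(\<lambda>j. x ^ Suc j / real (Suc j)) sums (- ln (1 - x))"
      using sums_Suc_iff[of "\<lambda>j. x ^ j / real j" "- ln (1 - x)"] by simp
    from sums_divide[OF this, of x]
    have lnx: "(\<lambda>j. 1 / real (Suc j) * x ^ j) sums (- ln (1 - x) / x)" using x by simp
    have r_sm: "summable (\<lambda>m. r m * x ^ m)"
    proof -
      have "r \<longlonglongrightarrow> 0" by (rule summable_LIMSEQ_zero[OF sums_summable[OF r_sums]])
      hence "Bseq r" by (rule convergent_imp_Bseq[OF convergentI])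
      then obtain C where C: "\<And>m. \<bar>r m\<bar> \<le> C" by (auto simp: Bseq_def)
      show ?thesis
      proof (rule summable_comparison_test)
        show "summable (\<lambda>m. C * x ^ m)" using x by (intro summable_mult summable_geometric) auto
        show "\<exists>N. \<forall>n\<ge>N. norm (r n * x ^ n) \<le> C * x ^ n"
          using C x by (auto simp: abs_mult intro!: mult_right_mono)
      qed
    qed
    have b_eq: "b m * x ^ m = r m * x ^ m + 1 / real (Suc m) * x ^ m" for m
      by (simp only: r_def distrib_right[symmetric]) simp
    have b_sm: "summable (\<lambda>m. b m * x ^ m)"
      unfolding b_eq by (intro summable_add r_sm sums_summable[OF lnx])
    have S: "(\<Sum>m. b m * x ^ m) = (\<Sum>m. r m * x ^ m) - ln (1 - x) / x"
      unfolding b_eq using suminf_add[OF r_sm sums_summable[OF lnx]] lnx by (simp add: sums_iff)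
    define w where "w m = (\<Sum>n\<in>{exp_floor m<..exp_floor (Suc m)}. mertens_term n * real n powr - d)" for m
    have w: "x * (b m * x ^ m) \<le> w m \<and> w m \<le> b m * x ^ m" for m
    proof -
      have "x ^ Suc m \<le> real n powr - d \<and> real n powr - d \<le> x ^ m"
        if "n \<in> {exp_floor m<..exp_floor (Suc m)}" for n
      proof -
        have n: "exp (real m) < real n" "real n \<le> exp (real (Suc m))"
          using that exp_floor_bounds(1)[of m n] exp_floor_bounds(2)[of n "Suc m"]
          by (simp_all only: greaterThanAtMost_iff)
        have n0: "0 < real n" by (rule less_trans[OF exp_gt_zero n(1)])
        have "exp (real (Suc m)) powr - d \<le> real n powr - d" "real n powr - d \<le> exp (real m) powr - d"
          using n d n0 powr_mono2'[of "- d" "real n" "exp (real (Suc m))"] powr_mono2'[of "- d" "exp (real m)" "real n"]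
          by (simp_all only: exp_gt_zero less_imp_le neg_le_0_iff_le)
        moreover have "exp (real j) powr - d = x ^ j" for j
          by (simp add: x_def powr_def exp_of_nat_mult[symmetric] mult.commute)
        ultimately show ?thesis by (simp only:)
      qed
      hence "(\<Sum>n\<in>{exp_floor m<..exp_floor (Suc m)}. mertens_term n * x ^ Suc m) \<le> w m"
        "w m \<le> (\<Sum>n\<in>{exp_floor m<..exp_floor (Suc m)}. mertens_term n * x ^ m)"
        unfolding w_def by (simp_all only: sum_mono mult_left_mono mertens_term_nonneg)
      moreover have "(\<Sum>n\<in>{exp_floor m<..exp_floor (Suc m)}. mertens_term n * x ^ Suc m) = x * (b m * x ^ m)"
        unfolding b_def sum_distrib_right sum_distrib_left by (intro sum.cong) auto
      moreover have "(\<Sum>n\<in>{exp_floor m<..exp_floor (Suc m)}. mertens_term n * x ^ m) = b m * x ^ m"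
        by (simp only: b_def sum_distrib_right[symmetric])
      ultimately show ?thesis by (simp only:)
    qed
    have "w sums Z d"
    proof -
      have "(\<lambda>N. \<Sum>n\<le>N. mertens_term n * real n powr - d) \<longlonglongrightarrow> Z d"
        unfolding Z_def by (rule summable_LIMSEQ'[OF mertens_dirichlet_minus_log_zeta(1)[OF d]])
      from filterlim_compose[OF this filterlim_exp_floor]
      show ?thesis unfolding sums_def w_def
        by (subst sum_exp_floor_blocks) (auto simp: mt01[simplified])
    qed
    hence "x * (\<Sum>m. b m * x ^ m) \<le> Z d" "Z d \<le> (\<Sum>m. b m * x ^ m)"
      using w sums_le[OF _ sums_mult[OF summable_sums[OF b_sm], of x] \<open>w sums Z d\<close>]
        sums_le[OF _ \<open>w sums Z d\<close> summable_sums[OF b_sm]] by auto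
    moreover have "Z d + L / x \<le> R \<and> R \<le> (Z d + L) / x"
      if "x * (R - L / x) \<le> Z d" "Z d \<le> R - L / x" for R L
    proof -
      have "x * (R - L / x) = R * x - L" using x by (simp add: right_diff_distrib mult.commute)
      thus ?thesis using that x by (simp add: pos_le_divide_eq)
    qed
    ultimately show ?thesis unfolding S x_def[symmetric] by blast
  qed
  have Zlim: "((\<lambda>d. Z d + ln (1 - exp (- d))) \<longlongrightarrow> 0) (at_right 0)"
    using tendsto_add[OF mertens_dirichlet_minus_log_zeta(2) log_zeta_plus_log_tendsto] by (simp add: Z_def)
  have "((\<lambda>d. \<Sum>m. r m * exp (- d) ^ m) \<longlongrightarrow> 0) (at_right (0::real))"
  proof (rule tendsto_sandwich)
    \<comment> \<open>The cost of the division by x in the lower bound; it is of size d ln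
      d.\<close>
    have "((\<lambda>d::real. ln (1 - exp (- d)) * (exp d - 1)) \<longlongrightarrow> 0) (at_right 0)" by real_asymp
    from tendsto_add[OF Zlim this]
    show "((\<lambda>d. (Z d + ln (1 - exp (- d))) + ln (1 - exp (- d)) * (exp d - 1)) \<longlongrightarrow> 0) (at_right 0)" by simp
    have "((\<lambda>d::real. exp (- d)) \<longlongrightarrow> 1) (at_right 0)" by real_asymp
    from tendsto_divide[OF Zlim this]
    show "((\<lambda>d. (Z d + ln (1 - exp (- d))) / exp (- d)) \<longlongrightarrow> 0) (at_right 0)" by simp
    have "(Z d + ln (1 - exp (- d))) + ln (1 - exp (- d)) * (exp d - 1) = Z d + ln (1 - exp (- d)) / exp (- d)" for d
      by (simp add: exp_minus divide_inverse algebra_simps)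
    thus "eventually (\<lambda>d. (Z d + ln (1 - exp (- d))) + ln (1 - exp (- d)) * (exp d - 1) \<le> (\<Sum>m. r m * exp (- d) ^ m)) (at_right 0)"
      using main by (simp only:) (auto intro: eventually_mono[OF eventually_at_right_less[of 0]])
    show "eventually (\<lambda>d. (\<Sum>m. r m * exp (- d) ^ m) \<le> (Z d + ln (1 - exp (- d))) / exp (- d)) (at_right 0)"
      using main by (auto intro: eventually_mono[OF eventually_at_right_less[of 0]])
  qed
  moreover have "((\<lambda>d. \<Sum>m. r m * exp (- d) ^ m) \<longlongrightarrow> c - euler_mascheroni) (at_right (0::real))"
  proof (rule filterlim_compose[OF abel_power_series_limit[OF r_sums]])
    show "filterlim (\<lambda>d::real. exp (- d)) (at_left 1) (at_right 0)" by real_asymp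
  qed
  ultimately have "0 = c - euler_mascheroni" by (rule tendsto_unique[OF trivial_limit_at_right_real])
  thus ?thesis by simp
qed

theorem mertens_third:
  obtains K where "\<And>N. N \<ge> 2 \<Longrightarrow>
    \<bar>(\<Sum>n=1..N. mertens_term n) - ln (ln (real N)) - euler_mascheroni\<bar> \<le> K / ln (real N)"
  using mertens_second mertens_constant by metis

subsection \<open>Primitive characters\<close>

text \<open>Take m = n + d t with t the product of the primes of q that do not divide n. A prime of
  q dividing n divides neither d nor t; a prime of q not dividing n divides t. In both cases it
  fails to divide m.\<close>

lemma ex_coprime_lift:
  fixes d q n :: nat
  assumes "q > 0" "d dvd q" "coprime n d"
  shows "\<exists>m. [m = n] (mod d) \<and> coprime m q"
proof -
  define t where "t = \<Prod>{p\<in>prime_factors q. \<not> p dvd n}"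
  have "coprime (n + d * t) q"
  proof (rule ccontr)
    assume "\<not> coprime (n + d * t) q"
    hence "gcd (n + d * t) q \<noteq> 1" unfolding coprime_iff_gcd_eq_1 .
    then obtain p where "prime p" "p dvd gcd (n + d * t) q" using prime_factor_nat by blast
    hence p: "prime p" "p dvd n + d * t" "p dvd q" by (meson dvd_trans gcd_dvd1 gcd_dvd2)+
    have pq: "p \<in> prime_factors q" using p assms(1) by (simp add: prime_factors_dvd)
    show False
    proof (cases "p dvd n")
      case True
      hence "p dvd d * t" using p(2) by (simp add: dvd_add_right_iff)
      moreover have "\<not> p dvd d" using True assms(3) p(1) by (meson coprime_common_divisor not_prime_unit)
      ultimately have "p dvd t" using p(1) by (simp add: prime_dvd_mult_iff)
      then obtain r where r: "r \<in> prime_factors q" "\<not> r dvd n" "p dvd r"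
        unfolding t_def using p(1) by (auto simp: prime_dvd_prod_iff)
      hence "p = r" using p(1) by (intro primes_dvd_imp_eq) (auto simp: prime_factors_dvd)
      with r True show False by blast
    next
      case False
      have "p dvd t" unfolding t_def using False pq by (intro dvd_prodI) auto
      hence "p dvd n" using p(2) by (simp add: dvd_add_left_iff)
      with False show False by blast
    qed
  qed
  moreover have "[n + d * t = n] (mod d)" by (simp add: cong_def)
  ultimately show ?thesis by blast
qed

text \<open>The Chinese remainder theorem for moduli that need not be coprime.\<close>

lemma ex_common_solution:
  fixes d1 d2 m n :: nat
  assumes "d1 > 0" "d2 > 0" "[m = n] (mod gcd d1 d2)"
  shows "\<exists>x. [x = m] (mod d1) \<and> [x = n] (mod d2)"
proof -
  define g where "g = gcd d1 d2"
  obtain u where u: "[d1 * u = g] (mod d2)"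
    using cong_solve_nat[of d1 d2] assms unfolding g_def by auto
  \<comment> \<open>Replacing n by n + d2 m does not change its residue modulo d2 and makes the
    subtraction of m exact in the natural numbers.\<close>
  have "1 * m \<le> d2 * m" using assms(2) by (intro mult_right_mono) auto
  hence le: "m \<le> n + d2 * m" by (simp only: mult_1 trans_le_add2)
  have "[n + d2 * m = m + 0] (mod g)"
    using assms(3) by (intro cong_add[of n m g "d2 * m" 0, unfolded]) (auto simp: g_def cong_sym cong_0_iff)
  hence "g dvd n + d2 * m - m" using le by (simp add: cong_def mod_eq_dvd_iff_nat)
  then obtain k where k: "n + d2 * m - m = g * k" by auto
  have "[m + d1 * u * k = m + g * k] (mod d2)"
    by (intro cong_add cong_mult u) auto
  also have "m + g * k = n + d2 * m" using k le by simp
  also have "[n + d2 * m = n] (mod d2)" by (simp add: cong_def)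
  finally have "[m + d1 * u * k = n] (mod d2)" .
  moreover have "[m + d1 * u * k = m] (mod d1)" by (simp add: cong_def mult.assoc)
  ultimately show ?thesis by blast
qed

lemma coprime_cong: "[m = n] (mod d) \<Longrightarrow> coprime m d \<longleftrightarrow> coprime n (d::nat)"
  using cong_imp_coprime cong_sym by blast

text \<open>Choose y coprime to q with y = m modulo d1 and y = n modulo d2. Then chi(y) equals
  chi(m) when read through \<open>psi1\<close> and chi(n) when read through
  \<open>psi2\<close>.\<close>

lemma induced_cong_gcd:
  assumes "q > 0" and ind: "induces d1 psi1 q chi" "induces d2 psi2 q chi"
    and "coprime m q" "coprime n q" "[m = n] (mod gcd d1 d2)"
  shows "chi m = chi n"
proof -
  have d: "d1 dvd q" "d2 dvd q" "dcharacter d1 psi1" "dcharacter d2 psi2"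
    and eq: "\<And>n. coprime n q \<Longrightarrow> chi n = psi1 n" "\<And>n. coprime n q \<Longrightarrow> chi n = psi2 n"
    using ind by (auto simp: induces_def)
  have pos: "d1 > 0" "d2 > 0" using d \<open>q > 0\<close> by (auto intro: Nat.gr0I)
  obtain x where x: "[x = m] (mod d1)" "[x = n] (mod d2)"
    using ex_common_solution[OF pos assms(6)] by blast
  have "coprime x d1" "coprime x d2"
    using x coprime_cong assms(4,5) d(1,2) by (meson coprime_divisors dvd_refl)+
  hence "coprime x (lcm d1 d2)"
    by (meson coprime_divisors coprime_mult_right_iff dvd_refl lcm_least dvd_triv_left dvd_triv_right)
  moreover have "lcm d1 d2 dvd q" using d by simp
  ultimately obtain y where y: "[y = x] (mod lcm d1 d2)" "coprime y q"
    using ex_coprime_lift[OF \<open>q > 0\<close>] by blast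
  have "[y = m] (mod d1)" "[y = n] (mod d2)"
    using y(1) x by (meson cong_dvd_modulus_nat cong_trans dvd_lcm1 dvd_lcm2)+
  hence "psi1 y = psi1 m" "psi2 y = psi2 n" using d dcharacter_cong by blast+
  thus ?thesis using eq y(2) assms(4,5) by metis
qed

text \<open>On integers coprime to q, chi depends only on the residue modulo gcd d1 d2. The
  character psi is read off from representatives coprime to q, and \<open>induced_cong_gcd\<close>
  makes their choice immaterial.\<close>

lemma ex_gcd_inducing:
  assumes "q > 0" and ind: "induces d1 psi1 q chi" "induces d2 psi2 q chi"
  shows "\<exists>psi. induces (gcd d1 d2) psi d1 psi1 \<and> induces (gcd d1 d2) psi d2 psi2"
proof -
  define g where "g = gcd d1 d2"
  have d: "d1 dvd q" "d2 dvd q" "dcharacter d1 psi1" "dcharacter d2 psi2" "dcharacter q chi"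
    and eq: "\<And>n. coprime n q \<Longrightarrow> chi n = psi1 n" "\<And>n. coprime n q \<Longrightarrow> chi n = psi2 n"
    using ind by (auto simp: induces_def)
  have gq: "g dvd q" using d unfolding g_def by (meson dvd_trans gcd_dvd1)
  define rep where "rep n = (SOME m. [m = n] (mod g) \<and> coprime m q)" for n
  have rep: "[rep n = n] (mod g)" "coprime (rep n) q" if "coprime n g" for n
    using someI_ex[OF ex_coprime_lift[OF \<open>q > 0\<close> gq that]] unfolding rep_def by blast+
  define psi where "psi n = (if coprime n g then chi (rep n) else 0)" for n
  have psi_eq: "psi n = chi m" if "coprime m q" "[m = n] (mod g)" for m n
  proof -
    have "coprime m g" using that(1) gq by (meson coprime_divisors dvd_refl)
    hence "coprime n g" using coprime_cong[OF that(2)] by blast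
    thus ?thesis
      using induced_cong_gcd[OF assms that(1) rep(2), of n] rep(1)[of n] that(2)
      unfolding psi_def g_def by (metis cong_sym cong_trans)
  qed
  have psi_0: "psi n = 0" if "\<not> coprime n g" for n using that by (simp add: psi_def)
  have "dcharacter g psi"
    unfolding dcharacter_def
  proof (intro conjI allI)
    fix m n
    show "psi (m * n) = psi m * psi n"
    proof (cases "coprime m g \<and> coprime n g")
      case True
      have "psi (m * n) = chi (rep m * rep n)"
        using True rep by (intro psi_eq cong_mult) auto
      also have "\<dots> = psi m * psi n" using True by (simp add: psi_def dcharacter_mult[OF d(5)])
      finally show ?thesis .
    qed (auto simp: psi_def)
  next
    fix n
    have "[n + g = n] (mod g)" by (simp add: cong_def)
    thus "psi (n + g) = psi n"
      using psi_eq[of "rep n" "n + g"] psi_eq[of "rep n" n] rep[of n] psi_0 coprime_cong[of "n + g" n g]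
      by (metis cong_sym cong_trans)
  next
    fix n
    show "psi n \<noteq> 0 \<longleftrightarrow> coprime n g"
      using rep(2)[of n] dcharacter_eq_0_iff[OF d(5)] by (auto simp: psi_def)
  qed
  moreover have "psi1 n = psi n" if n: "coprime n d1" for n
  proof -
    obtain m where m: "[m = n] (mod d1)" "coprime m q" using ex_coprime_lift[OF \<open>q > 0\<close> d(1) n] by blast
    have "[m = n] (mod g)" using m(1) unfolding g_def by (meson cong_dvd_modulus_nat gcd_dvd1)
    thus ?thesis using psi_eq[OF m(2)] eq(1)[OF m(2)] dcharacter_cong[OF d(3) m(1)] by simp
  qed
  moreover have "psi2 n = psi n" if n: "coprime n d2" for n
  proof -
    obtain m where m: "[m = n] (mod d2)" "coprime m q" using ex_coprime_lift[OF \<open>q > 0\<close> d(2) n] by blast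
    have "[m = n] (mod g)" using m(1) unfolding g_def by (meson cong_dvd_modulus_nat gcd_dvd2)
    thus ?thesis using psi_eq[OF m(2)] eq(2)[OF m(2)] dcharacter_cong[OF d(4) m(1)] by simp
  qed
  ultimately show ?thesis using d unfolding g_def by (auto simp: induces_def)
qed

text \<open>Justifies the definite description in \<open>inducing_primitive\<close>: both characters
  are induced from modulus gcd d1 d2, so primitivity forces both moduli to equal it.\<close>

lemma primitive_inducing_unique:
  assumes "q > 0" "primitive_dcharacter d1 psi1" "induces d1 psi1 q chi"
    "primitive_dcharacter d2 psi2" "induces d2 psi2 q chi"
  shows "psi1 = psi2"
proof -
  obtain psi where psi: "induces (gcd d1 d2) psi d1 psi1" "induces (gcd d1 d2) psi d2 psi2"
    using ex_gcd_inducing[OF assms(1,3,5)] by blast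
  have "gcd d1 d2 = d1" "gcd d1 d2 = d2"
    using assms(2,4) psi unfolding primitive_dcharacter_def by blast+
  hence "d1 = d2" by simp
  show ?thesis
  proof
    fix n
    show "psi1 n = psi2 n"
      using psi dcharacter_eq_0_iff[of d1 psi1 n] dcharacter_eq_0_iff[of d2 psi2 n] \<open>d1 = d2\<close>
      unfolding induces_def by (cases "coprime n d1") metis+
  qed
qed

text \<open>A character of least modulus among those inducing chi is primitive, since being induced
  is transitive.\<close>

lemma ex_primitive_inducing:
  assumes "q > 0" "dcharacter q chi"
  shows "\<exists>d psi. primitive_dcharacter d psi \<and> induces d psi q chi"
proof -
  define P where "P d \<longleftrightarrow> (\<exists>psi. induces d psi q chi)" for d
  have "P q" using assms by (auto simp: P_def induces_def)
  define d where "d = (LEAST d. P d)"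
  have "P d" unfolding d_def by (rule LeastI) fact
  then obtain psi where psi: "induces d psi q chi" by (auto simp: P_def)
  have "d > 0" using psi assms by (auto simp: induces_def intro: Nat.gr0I)
  have "\<not> (induces d' psi' d psi)" if "d' \<noteq> d" for d' psi'
  proof
    assume ind: "induces d' psi' d psi"
    have "coprime n d" if "coprime n q" for n
      using that psi by (meson coprime_divisors dvd_refl induces_def)
    hence "induces d' psi' q chi" using ind psi unfolding induces_def by (metis dvd_trans)
    hence "P d'" by (auto simp: P_def)
    hence "d \<le> d'" unfolding d_def by (rule Least_le)
    moreover have "d' \<le> d" using ind \<open>d > 0\<close> by (auto simp: induces_def intro: dvd_imp_le)
    ultimately show False using that by simp
  qed
  hence "primitive_dcharacter d psi" using psi by (auto simp: primitive_dcharacter_def induces_def)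
  thus ?thesis using psi by blast
qed

lemma
  assumes "q > 0" "dcharacter q chi"
  shows inducing_primitive_mult: "inducing_primitive q chi (m * n) = inducing_primitive q chi m * inducing_primitive q chi n"
    and inducing_primitive_1: "inducing_primitive q chi (Suc 0) = 1"
    and norm_inducing_primitive_le: "norm (inducing_primitive q chi n) \<le> 1"
    and inducing_primitive_coprime: "coprime n q \<Longrightarrow> inducing_primitive q chi n = chi n"
proof -
  obtain d psi where psi: "primitive_dcharacter d psi" "induces d psi q chi"
    using ex_primitive_inducing[OF assms] by blast
  have eq: "inducing_primitive q chi = psi"
    unfolding inducing_primitive_def
    by (rule the_equality) (use psi primitive_inducing_unique[OF assms(1)] in blast)+
  have d: "dcharacter d psi" "d > 0" using psi assms by (auto simp: induces_def intro: Nat.gr0I)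
  show "inducing_primitive q chi (m * n) = inducing_primitive q chi m * inducing_primitive q chi n"
    "inducing_primitive q chi (Suc 0) = 1" "norm (inducing_primitive q chi n) \<le> 1"
    unfolding eq using d by (auto simp: dcharacter_mult norm_dcharacter_le)
  show "coprime n q \<Longrightarrow> inducing_primitive q chi n = chi n"
    unfolding eq using psi by (auto simp: induces_def)
qed

subsection \<open>Coefficients of products of \<open>L\<close>-functions\<close>

text \<open>Absolute convergence is part of the notion so that products may be regrouped by
  divisors. The index set starts at 1 to fit \<open>has_sum_divisors\<close>.\<close>

definition dirichlet_series_of :: "(nat \<Rightarrow> complex) \<Rightarrow> (complex \<Rightarrow> complex) \<Rightarrow> bool" where
  "dirichlet_series_of a F \<longleftrightarrow> a 0 = 0 \<and>
     (\<forall>s. Re s > 1 \<longrightarrow> (\<lambda>n. norm (a n / of_nat n powr s)) summable_on {1..} \<and>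
        ((\<lambda>n. a n / of_nat n powr s) has_sum F s) {1..})"

definition dirichlet_conv :: "(nat \<Rightarrow> complex) \<Rightarrow> (nat \<Rightarrow> complex) \<Rightarrow> nat \<Rightarrow> complex" where
  "dirichlet_conv a b n = (if n = 0 then 0 else \<Sum>d | d dvd n. a d * b (n div d))"

lemma dirichlet_series_of_sums:
  assumes "dirichlet_series_of a F" "Re s > 1"
  shows "(\<lambda>n. a n / of_nat n powr s) sums F s"
proof -
  have "((\<lambda>n. a n / of_nat n powr s) has_sum F s) {1..}"
    using assms by (auto simp: dirichlet_series_of_def)
  also have "?this \<longleftrightarrow> ((\<lambda>n. a n / of_nat n powr s) has_sum F s) UNIV"
    using assms by (intro has_sum_cong_neutral) (auto simp: dirichlet_series_of_def Suc_le_eq)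
  finally show ?thesis by (rule has_sum_imp_sums)
qed

lemma of_nat_mult_powr: "of_nat (d * m) powr (s::complex) = of_nat d powr s * of_nat m powr s"
  by (simp add: powr_times_real)

lemma dirichlet_series_of_conv:
  assumes "dirichlet_series_of a F" "dirichlet_series_of b G"
  shows "dirichlet_series_of (dirichlet_conv a b) (\<lambda>s. F s * G s)"
  unfolding dirichlet_series_of_def
proof (intro conjI allI impI)
  show "dirichlet_conv a b 0 = 0" by (simp add: dirichlet_conv_def)
next
  fix s :: complex assume s: "Re s > 1"
  define f where "f n = a n / of_nat n powr s" for n
  define g where "g n = b n / of_nat n powr s" for n
  have f: "(\<lambda>n. norm (f n)) summable_on {1..}" "(f has_sum F s) {1..}"
   and g: "(\<lambda>n. norm (g n)) summable_on {1..}" "(g has_sum G s) {1..}"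
    using assms s unfolding dirichlet_series_of_def f_def g_def by blast+
  have conv: "dirichlet_conv a b n / of_nat n powr s = (\<Sum>d | d dvd n. f d * g (n div d))" if "n \<in> {1..}" for n
  proof -
    have "(\<Sum>d | d dvd n. f d * g (n div d)) = (\<Sum>d | d dvd n. a d * b (n div d) / of_nat n powr s)"
    proof (intro sum.cong refl)
      fix d assume "d \<in> {d. d dvd n}"
      hence "of_nat n powr s = of_nat d powr s * of_nat (n div d) powr s"
        by (subst of_nat_mult_powr[symmetric]) simp
      thus "f d * g (n div d) = a d * b (n div d) / of_nat n powr s" by (simp add: f_def g_def)
    qed
    thus ?thesis using that by (simp add: dirichlet_conv_def sum_divide_distrib)
  qed
  have abs: "(\<lambda>(d, m). norm (f d) * norm (g m)) summable_on {1..} \<times> {1..}"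
  proof (rule summable_on_SigmaI)
    fix d :: nat
    show "((\<lambda>m. case (d, m) of (d, m) \<Rightarrow> norm (f d) * norm (g m)) has_sum (norm (f d) * infsum (\<lambda>m. norm (g m)) {1..})) {1..}"
      unfolding prod.case by (intro has_sum_cmult_right has_sum_infsum g)
    show "(\<lambda>d. norm (f d) * infsum (\<lambda>m. norm (g m)) {1..}) summable_on {1..}"
      by (intro summable_on_cmult_left f)
  qed auto
  then obtain B where B: "((\<lambda>(d, m). norm (f d) * norm (g m)) has_sum B) ({1..} \<times> {1..})"
    by (auto simp: summable_on_def)
  have "(\<lambda>n. \<Sum>d | d dvd n. norm (f d) * norm (g (n div d))) summable_on {1..}"
    using has_sum_divisors[OF B] by (auto simp: summable_on_def)
  thus "(\<lambda>n. norm (dirichlet_conv a b n / of_nat n powr s)) summable_on {1..}"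
  proof (rule summable_on_comparison_test)
    fix n :: nat assume n: "n \<in> {1..}"
    show "norm (dirichlet_conv a b n / of_nat n powr s) \<le> (\<Sum>d | d dvd n. norm (f d) * norm (g (n div d)))"
      unfolding conv[OF n] by (rule sum_norm_le) (simp add: norm_mult)
  qed auto
  have "(\<lambda>p. norm (case p of (d, m) \<Rightarrow> f d * g m)) summable_on {1..} \<times> {1..}"
    using abs by (simp add: case_prod_unfold norm_mult)
  hence "(\<lambda>(d, m). f d * g m) summable_on {1..} \<times> {1..}" by (rule abs_summable_summable)
  hence "((\<lambda>(d, m). f d * g m) has_sum (F s * G s)) ({1..} \<times> {1..})"
  proof (rule has_sum_SigmaI[rotated 2])
    show "((\<lambda>m. case (d, m) of (d, m) \<Rightarrow> f d * g m) has_sum (f d * G s)) {1..}" for d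
      unfolding prod.case by (intro has_sum_cmult_right g)
    show "((\<lambda>d. f d * G s) has_sum (F s * G s)) {1..}" by (intro has_sum_cmult_left f)
  qed
  from has_sum_divisors[OF this]
  have "((\<lambda>n. \<Sum>d | d dvd n. f d * g (n div d)) has_sum (F s * G s)) {1..}" by simp
  also have "?this \<longleftrightarrow> ((\<lambda>n. dirichlet_conv a b n / of_nat n powr s) has_sum (F s * G s)) {1..}"
    by (rule has_sum_cong) (simp add: conv)
  finally show "((\<lambda>n. dirichlet_conv a b n / of_nat n powr s) has_sum (F s * G s)) {1..}" .
qed

text \<open>The Bell series of a at p, under which Dirichlet convolution becomes multiplication of
  power series.\<close>

definition local_fps :: "(nat \<Rightarrow> complex) \<Rightarrow> nat \<Rightarrow> complex fps" where
  "local_fps a p = Abs_fps (\<lambda>m. a (p ^ m))"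

lemma local_fps_conv:
  assumes "prime p"
  shows "local_fps (dirichlet_conv a b) p = local_fps a p * local_fps b p"
proof (rule fps_ext)
  fix m
  have "p > 0" using assms prime_gt_0_nat by blast
  have "local_fps (dirichlet_conv a b) p $ m = (\<Sum>d | d dvd p ^ m. a d * b (p ^ m div d))"
    using \<open>p > 0\<close> by (simp add: local_fps_def dirichlet_conv_def)
  also have "\<dots> = (\<Sum>i\<le>m. a (p ^ i) * b (p ^ m div p ^ i))"
    by (rule sum_divisors_prime_power[OF assms])
  also have "\<dots> = (\<Sum>i\<le>m. a (p ^ i) * b (p ^ (m - i)))"
    using \<open>p > 0\<close> by (intro sum.cong refl) (simp add: power_diff)
  finally show "local_fps (dirichlet_conv a b) p $ m = (local_fps a p * local_fps b p) $ m"
    by (simp add: local_fps_def fps_mult_nth atMost_atLeast0)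
qed

text \<open>Keeps the analytic function and the Bell series together, so that following the product
  structure of \<open>L_prod\<close> yields \<open>d_coeff\<close> at prime powers.\<close>

definition has_local_factors :: "(nat \<Rightarrow> complex) \<Rightarrow> (complex \<Rightarrow> complex) \<Rightarrow> (nat \<Rightarrow> complex fps) \<Rightarrow> bool" where
  "has_local_factors a F phi \<longleftrightarrow> dirichlet_series_of a F \<and> (\<forall>p. prime p \<longrightarrow> local_fps a p = phi p)"

lemma has_local_factors_mult:
  "\<exists>a. has_local_factors a F phi \<Longrightarrow> \<exists>b. has_local_factors b G theta \<Longrightarrow>
    \<exists>c. has_local_factors c (\<lambda>s. F s * G s) (\<lambda>p. phi p * theta p)"
  unfolding has_local_factors_def using dirichlet_series_of_conv local_fps_conv by metis

lemma has_local_factors_1: "\<exists>a. has_local_factors a (\<lambda>s. 1) (\<lambda>p. 1)"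
proof (intro exI[of _ "\<lambda>n. if n = 1 then 1 else 0"], unfold has_local_factors_def, intro conjI allI impI)
  show "dirichlet_series_of (\<lambda>n. if n = 1 then 1 else 0) (\<lambda>s. 1)"
    unfolding dirichlet_series_of_def
  proof (intro conjI allI impI)
    fix s :: complex
    have "((\<lambda>n. (if n = 1 then 1 else 0) / of_nat n powr s) has_sum (\<Sum>n\<in>{1}. (if n = 1 then 1 else 0) / of_nat n powr s)) {1..}"
      by (rule has_sum_finite_neutralI[of "{1}"]) auto
    thus "((\<lambda>n. (if n = 1 then 1 else 0) / of_nat n powr s) has_sum 1) {1..}" by simp
    show "(\<lambda>n. norm ((if n = 1 then 1 else 0) / of_nat n powr s)) summable_on {1..}"
      by (rule finite_nonzero_values_imp_summable_on) (rule finite_subset[of _ "{1}"], auto)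
  qed auto
  fix p :: nat assume "prime p"
  hence "p > 1" by (rule prime_gt_1_nat)
  thus "local_fps (\<lambda>n. if n = 1 then 1 else 0) p = 1"
    by (intro fps_ext) (auto simp: local_fps_def)
qed

lemma has_local_factors_power:
  assumes "\<exists>a. has_local_factors a F phi"
  shows "\<exists>a. has_local_factors a (\<lambda>s. F s ^ k) (\<lambda>p. phi p ^ k)"
proof (induction k)
  case (Suc k)
  show ?case using has_local_factors_mult[OF assms Suc] by simp
qed (use has_local_factors_1 in simp)

lemma has_local_factors_prod:
  assumes "finite A" "\<And>x. x \<in> A \<Longrightarrow> \<exists>a. has_local_factors a (F x) (phi x)"
  shows "\<exists>a. has_local_factors a (\<lambda>s. \<Prod>x\<in>A. F x s) (\<lambda>p. \<Prod>x\<in>A. phi x p)"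
  using assms
proof (induction A rule: finite_induct)
  case (insert x A)
  have "\<exists>a. has_local_factors a (F x) (phi x)" "\<exists>a. has_local_factors a (\<lambda>s. \<Prod>x\<in>A. F x s) (\<lambda>p. \<Prod>x\<in>A. phi x p)"
    using insert by auto
  from has_local_factors_mult[OF this] show ?case using insert.hyps by simp
qed (use has_local_factors_1 in simp)

lemma has_local_factors_dirichlet_L:
  assumes "dcharacter q chi" "q > 0"
  shows "\<exists>a. has_local_factors a (dirichlet_L chi) (\<lambda>p. Abs_fps (\<lambda>m. chi p ^ m))"
proof (intro exI[of _ "\<lambda>n. if n = 0 then 0 else chi n"], unfold has_local_factors_def, intro conjI allI impI)
  show "dirichlet_series_of (\<lambda>n. if n = 0 then 0 else chi n) (dirichlet_L chi)"
    unfolding dirichlet_series_of_def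
  proof (intro conjI allI impI)
    fix s :: complex assume s: "Re s > 1"
    define f where "f n = chi n / of_nat n powr s" for n
    have "norm (f n) \<le> real n powr - Re s" for n
    proof (cases "n = 0")
      case False
      have "norm (f n) = norm (chi n) / real n powr Re s"
        using False by (simp add: f_def norm_divide norm_powr_real_powr)
      also have "\<dots> \<le> 1 / real n powr Re s" by (intro divide_right_mono norm_dcharacter_le[OF assms]) auto
      finally show ?thesis by (simp add: powr_minus divide_inverse)
    qed (simp add: f_def)
    moreover have "summable (\<lambda>n. real n powr - Re s)" using s by (simp add: summable_real_powr_iff)
    ultimately have sm: "summable (\<lambda>n. norm (f n))"
      by (intro summable_comparison_test[of "\<lambda>n. norm (f n)"]) auto
    have neutral: "f n = (if n = 0 then 0 else chi n) / of_nat n powr s" for n by (simp add: f_def)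
    show "(\<lambda>n. norm ((if n = 0 then 0 else chi n) / of_nat n powr s)) summable_on {1..}"
      unfolding neutral[symmetric]
      by (rule summable_on_subset_banach[of _ UNIV]) (use sm in \<open>auto intro!: norm_summable_imp_summable_on\<close>)
    have "(f has_sum dirichlet_L chi s) UNIV"
      unfolding dirichlet_L_def f_def[symmetric]
      by (intro norm_summable_imp_has_sum summable_sums sm summable_norm_cancel)
    also have "?this \<longleftrightarrow> (f has_sum dirichlet_L chi s) {1..}"
      by (rule has_sum_cong_neutral) (auto simp: f_def Suc_le_eq)
    finally show "((\<lambda>n. (if n = 0 then 0 else chi n) / of_nat n powr s) has_sum dirichlet_L chi s) {1..}"
      unfolding neutral[symmetric] .
  qed auto
  fix p :: nat assume "prime p"
  thus "local_fps (\<lambda>n. if n = 0 then 0 else chi n) p = Abs_fps (\<lambda>m. chi p ^ m)"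
    by (intro fps_ext) (auto simp: local_fps_def dcharacter_power[OF assms(1)])
qed

section \<open>Uniqueness of Dirichlet coefficients\<close>

text \<open>If n0 is the first index with a nonzero coefficient, multiplying the series at s by (n0
  + 1)^t makes the term at n0 grow like ((n0 + 1)/n0)^t while the later terms stay bounded in
  total.\<close>

lemma dirichlet_series_zero_coeffs:
  fixes c :: "nat \<Rightarrow> complex"
  assumes "c 0 = 0" and sums: "\<And>s. Re s > \<sigma> \<Longrightarrow> (\<lambda>n. c n / of_nat n powr s) sums 0"
  shows "c n = 0"
proof (rule ccontr)
  assume "c n \<noteq> 0"
  define n0 where "n0 = (LEAST n. c n \<noteq> 0)"
  have n0: "c n0 \<noteq> 0" unfolding n0_def by (rule LeastI[of "\<lambda>n. c n \<noteq> 0"]) fact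
  have least: "c n = 0" if "n < n0" for n using not_less_Least that unfolding n0_def by blast
  have "n0 > 0" using n0 assms(1) by (auto intro: Nat.gr0I)
  define s0 where "s0 = \<sigma> + 1"
  have "summable (\<lambda>n. c n / of_nat n powr (complex_of_real s0))"
    using sums[of "complex_of_real s0"] by (auto simp: s0_def sums_iff)
  hence "Bseq (\<lambda>n. c n / of_nat n powr (complex_of_real s0))"
    by (intro convergent_imp_Bseq convergentI[OF summable_LIMSEQ_zero])
  then obtain B where B: "\<And>n. norm (c n / of_nat n powr (complex_of_real s0)) \<le> B" by (auto simp: Bseq_def)
  have "B \<ge> 0" using order.trans[OF norm_ge_zero B] .
  have c_le: "norm (c n) / real n powr s0 \<le> B" for n
    using B[of n] by (cases "n = 0") (auto simp: norm_divide norm_powr_real_powr assms(1))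
  define Z where "Z = (\<Sum>n. real n powr - 2)"
  have smZ: "summable (\<lambda>n. real n powr - 2)" by (simp add: summable_real_powr_iff)
  have main: "norm (c n0) * real n0 powr - (s0 + 2) * (real (Suc n0) / real n0) powr t \<le> B * Z" if "t \<ge> 0" for t
  proof -
    \<comment> \<open>The exponent s0 keeps the coefficients bounded, 2 makes the remaining sum
      converge, and t tends to infinity.\<close>
    define s where "s = s0 + 2 + t"
    define f where "f n = c n / of_nat n powr (complex_of_real s)" for n
    have f0: "f sums 0" unfolding f_def by (rule sums) (use that in \<open>simp add: s_def s0_def\<close>)
    have "norm (f n) = norm (c n) / real n powr s" for n
      by (cases "n = 0") (auto simp: f_def norm_divide norm_powr_real_powr assms(1))
    hence f_norm: "norm (f n) = norm (c n) * real n powr - s" for n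
      by (simp add: powr_minus divide_inverse)
    define N where "N = Suc n0"
    have "(\<lambda>n. f (n + N)) sums (0 - (\<Sum>n<N. f n))" by (rule sums_split_initial_segment[OF f0])
    moreover have "(\<Sum>n<N. f n) = f n0"
      by (simp add: N_def f_def least)
    ultimately have tail: "(\<lambda>n. f (n + N)) sums (- f n0)" by simp
    have le: "norm (f (n + N)) \<le> B * real N powr - t * real (n + N) powr - 2" for n
    proof -
      have pos: "real (n + N) > 0" by (simp add: N_def)
      have "real (n + N) powr - s = real (n + N) powr - s0 * (real (n + N) powr - t * real (n + N) powr - 2)"
      proof -
        have "- s = - s0 + (- t + - 2)" by (simp add: s_def)
        thus ?thesis by (simp only: powr_add)
      qed
      hence "norm (f (n + N)) = norm (c (n + N)) / real (n + N) powr s0 * (real (n + N) powr - t * real (n + N) powr - 2)"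
        unfolding f_norm by (simp add: powr_minus divide_inverse)
      also have "\<dots> \<le> B * (real N powr - t * real (n + N) powr - 2)"
        using that \<open>B \<ge> 0\<close> by (intro mult_mono c_le powr_mono2' mult_right_mono) (auto simp: N_def)
      finally show ?thesis by simp
    qed
    have smt: "summable (\<lambda>n. B * real N powr - t * real (n + N) powr - 2)"
      by (intro summable_mult summable_ignore_initial_segment smZ)
    have "norm (f n0) = norm (\<Sum>n. f (n + N))" using tail by (simp add: sums_iff)
    also have "\<dots> \<le> (\<Sum>n. B * real N powr - t * real (n + N) powr - 2)"
      by (rule norm_suminf_le[OF le smt])
    also have "\<dots> = B * real N powr - t * (\<Sum>n. real (n + N) powr - 2)"
      by (intro suminf_mult summable_ignore_initial_segment smZ)
    also have "(\<Sum>n. real (n + N) powr - 2) \<le> Z"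
      unfolding Z_def suminf_split_initial_segment[OF smZ, of N] by (simp add: sum_nonneg)
    finally have "norm (c n0) * real n0 powr - s \<le> B * real N powr - t * Z"
      using \<open>B \<ge> 0\<close> by (simp add: f_norm mult_left_mono)
    hence "norm (c n0) * real n0 powr - s * real N powr t \<le> B * real N powr - t * Z * real N powr t"
      by (rule mult_right_mono) simp
    also have "\<dots> = B * Z * (real N powr - t * real N powr t)" by (simp only: mult_ac)
    also have "real N powr - t * real N powr t = 1" unfolding powr_add[symmetric] by (simp add: N_def)
    finally have "norm (c n0) * (real n0 powr - s * real N powr t) \<le> B * Z" by (simp only: mult_ac mult_1_right mult_1)
    moreover have "real n0 powr - s * real N powr t = real n0 powr - (s0 + 2) * (real N / real n0) powr t"
    proof -
      have "- s = - (s0 + 2) + - t" by (simp add: s_def)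
      hence "real n0 powr - s = real n0 powr - (s0 + 2) * real n0 powr - t" by (simp only: powr_add)
      thus ?thesis by (simp add: powr_divide powr_minus_divide)
    qed
    ultimately show ?thesis unfolding N_def by (simp only: mult.assoc)
  qed
  define r where "r = real (Suc n0) / real n0"
  have "r > 1" using \<open>n0 > 0\<close> by (simp add: r_def)
  have K: "norm (c n0) * real n0 powr - (s0 + 2) > 0" using n0 \<open>n0 > 0\<close> by simp
  have "filterlim (\<lambda>t. norm (c n0) * real n0 powr - (s0 + 2) * r powr t) at_top at_top"
    using K \<open>r > 1\<close> by real_asymp
  hence "eventually (\<lambda>t. norm (c n0) * real n0 powr - (s0 + 2) * r powr t > B * Z) at_top"
    by (simp add: filterlim_at_top_dense)
  hence "eventually (\<lambda>t. norm (c n0) * real n0 powr - (s0 + 2) * r powr t > B * Z \<and> t \<ge> 0) at_top"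
    by (intro eventually_conj eventually_ge_at_top)
  then obtain t where "norm (c n0) * real n0 powr - (s0 + 2) * r powr t > B * Z" "t \<ge> 0"
    by (auto simp: eventually_at_top_linorder)
  with main[of t] show False by (simp add: r_def)
qed

lemma dirichlet_coeffs_eq:
  assumes "dirichlet_series_of a F"
  shows "dirichlet_coeffs F = a"
  unfolding dirichlet_coeffs_def
proof (rule the_equality)
  show "a 0 = 0 \<and> (\<exists>\<sigma>. \<forall>s. Re s > \<sigma> \<longrightarrow> (\<lambda>n. a n / of_nat n powr s) sums F s)"
    using assms dirichlet_series_of_sums[OF assms] by (auto simp: dirichlet_series_of_def)
next
  fix b assume "b 0 = 0 \<and> (\<exists>\<sigma>. \<forall>s. Re s > \<sigma> \<longrightarrow> (\<lambda>n. b n / of_nat n powr s) sums F s)"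
  then obtain \<sigma> where b: "b 0 = 0" "\<And>s. Re s > \<sigma> \<Longrightarrow> (\<lambda>n. b n / of_nat n powr s) sums F s" by auto
  show "b = a"
  proof
    fix n
    have "b n - a n = 0"
    \<comment> \<open>A competing sequence may represent F only in a smaller half-plane, so both are
      compared where both converge.\<close>
    proof (rule dirichlet_series_zero_coeffs[where \<sigma> = "max \<sigma> 1"])
      show "b 0 - a 0 = 0" using b assms by (simp add: dirichlet_series_of_def)
      fix s :: complex assume "Re s > max \<sigma> 1"
      hence "(\<lambda>n. b n / of_nat n powr s - a n / of_nat n powr s) sums (F s - F s)"
        by (intro sums_diff b dirichlet_series_of_sums[OF assms]) auto
      thus "(\<lambda>n. (b n - a n) / of_nat n powr s) sums 0" by (simp add: diff_divide_distrib)
    qed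
    thus "b n = a n" by simp
  qed
qed

theorem d_coeff_local_fps:
  assumes "q > 0" "prime p"
  shows "Abs_fps (\<lambda>m. d_coeff q l (p ^ m)) = (\<Prod>chi\<in>dcharacters q. Abs_fps (\<lambda>m. chi p ^ m) ^ l chi)"
proof -
  have "\<exists>a. has_local_factors a (\<lambda>s. \<Prod>chi\<in>dcharacters q. dirichlet_L chi s ^ l chi)
      (\<lambda>p. \<Prod>chi\<in>dcharacters q. Abs_fps (\<lambda>m. chi p ^ m) ^ l chi)"
    using assms(1)
    by (intro has_local_factors_prod has_local_factors_power has_local_factors_dirichlet_L finite_dcharacters)
      (auto simp: dcharacters_def)
  then obtain a where a: "dirichlet_series_of a (L_prod q l)"
    "local_fps a p = (\<Prod>chi\<in>dcharacters q. Abs_fps (\<lambda>m. chi p ^ m) ^ l chi)"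
    using assms(2) unfolding has_local_factors_def L_prod_def[abs_def] by blast
  thus ?thesis using dirichlet_coeffs_eq[OF a(1)] by (simp add: d_coeff_def local_fps_def)
qed

section \<open>Euler factors as exponentials of power series\<close>

definition log_fps :: "(nat \<Rightarrow> complex) \<Rightarrow> complex fps" where
  "log_fps e = Abs_fps (\<lambda>j. e j / of_nat j)"

text \<open>The coefficient of z^m in exp of the sum of e_j z^j / j. For a genuine Euler factor the
  e_j are the power sums of its local roots.\<close>

definition exp_coeff :: "(nat \<Rightarrow> complex) \<Rightarrow> nat \<Rightarrow> complex" where
  "exp_coeff e m = fps_nth (fps_exp 1 oo log_fps e) m"

definition log_series :: "(nat \<Rightarrow> complex) \<Rightarrow> complex \<Rightarrow> complex" where
  "log_series e z = (\<Sum>j. e j / of_nat j * z ^ j)"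

lemma log_fps_nth_0 [simp]: "fps_nth (log_fps e) 0 = 0"
  by (simp add: log_fps_def)

lemma exp_coeff_0 [simp]: "exp_coeff e 0 = 1"
  by (simp add: exp_coeff_def fps_compose_nth)

text \<open>Only e_1, ..., e_m matter. Thus truncating the exponent at p^j <= X leaves the
  coefficients with p^m <= X unchanged.\<close>

lemma exp_coeff_cong:
  assumes "\<And>j. 1 \<le> j \<Longrightarrow> j \<le> m \<Longrightarrow> e j = e' j"
  shows "exp_coeff e m = exp_coeff e' m"
proof -
  have base: "fps_nth (log_fps e) j = fps_nth (log_fps e') j" if "j \<le> m" for j
    using assms[of j] that by (cases "j = 0") (auto simp: log_fps_def)
  have "fps_nth (log_fps e ^ i) j = fps_nth (log_fps e' ^ i) j" if "j \<le> m" for i j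
    using that
  proof (induction i arbitrary: j)
    case (Suc i)
    have "fps_nth (log_fps e ^ Suc i) j = (\<Sum>t=0..j. fps_nth (log_fps e) t * fps_nth (log_fps e ^ i) (j - t))"
      by (simp add: fps_mult_nth)
    also have "\<dots> = (\<Sum>t=0..j. fps_nth (log_fps e') t * fps_nth (log_fps e' ^ i) (j - t))"
    proof (intro sum.cong refl)
      fix t assume "t \<in> {0..j}"
      thus "fps_nth (log_fps e) t * fps_nth (log_fps e ^ i) (j - t) = fps_nth (log_fps e') t * fps_nth (log_fps e' ^ i) (j - t)"
        using Suc.IH[of "j - t"] base[of t] Suc.prems by simp
    qed
    also have "\<dots> = fps_nth (log_fps e' ^ Suc i) j" by (simp add: fps_mult_nth)
    finally show ?case .
  qed simp
  thus ?thesis by (simp add: exp_coeff_def fps_compose_nth)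
qed

context
  fixes e :: "nat \<Rightarrow> complex" and k :: nat
  assumes e_le: "\<And>j. norm (e j) \<le> real k"
begin

lemma log_series_sums_bound:
  assumes "norm z < 1"
  shows "summable (\<lambda>j. norm (e j / of_nat j * z ^ j))"
    "(\<lambda>j. e j / of_nat j * z ^ j) sums log_series e z"
    "norm (log_series e z) \<le> - real k * ln (1 - norm z)"
proof -
  have lnx: "(\<lambda>j. norm z ^ j / real j) sums (- ln (1 - norm z))"
  proof -
    have "(\<lambda>j. complex_of_real (norm z) ^ j / of_nat j) sums (- Ln (1 - complex_of_real (norm z)))"
      by (rule Ln_one_minus_sums) (use assms in auto)
    moreover have "Ln (1 - complex_of_real (norm z)) = of_real (ln (1 - norm z))"
      using assms by (subst Ln_of_real[symmetric]) auto
    ultimately have "(\<lambda>j. complex_of_real (norm z ^ j / real j)) sums complex_of_real (- ln (1 - norm z))" by simp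
    thus ?thesis by (simp only: sums_of_real_iff)
  qed
  have kln: "(\<lambda>j. real k * (norm z ^ j / real j)) sums (real k * (- ln (1 - norm z)))"
    by (rule sums_mult[OF lnx])
  have le: "norm (e j / of_nat j * z ^ j) \<le> real k * (norm z ^ j / real j)" for j
  proof -
    have "norm (e j / of_nat j * z ^ j) = norm (e j) * (norm z ^ j / real j)"
      by (simp add: norm_mult norm_divide norm_power)
    also have "\<dots> \<le> real k * (norm z ^ j / real j)" by (intro mult_right_mono e_le) auto
    finally show ?thesis .
  qed
  show sm: "summable (\<lambda>j. norm (e j / of_nat j * z ^ j))"
    by (rule summable_comparison_test[OF _ sums_summable[OF kln]]) (use le in auto)
  show "(\<lambda>j. e j / of_nat j * z ^ j) sums log_series e z"
    unfolding log_series_def by (rule summable_sums[OF summable_norm_cancel[OF sm]])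
  have "norm (log_series e z) \<le> (\<Sum>j. real k * (norm z ^ j / real j))"
    unfolding log_series_def by (rule norm_suminf_le[OF le sums_summable[OF kln]])
  thus "norm (log_series e z) \<le> - real k * ln (1 - norm z)" using kln by (simp add: sums_iff)
qed

lemma log_fps_conv_radius: "fps_conv_radius (log_fps e) \<ge> 1"
  unfolding fps_conv_radius_def
proof (rule conv_radius_geI_ex)
  fix r :: real assume r: "r > 0" "ereal r < 1"
  show "\<exists>z::complex. norm z = r \<and> summable (\<lambda>n. fps_nth (log_fps e) n * z ^ n)"
    using r log_series_sums_bound(1)[of "of_real r"]
    by (intro exI[of _ "of_real r"]) (auto simp: log_fps_def intro: summable_norm_cancel)
qed

lemma eval_log_fps: "eval_fps (log_fps e) z = log_series e z"
  by (simp add: eval_fps_def log_fps_def log_series_def)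

lemma exp_log_series_holomorphic: "(\<lambda>z. exp (log_series e z)) holomorphic_on ball 0 1"
proof -
  have "ereal (norm z) < fps_conv_radius (log_fps e)" if "norm z < 1" for z :: complex
    using that by (intro less_le_trans[OF _ log_fps_conv_radius]) (simp add: one_ereal_def)
  hence "eval_fps (log_fps e) holomorphic_on ball 0 1"
    by (intro holomorphic_on_eval_fps) auto
  from holomorphic_on_compose[OF this holomorphic_on_exp]
  have "(\<lambda>z. exp (eval_fps (log_fps e) z)) holomorphic_on ball 0 1" by (simp add: o_def)
  thus ?thesis by (simp add: eval_log_fps)
qed

lemma exp_log_series_has_fps_expansion:
  "(\<lambda>z. exp (log_series e z)) has_fps_expansion (fps_exp 1 oo log_fps e)"
proof -
  have "fps_conv_radius (log_fps e) > 0" by (intro less_le_trans[OF _ log_fps_conv_radius]) simp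
  hence "eval_fps (log_fps e) has_fps_expansion log_fps e" by (rule eval_fps_has_fps_expansion)
  from has_fps_expansion_compose[OF has_fps_expansion_exp1 this]
  show ?thesis by (simp add: o_def eval_log_fps)
qed

lemma exp_coeff_sums:
  assumes "norm z < 1"
  shows "(\<lambda>m. exp_coeff e m * z ^ m) sums exp (log_series e z)"
  unfolding exp_coeff_def
  by (rule has_fps_expansion_imp_sums_complex[where r = 1])
    (use exp_log_series_has_fps_expansion exp_log_series_holomorphic assms in \<open>auto simp: one_ereal_def\<close>)

text \<open>Cauchy's inequality on the circle of radius r, where the exponential is at most (1 -
  r)^(-k) because |e_j| <= k.\<close>

lemma norm_exp_coeff_le:
  assumes "0 < r" "r < 1"
  shows "norm (exp_coeff e m) \<le> exp (- real k * ln (1 - r)) / r ^ m"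
proof -
  have le: "norm ((deriv ^^ m) (\<lambda>z. exp (log_series e z)) 0) \<le> fact m * exp (- real k * ln (1 - r)) / r ^ m"
  proof (rule Cauchy_inequality)
    show "(\<lambda>z. exp (log_series e z)) holomorphic_on ball 0 r"
      using exp_log_series_holomorphic by (rule holomorphic_on_subset) (use assms in auto)
    have "(\<lambda>z. exp (log_series e z)) holomorphic_on cball 0 r"
      using exp_log_series_holomorphic by (rule holomorphic_on_subset) (use assms in auto)
    thus "continuous_on (cball 0 r) (\<lambda>z. exp (log_series e z))" by (rule holomorphic_on_imp_continuous_on)
    fix z :: complex assume "norm (0 - z) = r"
    hence z: "norm z = r" by simp
    have "norm (exp (log_series e z)) \<le> exp (norm (log_series e z))" by (rule norm_exp)
    also have "\<dots> \<le> exp (- real k * ln (1 - r))" using log_series_sums_bound(3)[of z] z assms by simp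
    finally show "norm (exp (log_series e z)) \<le> exp (- real k * ln (1 - r))" .
  qed (use assms in auto)
  have "exp_coeff e m = (deriv ^^ m) (\<lambda>z. exp (log_series e z)) 0 / fact m"
    unfolding exp_coeff_def by (rule fps_nth_fps_expansion[OF exp_log_series_has_fps_expansion])
  hence "norm (exp_coeff e m) = norm ((deriv ^^ m) (\<lambda>z. exp (log_series e z)) 0) / fact m"
    by (simp add: norm_divide)
  also have "\<dots> \<le> fact m * exp (- real k * ln (1 - r)) / r ^ m / fact m"
    by (rule divide_right_mono[OF le]) simp
  finally show ?thesis by simp
qed

end

lemma log_series_linear:
  fixes l :: "'a \<Rightarrow> nat"
  assumes "finite A" "\<And>x j. x \<in> A \<Longrightarrow> norm (c x j) \<le> 1" "norm z < 1"
  shows "log_series (\<lambda>j. \<Sum>x\<in>A. of_nat (l x) * c x j) z = (\<Sum>x\<in>A. of_nat (l x) * log_series (c x) z)"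
proof -
  have "(\<lambda>j. \<Sum>x\<in>A. of_nat (l x) * (c x j / of_nat j * z ^ j)) sums (\<Sum>x\<in>A. of_nat (l x) * log_series (c x) z)"
    using assms by (intro sums_sum sums_mult log_series_sums_bound(2)[where k = 1]) auto
  moreover have "(\<Sum>x\<in>A. of_nat (l x) * (c x j / of_nat j * z ^ j)) = (\<Sum>x\<in>A. of_nat (l x) * c x j) / of_nat j * z ^ j" for j
    unfolding sum_distrib_right sum_divide_distrib by (intro sum.cong) auto
  ultimately show ?thesis unfolding log_series_def by (simp add: sums_iff)
qed

lemma log_series_powers:
  assumes "norm u \<le> 1" "norm z < 1"
  shows "log_series (\<lambda>j. u ^ j) z = - Ln (1 - u * z)" "exp (log_series (\<lambda>j. u ^ j) z) = 1 / (1 - u * z)"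
proof -
  have uz: "norm (u * z) < 1"
    using mult_left_le_one_le[of "norm z" "norm u"] assms by (simp add: norm_mult)
  have "(\<lambda>j. u ^ j / of_nat j * z ^ j) sums (- Ln (1 - u * z))"
    using Ln_one_minus_sums[OF uz] by (simp add: power_mult_distrib)
  thus *: "log_series (\<lambda>j. u ^ j) z = - Ln (1 - u * z)" by (simp add: log_series_def sums_iff)
  have "1 - u * z \<noteq> 0" using uz by auto
  thus "exp (log_series (\<lambda>j. u ^ j) z) = 1 / (1 - u * z)" unfolding * by (simp add: exp_minus divide_inverse)
qed

text \<open>Both series expand the same function near 0: the product of (1 - u z)^(-l) is the
  exponential of the sum of l (u z)^j / j. Uniqueness of expansions identifies them.\<close>

lemma prod_geometric_eq_exp_coeff:
  fixes l :: "'a \<Rightarrow> nat"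
  assumes "finite A" "\<And>x. x \<in> A \<Longrightarrow> norm (u x) \<le> 1"
  shows "(\<Prod>x\<in>A. Abs_fps (\<lambda>m. u x ^ m) ^ l x) = Abs_fps (exp_coeff (\<lambda>j. \<Sum>x\<in>A. of_nat (l x) * u x ^ j))"
proof (rule fps_expansion_unique_complex)
  let ?e = "\<lambda>j. \<Sum>x\<in>A. of_nat (l x) * u x ^ j"
  have e: "norm (?e j) \<le> real (\<Sum>x\<in>A. l x)" for j
    unfolding of_nat_sum by (rule sum_norm_le)
      (use assms in \<open>auto simp: norm_mult norm_power intro!: mult_left_le power_le_one\<close>)
  show "(\<lambda>z. exp (log_series ?e z)) has_fps_expansion Abs_fps (exp_coeff ?e)"
    using exp_log_series_has_fps_expansion[OF e] by (simp add: exp_coeff_def[abs_def] fps_nth_inverse)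
  have ev: "eventually (\<lambda>z::complex. norm z < 1) (nhds 0)"
    using eventually_nhds_in_open[of "ball 0 1" "0::complex"] by (auto simp: eventually_mono)
  have geo: "(\<lambda>z. 1 / (1 - u x * z)) has_fps_expansion Abs_fps (\<lambda>m. u x ^ m)" if "x \<in> A" for x
  proof (rule has_fps_expansionI, rule eventually_mono[OF ev])
    fix z :: complex assume "norm z < 1"
    hence "norm (u x * z) < 1"
      using mult_left_le_one_le[of "norm z" "norm (u x)"] assms(2)[OF that] by (simp add: norm_mult)
    from geometric_sums[OF this]
    show "(\<lambda>n. fps_nth (Abs_fps (\<lambda>m. u x ^ m)) n * z ^ n) sums (1 / (1 - u x * z))"
      by (simp add: power_mult_distrib)
  qed
  have "(\<lambda>z. \<Prod>x\<in>A. (1 / (1 - u x * z)) ^ l x) has_fps_expansion (\<Prod>x\<in>A. Abs_fps (\<lambda>m. u x ^ m) ^ l x)"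
    by (intro has_fps_expansion_prod has_fps_expansion_power geo)
  moreover have "eventually (\<lambda>z. (\<Prod>x\<in>A. (1 / (1 - u x * z)) ^ l x) = exp (log_series ?e z)) (nhds 0)"
  proof (rule eventually_mono[OF ev])
    fix z :: complex assume z: "norm z < 1"
    have "exp (log_series ?e z) = (\<Prod>x\<in>A. exp (log_series (\<lambda>j. u x ^ j) z) ^ l x)"
      using assms z
      by (subst log_series_linear) (auto simp: norm_power power_le_one exp_sum exp_of_nat_mult)
    also have "\<dots> = (\<Prod>x\<in>A. (1 / (1 - u x * z)) ^ l x)"
      using assms z by (intro prod.cong refl) (simp add: log_series_powers(2))
    finally show "(\<Prod>x\<in>A. (1 / (1 - u x * z)) ^ l x) = exp (log_series ?e z)" ..
  qed
  ultimately show "(\<lambda>z. exp (log_series ?e z)) has_fps_expansion (\<Prod>x\<in>A. Abs_fps (\<lambda>m. u x ^ m) ^ l x)"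
    by (auto simp: has_fps_expansion_def elim: eventually_elim2)
qed

lemma d_coeff_prime_power:
  assumes "q > 0" "prime p"
  shows "d_coeff q l (p ^ m) = exp_coeff (\<lambda>j. \<Sum>chi\<in>dcharacters q. of_nat (l chi) * chi p ^ j) m"
proof -
  have "Abs_fps (\<lambda>m. d_coeff q l (p ^ m)) = Abs_fps (exp_coeff (\<lambda>j. \<Sum>chi\<in>dcharacters q. of_nat (l chi) * chi p ^ j))"
    unfolding d_coeff_local_fps[OF assms] using assms
    by (intro prod_geometric_eq_exp_coeff finite_dcharacters norm_dcharacter_le) (auto simp: dcharacters_def)
  thus ?thesis by (simp add: fps_eq_iff)
qed

lemma exp_coeff_1 [simp]: "exp_coeff e (Suc 0) = e 1"
  by (simp add: exp_coeff_def fps_compose_nth log_fps_def)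

lemma d_coeff_prime:
  assumes "q > 0" "prime p"
  shows "d_coeff q l p = (\<Sum>chi\<in>dcharacters q. of_nat (l chi) * chi p)"
  using d_coeff_prime_power[OF assms, of l 1] by simp

subsection \<open>Mean values of Dirichlet series\<close>

text \<open>With w = - ln n this is n^(-it).\<close>

definition osc :: "real \<Rightarrow> real \<Rightarrow> complex" where
  "osc w t = exp (\<i> * of_real (w * t))"

lemma norm_osc [simp]: "norm (osc w t) = 1"
  by (simp add: osc_def)

lemma osc_add: "osc (v + w) t = osc v t * osc w t"
  by (simp add: osc_def exp_add[symmetric] algebra_simps)

lemma cnj_osc: "cnj (osc w t) = osc (- w) t"
  by (simp add: osc_def exp_cnj)

lemma continuous_osc [continuous_intros]: "continuous_on A (osc w)"
  unfolding osc_def by (intro continuous_intros)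

lemma osc_integral_bound:
  assumes "T > 0"
  obtains I where "(osc w has_integral I) {T..2 * T}" "w = 0 \<Longrightarrow> I = of_real T"
    "norm I \<le> T" "w \<noteq> 0 \<Longrightarrow> norm I \<le> 2 / \<bar>w\<bar>"
proof -
  have "osc w integrable_on {T..2 * T}" by (intro integrable_continuous_real continuous_intros)
  then obtain I where I: "(osc w has_integral I) {T..2 * T}" by blast
  show ?thesis
  proof (rule that[OF I])
    show "norm I \<le> T"
    proof -
      have "norm I \<le> 1 * measure lborel {T..2 * T}"
        by (rule has_integral_bound_real[OF _ finite.emptyI]) (use I in auto)
      thus ?thesis using assms by simp
    qed
    show "I = of_real T" if "w = 0"
    proof -
      have "osc w = (\<lambda>_. 1)" using that by (simp add: osc_def fun_eq_iff)
      moreover have "((\<lambda>_. 1 :: complex) has_integral (measure lborel {T..2 * T} *\<^sub>R 1)) {T..2 * T}"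
        by (rule has_integral_const_real)
      ultimately have "I = measure lborel {T..2 * T} *\<^sub>R 1" using I has_integral_unique by metis
      thus ?thesis using assms by (simp add: scaleR_conv_of_real)
    qed
    show "norm I \<le> 2 / \<bar>w\<bar>" if "w \<noteq> 0"
    proof -
      have "(osc w has_integral (osc w (2 * T) / (\<i> * w) - osc w T / (\<i> * w))) {T..2 * T}"
      proof (rule fundamental_theorem_of_calculus)
        fix t assume "t \<in> {T..2 * T}"
        have "((\<lambda>z. exp (\<i> * of_real w * z) / (\<i> * w)) has_field_derivative exp (\<i> * of_real w * of_real t)) (at (of_real t))"
          using that by (auto intro!: derivative_eq_intros)
        from has_vector_derivative_real_field[OF this]
        show "((\<lambda>t. osc w t / (\<i> * w)) has_vector_derivative osc w t) (at t within {T..2 * T})"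
          by (auto simp: osc_def mult.assoc intro: has_vector_derivative_at_within)
      qed (use assms in auto)
      hence "I = osc w (2 * T) / (\<i> * w) - osc w T / (\<i> * w)" using I has_integral_unique by blast
      also have "norm \<dots> \<le> 1 / \<bar>w\<bar> + 1 / \<bar>w\<bar>"
        by (rule order.trans[OF norm_triangle_ineq4]) (simp add: norm_divide norm_mult)
      finally show ?thesis by simp
    qed
  qed
qed

text \<open>The gap between two frequencies; it is what bounds an off-diagonal integral by twice
  max(m, n).\<close>

lemma ln_nat_separation:
  fixes m n :: nat
  assumes "m > 0" "n > 0" "m \<noteq> n"
  shows "\<bar>ln (real m) - ln (real n)\<bar> \<ge> 1 / real (max m n)"
proof -
  have *: "ln (real b) - ln (real a) \<ge> 1 / real b" if "a < b" "a > 0" for a b :: nat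
  proof -
    have "ln (real a / real b) \<le> real a / real b - 1" using that by (intro ln_le_minus_one) auto
    also have "\<dots> \<le> (real b - 1) / real b - 1"
      using that by (intro diff_right_mono divide_right_mono) auto
    also have "\<dots> = - 1 / real b" using that by (simp add: field_simps)
    finally show ?thesis using that by (simp add: ln_div)
  qed
  show ?thesis
  proof (cases "m < n")
    case True thus ?thesis using *[of m n] assms by (simp add: max_def)
  next
    case False thus ?thesis using *[of n m] assms by (simp add: max_def)
  qed
qed

text \<open>The off-diagonal oscillatory integrals are bounded both by \<open>T\<close> and by \<open>2 max(m,n)\<close>, hence by
  the geometric mean with weights \<open>1 - \<delta>\<close> and \<open>\<delta>\<close>; no truncation of the series is needed.\<close>

lemma dirichlet_polynomial_mean_value:
  fixes b :: "'a \<Rightarrow> complex" and N :: "'a \<Rightarrow> nat"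
  assumes "finite F" "inj_on N F" "\<And>x. x \<in> F \<Longrightarrow> N x > 0" "T > 0" "0 < \<delta>" "\<delta> \<le> 1"
  shows "\<bar>1 / T * integral {T..2 * T} (\<lambda>t. (cmod (\<Sum>x\<in>F. b x * osc (- ln (real (N x))) t))\<^sup>2) - (\<Sum>x\<in>F. (cmod (b x))\<^sup>2)\<bar>
    \<le> 2 * T powr - \<delta> * (\<Sum>x\<in>F. cmod (b x) * real (N x) powr \<delta>)\<^sup>2"
proof -
  define D where "D t = (\<Sum>x\<in>F. b x * osc (- ln (real (N x))) t)" for t
  define w where "w x y = ln (real (N y)) - ln (real (N x))" for x y
  have "\<exists>I. (osc u has_integral I) {T..2 * T} \<and> (u = 0 \<longrightarrow> I = of_real T) \<and> norm I \<le> T \<and> (u \<noteq> 0 \<longrightarrow> norm I \<le> 2 / \<bar>u\<bar>)" for u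
    using osc_integral_bound[OF assms(4), of u] by blast
  then obtain I where I: "\<And>u. (osc u has_integral I u) {T..2 * T}" "I 0 = of_real T"
    "\<And>u. norm (I u) \<le> T" "\<And>u. u \<noteq> 0 \<Longrightarrow> norm (I u) \<le> 2 / \<bar>u\<bar>" by metis
  have D2: "complex_of_real ((cmod (D t))\<^sup>2) = (\<Sum>x\<in>F. \<Sum>y\<in>F. b x * cnj (b y) * osc (w x y) t)" for t
  proof -
    have "complex_of_real ((cmod (D t))\<^sup>2) = D t * cnj (D t)" by (rule complex_norm_square)
    also have "\<dots> = (\<Sum>x\<in>F. \<Sum>y\<in>F. b x * osc (- ln (real (N x))) t * cnj (b y * osc (- ln (real (N y))) t))"
      unfolding D_def cnj_sum by (rule sum_product)
    also have "\<dots> = (\<Sum>x\<in>F. \<Sum>y\<in>F. b x * cnj (b y) * osc (w x y) t)"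
    proof (intro sum.cong refl)
      fix x y
      have "w x y = - ln (real (N x)) + ln (real (N y))" by (simp add: w_def)
      thus "b x * osc (- ln (real (N x))) t * cnj (b y * osc (- ln (real (N y))) t) = b x * cnj (b y) * osc (w x y) t"
        by (simp only: osc_add complex_cnj_mult cnj_osc minus_minus mult_ac)
    qed
    finally show ?thesis .
  qed
  define J where "J = (\<Sum>x\<in>F. \<Sum>y\<in>F. b x * cnj (b y) * I (w x y))"
  have "((\<lambda>t. complex_of_real ((cmod (D t))\<^sup>2)) has_integral J) {T..2 * T}"
    unfolding D2 J_def by (intro has_integral_sum assms(1) has_integral_mult_right I)
  hence "((\<lambda>t. Re (complex_of_real ((cmod (D t))\<^sup>2))) has_integral Re J) {T..2 * T}"
    by (rule has_integral_linear[OF _ bounded_linear_Re, unfolded o_def])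
  hence int: "integral {T..2 * T} (\<lambda>t. (cmod (D t))\<^sup>2) = Re J" by (simp add: integral_unique)
  have diag: "(\<Sum>x\<in>F. (cmod (b x))\<^sup>2) = (\<Sum>x\<in>F. \<Sum>y\<in>F. if x = y then (cmod (b x))\<^sup>2 else 0)"
    using assms(1) by simp
  have "norm (J / T - of_real (\<Sum>x\<in>F. (cmod (b x))\<^sup>2)) \<le>
     (\<Sum>x\<in>F. \<Sum>y\<in>F. 2 * T powr - \<delta> * ((cmod (b x) * real (N x) powr \<delta>) * (cmod (b y) * real (N y) powr \<delta>)))"
    unfolding J_def diag sum_divide_distrib of_real_sum sum_subtractf[symmetric]
  proof (intro sum_norm_le)
    fix x y assume xy: "x \<in> F" "y \<in> F"
    show "norm (b x * cnj (b y) * I (w x y) / T - complex_of_real (if x = y then (cmod (b x))\<^sup>2 else 0))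
       \<le> 2 * T powr - \<delta> * ((cmod (b x) * real (N x) powr \<delta>) * (cmod (b y) * real (N y) powr \<delta>))"
    proof (cases "x = y")
      case True
      hence "b x * cnj (b y) * I (w x y) / T - complex_of_real (if x = y then (cmod (b x))\<^sup>2 else 0) = 0"
        using I(2) \<open>T > 0\<close> complex_norm_square[of "b y"] by (simp add: w_def)
      thus ?thesis by simp
    next
      case False
      hence neq: "N x \<noteq> N y" using xy assms(2) by (auto simp: inj_on_def)
      define M where "M = real (max (N x) (N y))"
      have pos: "N x > 0" "N y > 0" using assms(3) xy by auto
      \<comment> \<open>The cruder bound max(m, n) <= m n lets the double sum factor into the square
        of a single sum.\<close>
      have M: "M \<ge> 1" "M \<le> real (N x) * real (N y)" using pos by (auto simp: M_def max_def)
      have w: "\<bar>w x y\<bar> \<ge> 1 / M"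
        using ln_nat_separation[OF pos(2,1)] neq by (simp add: w_def M_def max.commute)
      hence "w x y \<noteq> 0" using M by auto
      hence "norm (I (w x y)) \<le> 2 / \<bar>w x y\<bar>" by (rule I(4))
      also have "\<dots> \<le> 2 / (1 / M)" using w M by (intro divide_left_mono mult_pos_pos) auto
      finally have "norm (I (w x y)) / T \<le> 2 * M / T" using \<open>T > 0\<close> by (simp add: divide_right_mono)
      moreover have "norm (I (w x y)) / T \<le> 1" using I(3)[of "w x y"] \<open>T > 0\<close> by simp
      ultimately have "norm (I (w x y)) / T \<le> (2 * M / T) powr \<delta>"
      proof (cases "2 * M / T \<ge> 1")
        case True
        hence "1 \<le> (2 * M / T) powr \<delta>" using assms by (intro ge_one_powr_ge_zero) auto
        thus ?thesis using \<open>norm (I (w x y)) / T \<le> 1\<close> by linarith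
      next
        case False
        have "(2 * M / T) powr 1 \<le> (2 * M / T) powr \<delta>"
          using False M assms by (intro powr_mono') auto
        thus ?thesis using \<open>norm (I (w x y)) / T \<le> 2 * M / T\<close> M assms by simp
      qed
      also have "\<dots> = 2 powr \<delta> * M powr \<delta> * T powr - \<delta>"
        using M assms by (simp add: powr_mult powr_divide powr_minus_divide)
      also have "\<dots> \<le> 2 * (real (N x) powr \<delta> * real (N y) powr \<delta>) * T powr - \<delta>"
      proof (intro mult_right_mono mult_mono)
        have "2 powr \<delta> \<le> 2 powr (1::real)" using assms by (intro powr_mono) auto
        thus "2 powr \<delta> \<le> (2::real)" by simp
        have "M powr \<delta> \<le> (real (N x) * real (N y)) powr \<delta>" using M assms by (intro powr_mono2) auto
        thus "M powr \<delta> \<le> real (N x) powr \<delta> * real (N y) powr \<delta>" by (simp add: powr_mult)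
      qed auto
      finally have "norm (I (w x y)) / T \<le> 2 * (real (N x) powr \<delta> * real (N y) powr \<delta>) * T powr - \<delta>" .
      hence "cmod (b x) * cmod (b y) * (norm (I (w x y)) / T) \<le>
        cmod (b x) * cmod (b y) * (2 * (real (N x) powr \<delta> * real (N y) powr \<delta>) * T powr - \<delta>)"
        by (intro mult_left_mono) auto
      thus ?thesis using False \<open>T > 0\<close> by (simp add: norm_mult norm_divide mult_ac)
    qed
  qed
  also have "\<dots> = 2 * T powr - \<delta> * (\<Sum>x\<in>F. cmod (b x) * real (N x) powr \<delta>)\<^sup>2"
    unfolding power2_eq_square sum_product by (simp only: sum_distrib_left)
  finally have "norm (J / T - of_real (\<Sum>x\<in>F. (cmod (b x))\<^sup>2)) \<le> \<dots>" .
  moreover have "\<bar>Re (J / T - of_real (\<Sum>x\<in>F. (cmod (b x))\<^sup>2))\<bar> \<le> norm (J / T - of_real (\<Sum>x\<in>F. (cmod (b x))\<^sup>2))"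
    by (rule abs_Re_le_cmod)
  ultimately show ?thesis unfolding D_def[symmetric] int using \<open>T > 0\<close> by simp
qed

text \<open>The bound for finite sums does not depend on the finite set. Absolute convergence gives
  uniform convergence in t, so the integrals converge and the bound passes to the limit.\<close>

lemma dirichlet_series_mean_value:
  fixes b :: "'a \<Rightarrow> complex" and N :: "'a \<Rightarrow> nat"
  assumes "inj_on N G" "\<And>x. x \<in> G \<Longrightarrow> N x > 0" "T > 0" "0 < \<delta>" "\<delta> \<le> 1"
    and V: "((\<lambda>x. cmod (b x) * real (N x) powr \<delta>) has_sum V) G"
    and P: "\<And>t. ((\<lambda>x. b x * osc (- ln (real (N x))) t) has_sum P t) G"
    and S: "((\<lambda>x. (cmod (b x))\<^sup>2) has_sum S) G"
  shows "\<bar>1 / T * integral {T..2 * T} (\<lambda>t. (cmod (P t))\<^sup>2) - S\<bar> \<le> 2 * T powr - \<delta> * V\<^sup>2"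
proof -
  define D where "D F t = (\<Sum>x\<in>F. b x * osc (- ln (real (N x))) t)" for F t
  have b_le: "cmod (b x) \<le> cmod (b x) * real (N x) powr \<delta>" if "x \<in> G" for x
  proof -
    have "1 \<le> real (N x) powr \<delta>" using assms(2)[OF that] \<open>0 < \<delta>\<close> by (intro ge_one_powr_ge_zero) auto
    thus ?thesis using mult_left_mono[of 1 "real (N x) powr \<delta>" "cmod (b x)"] by simp
  qed
  have b_sm: "(\<lambda>x. cmod (b x)) summable_on G"
    by (rule summable_on_comparison_test[of "\<lambda>x. cmod (b x) * real (N x) powr \<delta>"])
      (use V b_le in \<open>auto simp: summable_on_def\<close>)
  define W where "W = infsum (\<lambda>x. cmod (b x)) G"
  have W: "((\<lambda>x. cmod (b x)) has_sum W) G" using b_sm by (simp add: W_def)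
  have D_le: "norm (D F t) \<le> W" if "finite F" "F \<subseteq> G" for F t
  proof -
    have "norm (D F t) \<le> (\<Sum>x\<in>F. cmod (b x))" unfolding D_def by (rule sum_norm_le) (simp add: norm_mult)
    also have "\<dots> \<le> W" by (rule finite_sum_le_has_sum[OF W]) (use that in auto)
    finally show ?thesis .
  qed
  have P_le: "norm (P t) \<le> W" for t
    by (rule norm_infsum_le[OF P W]) (simp add: norm_mult)
  have W0: "W \<ge> 0" using order.trans[OF norm_ge_zero P_le] .
  have unif: "uniform_limit {T..2 * T} D P (finite_subsets_at_top G)"
    unfolding D_def[abs_def]
    by (rule Weierstrass_m_test_general'[where M = "\<lambda>x. cmod (b x)"]) (use P b_sm in \<open>auto simp: norm_mult\<close>)
  have ev_sub: "eventually (\<lambda>F. finite F \<and> F \<subseteq> G) (finite_subsets_at_top G)"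
    by (simp add: eventually_finite_subsets_at_top_weakI)
  have unif2: "uniform_limit {T..2 * T} (\<lambda>F t. (cmod (D F t))\<^sup>2) (\<lambda>t. (cmod (P t))\<^sup>2) (finite_subsets_at_top G)"
  proof (rule uniform_limitI)
    fix e :: real assume "e > 0"
    \<comment> \<open>The summand 1 guards against W = 0.\<close>
    have "eventually (\<lambda>F. \<forall>t\<in>{T..2*T}. dist (D F t) (P t) < e / (2 * W + 1)) (finite_subsets_at_top G)"
      using \<open>e > 0\<close> W0 by (intro uniform_limitD[OF unif]) auto
    with ev_sub show "eventually (\<lambda>F. \<forall>t\<in>{T..2*T}. dist ((cmod (D F t))\<^sup>2) ((cmod (P t))\<^sup>2) < e) (finite_subsets_at_top G)"
    proof eventually_elim
      case (elim F)
      show ?case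
      proof
        fix t assume t: "t \<in> {T..2*T}"
        have "dist ((cmod (D F t))\<^sup>2) ((cmod (P t))\<^sup>2) = \<bar>cmod (D F t) - cmod (P t)\<bar> * (cmod (D F t) + cmod (P t))"
          by (simp add: dist_real_def power2_eq_square square_diff_square_factored abs_mult)
        also have "\<dots> \<le> dist (D F t) (P t) * (W + W)"
          using D_le[of F t] P_le[of t] elim
          by (intro mult_mono add_mono) (auto simp: dist_norm norm_triangle_ineq3)
        also have "\<dots> \<le> dist (D F t) (P t) * (2 * W + 1)" by (intro mult_left_mono) auto
        also have "\<dots> < e"
          using bspec[OF elim(2) t] W0 by (simp add: pos_less_divide_eq)
        finally show "dist ((cmod (D F t))\<^sup>2) ((cmod (P t))\<^sup>2) < e" .
      qed
    qed
  qed
  obtain I J where IJ: "\<And>F. ((\<lambda>t. (cmod (D F t))\<^sup>2) has_integral I F) {T..2*T}"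
    "((\<lambda>t. (cmod (P t))\<^sup>2) has_integral J) {T..2*T}" "(I \<longlongrightarrow> J) (finite_subsets_at_top G)"
    by (rule uniform_limit_integral[OF unif2]) (auto simp: D_def intro!: continuous_intros)
  have "((\<lambda>F. \<bar>1 / T * I F - (\<Sum>x\<in>F. (cmod (b x))\<^sup>2)\<bar>) \<longlongrightarrow> \<bar>1 / T * J - S\<bar>) (finite_subsets_at_top G)"
    using S unfolding has_sum_def by (intro tendsto_intros IJ)
  moreover have "eventually (\<lambda>F. \<bar>1 / T * I F - (\<Sum>x\<in>F. (cmod (b x))\<^sup>2)\<bar> \<le> 2 * T powr - \<delta> * V\<^sup>2) (finite_subsets_at_top G)"
    using ev_sub
  proof eventually_elim
    case (elim F)
    have "I F = integral {T..2*T} (\<lambda>t. (cmod (D F t))\<^sup>2)" by (rule integral_unique[OF IJ(1), symmetric])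
    hence "\<bar>1 / T * I F - (\<Sum>x\<in>F. (cmod (b x))\<^sup>2)\<bar> \<le> 2 * T powr - \<delta> * (\<Sum>x\<in>F. cmod (b x) * real (N x) powr \<delta>)\<^sup>2"
      using dirichlet_polynomial_mean_value[of F N T \<delta> b] elim assms(1-5)
      unfolding D_def by (auto intro: inj_on_subset)
    also have "\<dots> \<le> 2 * T powr - \<delta> * V\<^sup>2"
      using elim by (intro mult_left_mono power_mono finite_sum_le_has_sum[OF V]) (auto intro: sum_nonneg)
    finally show ?case .
  qed
  ultimately have "\<bar>1 / T * J - S\<bar> \<le> 2 * T powr - \<delta> * V\<^sup>2"
    by (rule tendsto_upperbound) simp
  thus ?thesis using IJ(2) by (simp add: integral_unique)
qed

subsection \<open>The truncated Euler product\<close>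

definition real_primes_upto :: "real \<Rightarrow> nat set" where
  "real_primes_upto X = {p. prime p \<and> real p \<le> X}"

lemma finite_real_primes_upto [simp]: "finite (real_primes_upto X)"
proof (rule finite_subset)
  show "real_primes_upto X \<subseteq> {..nat \<lfloor>X\<rfloor>}" by (auto simp: real_primes_upto_def le_nat_floor)
qed simp

text \<open>The Euler factor of \<open>P_X(s,\<chi>)\<close> at \<open>p \<le> X\<close> is \<open>exp (\<Sum> t_j z^j / j)\<close> with \<open>z = p^{-s}\<close> and \<open>t_j\<close> as
  below: a factor \<open>1 - \<chi>*(p) z\<close> with \<open>p | q\<close> contributes \<open>- \<chi>*(p)^j\<close> for every \<open>j\<close>, so that only the
  \<open>j\<close> with \<open>p^j > X\<close> survive.\<close>

definition trunc_coeff :: "real \<Rightarrow> nat \<Rightarrow> (nat \<Rightarrow> complex) \<Rightarrow> nat \<Rightarrow> nat \<Rightarrow> complex" where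
  "trunc_coeff X q chi p j =
     inducing_primitive q chi p ^ j * (of_bool (real (p ^ j) \<le> X) - of_bool (p dvd q))"

lemma norm_trunc_coeff_le:
  assumes "q > 0" "dcharacter q chi"
  shows "norm (trunc_coeff X q chi p j) \<le> 1"
proof -
  have "norm (inducing_primitive q chi p ^ j) \<le> 1"
    using norm_inducing_primitive_le[OF assms] by (simp add: norm_power power_le_one)
  moreover have "norm (of_bool (real (p ^ j) \<le> X) - of_bool (p dvd q) :: complex) \<le> 1"
    by (simp add: of_bool_def)
  ultimately show ?thesis unfolding trunc_coeff_def norm_mult by (intro mult_le_one) auto
qed

lemma log_series_diff:
  assumes "\<And>j. norm (a j) \<le> 1" "\<And>j. norm (b j) \<le> 1" "norm z < 1"
  shows "log_series (\<lambda>j. a j - b j) z = log_series a z - log_series b z"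
proof -
  have "(\<lambda>j. a j / of_nat j * z ^ j - b j / of_nat j * z ^ j) sums (log_series a z - log_series b z)"
    by (intro sums_diff log_series_sums_bound(2)[where k = 1]) (use assms in auto)
  thus ?thesis by (simp add: log_series_def sums_iff left_diff_distrib diff_divide_distrib)
qed

lemma finite_exponents_le:
  assumes "p > 1"
  shows "finite {j. j \<ge> 1 \<and> real (p ^ j) \<le> X}"
proof (rule finite_subset)
  show "{j. j \<ge> 1 \<and> real (p ^ j) \<le> X} \<subseteq> {..nat \<lfloor>X\<rfloor>}"
  proof
    fix j assume "j \<in> {j. j \<ge> 1 \<and> real (p ^ j) \<le> X}"
    hence "real (p ^ j) \<le> X" by blast
    moreover have "real j < real (p ^ j)" using assms power_gt_expt[of p j] by simp
    ultimately have "real j \<le> X" by linarith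
    thus "j \<in> {..nat \<lfloor>X\<rfloor>}" by (simp add: le_nat_floor)
  qed
qed simp

lemma sum_prime_powers_upto:
  fixes f :: "nat \<Rightarrow> complex"
  shows "(\<Sum>n | n > 0 \<and> real n \<le> X. mangoldt n * f n) =
    (\<Sum>p\<in>real_primes_upto X. \<Sum>j | j \<ge> 1 \<and> real (p ^ j) \<le> X. of_real (ln (real p)) * f (p ^ j))"
proof -
  let ?B = "SIGMA p:real_primes_upto X. {j. j \<ge> 1 \<and> real (p ^ j) \<le> X}"
  have fin: "finite {n. n > 0 \<and> real n \<le> X}"
    by (rule finite_subset[of _ "{..nat \<lfloor>X\<rfloor>}"]) (auto simp: le_nat_floor)
  have finj: "finite {j. j \<ge> 1 \<and> real (p ^ j) \<le> X}" if "p \<in> real_primes_upto X" for p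
    using that prime_gt_1_nat by (intro finite_exponents_le) (auto simp: real_primes_upto_def)
  have "(\<Sum>n | n > 0 \<and> real n \<le> X. mangoldt n * f n) =
    (\<Sum>n | primepow n \<and> real n \<le> X. mangoldt n * f n)"
    by (rule sum.mono_neutral_right[OF fin]) (auto simp: mangoldt_def intro: primepow_gt_0_nat)
  also have "\<dots> = (\<Sum>(p, j)\<in>?B. of_real (ln (real p)) * f (p ^ j))"
  proof (rule sum.reindex_bij_betw[symmetric, THEN trans])
    show "bij_betw (\<lambda>(p, j). p ^ j) ?B {n. primepow n \<and> real n \<le> X}"
      unfolding bij_betw_def
    proof
      show "inj_on (\<lambda>(p, j). p ^ j) ?B"
      proof (rule inj_onI)
        fix x y assume xy: "x \<in> ?B" "y \<in> ?B" "(case x of (p, j) \<Rightarrow> p ^ j) = (case y of (p, j) \<Rightarrow> p ^ j)"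
        obtain p j p' j' where eq: "x = (p, j)" "y = (p', j')" by (cases x, cases y)
        have p: "prime p" "prime p'" "j > 0" "j' > 0" "p ^ j = p' ^ j'"
          using xy by (auto simp: eq real_primes_upto_def)
        have "p dvd p' ^ j'" using p by (metis dvd_power)
        hence "p = p'" using p by (meson prime_dvd_power primes_dvd_imp_eq)
        moreover have "j = j'" using p prime_gt_1_nat[OF p(1)] \<open>p = p'\<close> by (simp add: power_inject_exp)
        ultimately show "x = y" by (simp add: eq)
      qed
      show "(\<lambda>(p, j). p ^ j) ` ?B = {n. primepow n \<and> real n \<le> X}"
      proof safe
        fix p j assume pj: "p \<in> real_primes_upto X" "j \<ge> 1" "real (p ^ j) \<le> X"
        thus "primepow (p ^ j)" by (auto simp: real_primes_upto_def)
      next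
        fix n :: nat assume n: "primepow n" "real n \<le> X"
        then obtain p j where pj: "prime p" "j > 0" "n = p ^ j" unfolding primepow_def by auto
        have "p ^ 1 \<le> p ^ j" using pj prime_gt_0_nat[OF pj(1)] by (intro power_increasing) auto
        hence "real p \<le> X" using n pj by (simp add: order.trans[OF of_nat_mono])
        hence "(p, j) \<in> ?B" using pj n by (auto simp: real_primes_upto_def)
        thus "n \<in> (\<lambda>(p, j). p ^ j) ` ?B" using pj by force
      qed
    qed
  next
    show "(\<Sum>x\<in>?B. mangoldt (case x of (p, j) \<Rightarrow> p ^ j) * f (case x of (p, j) \<Rightarrow> p ^ j)) =
      (\<Sum>(p, j)\<in>?B. of_real (ln (real p)) * f (p ^ j))"
      by (intro sum.cong refl) (auto simp: real_primes_upto_def)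
  qed
  also have "\<dots> = (\<Sum>p\<in>real_primes_upto X. \<Sum>j | j \<ge> 1 \<and> real (p ^ j) \<le> X. of_real (ln (real p)) * f (p ^ j))"
    using finj by (subst sum.Sigma) auto
  finally show ?thesis .
qed

lemma norm_nat_powr_neg_less_1:
  assumes "n \<ge> 2" "Re s > 0"
  shows "norm (of_nat n powr (- s) :: complex) < 1"
proof -
  have "real n powr - Re s < real n powr 0" using assms by (intro powr_less_mono) auto
  thus ?thesis using assms by (simp add: norm_powr_real_powr)
qed

text \<open>From q < X every prime dividing q is at most X, so its factor 1 - chi'(p) p^(-s), with
  chi' the primitive character, can be merged into the Euler factor at p.\<close>

lemma P_X_eq_prod:
  assumes "q > 0" "real q < X" "dcharacter q chi" "Re s > 0"
  shows "P_X X q s chi = (\<Prod>p\<in>real_primes_upto X. exp (log_series (trunc_coeff X q chi p) (of_nat p powr (- s))))"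
proof -
  define u where "u = inducing_primitive q chi"
  define z :: "nat \<Rightarrow> complex" where "z p = of_nat p powr (- s)" for p
  have u_le: "norm (u p) \<le> 1" for p unfolding u_def by (rule norm_inducing_primitive_le[OF assms(1,3)])
  have u_pow: "u (p ^ j) = u p ^ j" for p j
    by (induction j) (simp_all add: u_def inducing_primitive_mult[OF assms(1,3)] inducing_primitive_1[OF assms(1,3)])
  have z_lt: "norm (z p) < 1" if "p \<in> real_primes_upto X" for p
    unfolding z_def using that assms(4) prime_ge_2_nat by (intro norm_nat_powr_neg_less_1) (auto simp: real_primes_upto_def)
  have pf: "prime_factors q \<subseteq> real_primes_upto X"
  proof
    fix p assume p: "p \<in> prime_factors q"
    hence "p \<le> q" using assms(1) by (auto intro: dvd_imp_le simp: prime_factors_dvd)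
    thus "p \<in> real_primes_upto X" using p assms(2) by (auto simp: real_primes_upto_def prime_factors_dvd)
  qed
  have local1: "(\<Sum>j | j \<ge> 1 \<and> real (p ^ j) \<le> X. of_real (ln (real p)) * (u (p ^ j) / (of_nat (p ^ j) powr s * of_real (ln (real (p ^ j)))))) =
    log_series (\<lambda>j. u p ^ j * of_bool (real (p ^ j) \<le> X)) (z p)" if "p \<in> real_primes_upto X" for p
  proof -
    have p: "prime p" "p > 1" using that prime_gt_1_nat by (auto simp: real_primes_upto_def)
    have lnp: "ln (real p) \<noteq> 0" using p by simp
    define J where "J = {j. j \<ge> 1 \<and> real (p ^ j) \<le> X}"
    have "finite J" unfolding J_def by (rule finite_exponents_le[OF p(2)])
    have zs: "z p ^ j = 1 / of_nat (p ^ j) powr s" for j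
    proof (induction j)
      case (Suc j)
      have "of_nat (p ^ Suc j) powr s = of_nat p powr s * of_nat (p ^ j) powr s"
        using of_nat_mult_powr[of p "p ^ j" s] by simp
      thus ?case using Suc by (simp add: z_def powr_minus divide_inverse)
    qed simp
    have "(\<lambda>j. u p ^ j * of_bool (real (p ^ j) \<le> X) / of_nat j * z p ^ j) sums
       (\<Sum>j\<in>J. u p ^ j * of_bool (real (p ^ j) \<le> X) / of_nat j * z p ^ j)"
      by (rule sums_finite[OF \<open>finite J\<close>]) (auto simp: J_def not_le)
    hence "log_series (\<lambda>j. u p ^ j * of_bool (real (p ^ j) \<le> X)) (z p) = (\<Sum>j\<in>J. u p ^ j * of_bool (real (p ^ j) \<le> X) / of_nat j * z p ^ j)"
      by (simp add: log_series_def sums_iff)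
    also have "\<dots> = (\<Sum>j\<in>J. of_real (ln (real p)) * (u (p ^ j) / (of_nat (p ^ j) powr s * of_real (ln (real (p ^ j))))))"
    proof (intro sum.cong refl)
      fix j assume j: "j \<in> J"
      have "ln (real (p ^ j)) = real j * ln (real p)" using p by (simp add: ln_realpow)
      thus "u p ^ j * of_bool (real (p ^ j) \<le> X) / of_nat j * z p ^ j =
        of_real (ln (real p)) * (u (p ^ j) / (of_nat (p ^ j) powr s * of_real (ln (real (p ^ j)))))"
        using j lnp by (simp add: J_def u_pow zs del: of_nat_power)
    qed
    finally show ?thesis by (simp add: J_def)
  qed
  have "P_X X q s chi = (\<Prod>p\<in>prime_factors q. 1 - u p * z p) *
      exp (\<Sum>n | n > 0 \<and> real n \<le> X. mangoldt n * (u n / (of_nat n powr s * of_real (ln (real n)))))"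
    unfolding P_X_def Let_def u_def z_def by (simp add: mult_ac)
  also have "(\<Sum>n | n > 0 \<and> real n \<le> X. mangoldt n * (u n / (of_nat n powr s * of_real (ln (real n))))) =
    (\<Sum>p\<in>real_primes_upto X. log_series (\<lambda>j. u p ^ j * of_bool (real (p ^ j) \<le> X)) (z p))"
    unfolding sum_prime_powers_upto by (intro sum.cong refl local1)
  also have "(\<Prod>p\<in>prime_factors q. 1 - u p * z p) = (\<Prod>p\<in>real_primes_upto X. if p dvd q then 1 - u p * z p else 1)"
    by (rule prod.mono_neutral_cong_left[OF finite_real_primes_upto pf])
      (use assms(1) in \<open>auto simp: real_primes_upto_def prime_factors_dvd\<close>)
  also have "\<dots> * exp (\<Sum>p\<in>real_primes_upto X. log_series (\<lambda>j. u p ^ j * of_bool (real (p ^ j) \<le> X)) (z p)) =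
    (\<Prod>p\<in>real_primes_upto X. (if p dvd q then 1 - u p * z p else 1) * exp (log_series (\<lambda>j. u p ^ j * of_bool (real (p ^ j) \<le> X)) (z p)))"
    by (simp add: exp_sum prod.distrib)
  also have "\<dots> = (\<Prod>p\<in>real_primes_upto X. exp (log_series (trunc_coeff X q chi p) (z p)))"
  proof (intro prod.cong refl)
    fix p assume p: "p \<in> real_primes_upto X"
    show "(if p dvd q then 1 - u p * z p else 1) * exp (log_series (\<lambda>j. u p ^ j * of_bool (real (p ^ j) \<le> X)) (z p)) =
      exp (log_series (trunc_coeff X q chi p) (z p))"
    proof (cases "p dvd q")
      case True
      have "trunc_coeff X q chi p = (\<lambda>j. u p ^ j * of_bool (real (p ^ j) \<le> X) - u p ^ j)"
        using True by (simp add: trunc_coeff_def u_def fun_eq_iff right_diff_distrib)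
      hence "log_series (trunc_coeff X q chi p) (z p) =
        log_series (\<lambda>j. u p ^ j * of_bool (real (p ^ j) \<le> X)) (z p) - log_series (\<lambda>j. u p ^ j) (z p)"
        using u_le z_lt[OF p]
        by (simp only:) (subst log_series_diff, auto simp: norm_mult norm_power power_le_one of_bool_def)
      moreover have "exp (- log_series (\<lambda>j. u p ^ j) (z p)) = 1 - u p * z p"
        using log_series_powers(2)[OF u_le z_lt[OF p]] by (simp add: exp_minus)
      ultimately show ?thesis using True by (simp add: exp_diff exp_minus divide_inverse mult.commute)
    next
      case False
      thus ?thesis by (simp add: trunc_coeff_def[abs_def] u_def)
    qed
  qed
  finally show ?thesis by (simp add: z_def)
qed

definition local_exponent :: "real \<Rightarrow> nat \<Rightarrow> ((nat \<Rightarrow> complex) \<Rightarrow> nat) \<Rightarrow> nat \<Rightarrow> nat \<Rightarrow> complex" where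
  "local_exponent X q l p j = (\<Sum>chi\<in>dcharacters q. of_nat (l chi) * trunc_coeff X q chi p j)"

lemma norm_weighted_sum_le:
  assumes "\<And>chi. chi \<in> dcharacters q \<Longrightarrow> norm (c chi) \<le> 1"
  shows "norm (\<Sum>chi\<in>dcharacters q. of_nat (l chi) * (c chi :: complex)) \<le> real (tuple_size q l)"
  unfolding tuple_size_def of_nat_sum
  by (rule sum_norm_le) (use assms in \<open>auto simp: norm_mult intro!: mult_left_le\<close>)

lemma norm_local_exponent_le:
  assumes "q > 0"
  shows "norm (local_exponent X q l p j) \<le> real (tuple_size q l)"
  unfolding local_exponent_def
  by (rule norm_weighted_sum_le) (use assms in \<open>auto simp: dcharacters_def intro: norm_trunc_coeff_le\<close>)

lemma P_prod_eq_prod: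
  assumes "q > 0" "real q < X" "Re s > 0"
  shows "P_prod X q l s = (\<Prod>p\<in>real_primes_upto X. exp (log_series (local_exponent X q l p) (of_nat p powr (- s))))"
proof -
  have "P_prod X q l s = (\<Prod>chi\<in>dcharacters q. \<Prod>p\<in>real_primes_upto X. exp (log_series (trunc_coeff X q chi p) (of_nat p powr (- s))) ^ l chi)"
    unfolding P_prod_def by (intro prod.cong refl) (simp add: P_X_eq_prod assms dcharacters_def prod_power_distrib)
  also have "\<dots> = (\<Prod>p\<in>real_primes_upto X. \<Prod>chi\<in>dcharacters q. exp (log_series (trunc_coeff X q chi p) (of_nat p powr (- s))) ^ l chi)"
    by (rule prod.swap)
  also have "\<dots> = (\<Prod>p\<in>real_primes_upto X. exp (log_series (local_exponent X q l p) (of_nat p powr (- s))))"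
  proof (intro prod.cong refl)
    fix p assume p: "p \<in> real_primes_upto X"
    have z: "norm (of_nat p powr (- s) :: complex) < 1"
      using p assms(3) prime_ge_2_nat by (intro norm_nat_powr_neg_less_1) (auto simp: real_primes_upto_def)
    have "log_series (local_exponent X q l p) (of_nat p powr (- s)) =
      (\<Sum>chi\<in>dcharacters q. of_nat (l chi) * log_series (trunc_coeff X q chi p) (of_nat p powr (- s)))"
      unfolding local_exponent_def
      by (rule log_series_linear) (use assms z in \<open>auto simp: dcharacters_def intro: norm_trunc_coeff_le finite_dcharacters[unfolded dcharacters_def]\<close>)
    thus "(\<Prod>chi\<in>dcharacters q. exp (log_series (trunc_coeff X q chi p) (of_nat p powr (- s))) ^ l chi) =
      exp (log_series (local_exponent X q l p) (of_nat p powr (- s)))"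
      using finite_dcharacters[OF assms(1)] by (simp add: exp_sum exp_of_nat_mult)
  qed
  finally show ?thesis .
qed

text \<open>For p | q the two indicators in \<open>trunc_coeff\<close> cancel while p^j <= X,
  matching chi(p)^j = 0; here j >= 1 matters, because 0^0 = 1. For other p the primitive character
  agrees with chi at p.\<close>

lemma local_exponent_eq:
  assumes "q > 0" "prime p" "j \<ge> 1" "real (p ^ j) \<le> X"
  shows "local_exponent X q l p j = (\<Sum>chi\<in>dcharacters q. of_nat (l chi) * chi p ^ j)"
  unfolding local_exponent_def
proof (intro sum.cong refl)
  fix chi assume "chi \<in> dcharacters q"
  hence chi: "dcharacter q chi" by (simp add: dcharacters_def)
  have "trunc_coeff X q chi p j = chi p ^ j"
  proof (cases "p dvd q")
    case True
    have "\<not> coprime p q" using True assms(2) by (meson coprime_common_divisor dvd_refl not_prime_unit)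
    hence "chi p = 0" using dcharacter_eq_0_iff[OF chi] by blast
    thus ?thesis using True assms by (simp add: trunc_coeff_def)
  next
    case False
    hence "coprime p q" using assms(2) by (simp add: prime_imp_coprime_nat)
    hence "inducing_primitive q chi p = chi p" by (rule inducing_primitive_coprime[OF assms(1) chi])
    thus ?thesis using False assms by (simp add: trunc_coeff_def)
  qed
  thus "of_nat (l chi) * trunc_coeff X q chi p j = of_nat (l chi) * chi p ^ j" by simp
qed

lemma exp_coeff_local_exponent:
  assumes "q > 0" "prime p" "real (p ^ m) \<le> X"
  shows "exp_coeff (local_exponent X q l p) m = d_coeff q l (p ^ m)"
  unfolding d_coeff_prime_power[OF assms(1,2)]
proof (intro exp_coeff_cong local_exponent_eq assms(1,2))
  fix j assume "1 \<le> j" "j \<le> m"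
  hence "p ^ j \<le> p ^ m" using prime_gt_0_nat[OF assms(2)] by (intro power_increasing) auto
  hence "real (p ^ j) \<le> real (p ^ m)" by (rule of_nat_mono)
  thus "real (p ^ j) \<le> X" using assms(3) by linarith
qed

section \<open>Majorants uniform in the tuple\<close>

definition coeff_const :: "nat \<Rightarrow> real" where
  "coeff_const k = exp (- real k * ln (1 - 2 powr (- 1 / 8)))"

lemma coeff_const_pos: "coeff_const k > 0"
  by (simp add: coeff_const_def)

lemma two_powr_neg_eighth: "0 < (2::real) powr (- 1 / 8)" "(2::real) powr (- 1 / 8) < 1"
proof -
  have "(2::real) powr (- 1 / 8) < 2 powr 0" by (intro powr_less_mono) auto
  thus "(2::real) powr (- 1 / 8) < 1" by simp
qed simp

text \<open>Cauchy's bound at radius 2^(-1/8). For p = 2 and sigma = 1/4 the terms then decay with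
  ratio 2^(1/8 - 1/4) = 2^(-1/8), still less than 1.\<close>

lemma norm_exp_coeff_le_powr:
  assumes "\<And>j. norm (e j) \<le> real k"
  shows "norm (exp_coeff e m) \<le> coeff_const k * 2 powr (real m / 8)"
proof -
  have "norm (exp_coeff e m) \<le> exp (- real k * ln (1 - 2 powr (- 1 / 8))) / (2 powr (- 1 / 8)) ^ m"
    by (rule norm_exp_coeff_le[OF assms two_powr_neg_eighth])
  also have "((2::real) powr (- 1 / 8)) ^ m = 2 powr (- (real m / 8))"
    by (subst powr_realpow[symmetric]) (simp_all add: powr_powr)
  finally show ?thesis unfolding coeff_const_def powr_minus divide_inverse inverse_inverse_eq .
qed

text \<open>From the geometric tail C y / (1 - y) with y = 2^(1/8) p^(-sigma) <= 2^(-1/8), where C =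
  \<open>coeff_const k\<close>.\<close>

definition majorant_const :: "nat \<Rightarrow> real" where
  "majorant_const k = coeff_const k * 2 powr (1 / 8) / (1 - 2 powr (- 1 / 8))"

lemma majorant_const_pos: "majorant_const k > 0"
  unfolding majorant_const_def using two_powr_neg_eighth coeff_const_pos[of k] by auto

text \<open>The terms with m >= 1 add up to at most \<open>majorant_const k\<close> p^(-sigma), and
  1 + u <= e^u turns the product over p into the exponential of a sum over primes. The range sigma
  >= 1/4 covers sigma = 1/2 - delta with delta <= 1/4.\<close>

lemma local_abs_series:
  assumes e: "\<And>j. norm (e j) \<le> real k" and "p \<ge> 2" "\<sigma> \<ge> 1 / 4"
  shows "(\<lambda>m. norm (exp_coeff e m) * (real p powr - \<sigma>) ^ m) summable_on UNIV"
    and "(\<Sum>\<^sub>\<infinity>m. norm (exp_coeff e m) * (real p powr - \<sigma>) ^ m) \<le> exp (majorant_const k * real p powr - \<sigma>)"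
proof -
  define x where "x = real p powr - \<sigma>"
  define y where "y = 2 powr (1 / 8) * x"
  have x: "x > 0" using assms by (simp add: x_def)
  have "x \<le> 2 powr - \<sigma>" unfolding x_def using assms by (intro powr_mono2') auto
  also have "\<dots> \<le> 2 powr (- 1 / 4)" using assms by (intro powr_mono) auto
  finally have "y \<le> 2 powr (1 / 8) * 2 powr (- 1 / 4)" unfolding y_def by (intro mult_left_mono) auto
  also have "\<dots> = 2 powr (- 1 / 8)" by (simp add: powr_add[symmetric])
  finally have y: "0 < y" "y \<le> 2 powr (- 1 / 8)" using x by (auto simp: y_def)
  hence y1: "y < 1" using two_powr_neg_eighth by linarith
  define f where "f m = norm (exp_coeff e m) * x ^ m" for m
  have f_le: "f m \<le> coeff_const k * y ^ m" for m
  proof -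
    have "f m \<le> (coeff_const k * 2 powr (real m / 8)) * x ^ m"
      unfolding f_def using x by (intro mult_right_mono norm_exp_coeff_le_powr e) auto
    also have "2 powr (real m / 8) = ((2::real) powr (1 / 8)) ^ m"
      by (simp add: powr_realpow[symmetric] powr_powr)
    finally show ?thesis by (simp add: y_def power_mult_distrib mult_ac)
  qed
  have f0: "f m \<ge> 0" for m using x by (simp add: f_def)
  have geo: "summable (\<lambda>m. y ^ m)" using y y1 by (intro summable_geometric) auto
  have sm: "summable f"
    by (rule summable_comparison_test[OF _ summable_mult[OF geo, of "coeff_const k"]]) (use f_le f0 in auto)
  show 1: "(\<lambda>m. norm (exp_coeff e m) * (real p powr - \<sigma>) ^ m) summable_on UNIV"
    unfolding x_def[symmetric] f_def[symmetric] using sm f0 by (intro norm_summable_imp_summable_on) auto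
  have "(\<Sum>\<^sub>\<infinity>m. f m) = suminf f"
    using norm_summable_imp_has_sum[of f "suminf f"] sm f0 by (simp add: infsumI summable_sums)
  also have "\<dots> = (\<Sum>m. f (Suc m)) + 1"
    using suminf_split_head[OF sm] by (simp add: f_def)
  also have "(\<Sum>m. f (Suc m)) \<le> (\<Sum>m. coeff_const k * y * y ^ m)"
    using sm geo f_le[of "Suc _"] by (intro suminf_le) (auto simp: summable_Suc_iff mult.assoc)
  also have "\<dots> = coeff_const k * y * (1 / (1 - y))"
    using y y1 by (simp add: suminf_mult suminf_geometric summable_geometric)
  also have "\<dots> \<le> coeff_const k * y * (1 / (1 - 2 powr (- 1 / 8)))"
    using y y1 two_powr_neg_eighth coeff_const_pos[of k]
    by (intro mult_left_mono divide_left_mono) auto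
  also have "\<dots> = majorant_const k * x" by (simp add: majorant_const_def y_def)
  also have "majorant_const k * x + 1 \<le> exp (majorant_const k * x)"
    using exp_ge_add_one_self[of "majorant_const k * x"] by linarith
  finally show "(\<Sum>\<^sub>\<infinity>m. norm (exp_coeff e m) * (real p powr - \<sigma>) ^ m) \<le> exp (majorant_const k * real p powr - \<sigma>)"
    by (simp add: f_def x_def)
qed

definition local_square_sum :: "(nat \<Rightarrow> complex) \<Rightarrow> nat \<Rightarrow> real" where
  "local_square_sum a p = (\<Sum>m. (cmod (a m))\<^sup>2 / real p ^ m)"

lemma local_square_series:
  assumes a: "\<And>m. norm (a m) \<le> C * 2 powr (real m / 8)" and "p \<ge> 2"
  shows "summable (\<lambda>m. (cmod (a m))\<^sup>2 / real p ^ m)"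
    and "(\<lambda>m. (cmod (a m))\<^sup>2 * (1 / real p) ^ m) summable_on UNIV"
    and "(\<Sum>\<^sub>\<infinity>m. (cmod (a m))\<^sup>2 * (1 / real p) ^ m) = local_square_sum a p"
proof -
  let ?y = "2 powr (1 / 4) / 2 :: real"
  have y: "0 < ?y" "?y < 1"
  proof -
    have "(2::real) powr (1 / 4) < 2 powr 1" by (intro powr_less_mono) auto
    thus "?y < 1" by simp
  qed simp
  show sm: "summable (\<lambda>m. (cmod (a m))\<^sup>2 / real p ^ m)"
  proof (rule summable_comparison_test)
    show "summable (\<lambda>m. C\<^sup>2 * ?y ^ m)" using y by (intro summable_mult summable_geometric) auto
    show "\<exists>N. \<forall>m\<ge>N. norm ((cmod (a m))\<^sup>2 / real p ^ m) \<le> C\<^sup>2 * ?y ^ m"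
    proof (intro exI allI impI)
      fix m
      have "(cmod (a m))\<^sup>2 \<le> (C * 2 powr (real m / 8))\<^sup>2" by (intro power_mono a) auto
      also have "\<dots> = C\<^sup>2 * (2 powr (1 / 4)) ^ m"
        by (simp add: power_mult_distrib powr_realpow[symmetric] powr_powr powr_power)
      finally have "(cmod (a m))\<^sup>2 / real p ^ m \<le> C\<^sup>2 * (2 powr (1 / 4)) ^ m / 2 ^ m"
        using assms(2) by (intro frac_le power_mono) auto
      thus "norm ((cmod (a m))\<^sup>2 / real p ^ m) \<le> C\<^sup>2 * ?y ^ m" by (simp add: power_divide)
    qed
  qed
  have eq: "(\<lambda>m. (cmod (a m))\<^sup>2 * (1 / real p) ^ m) = (\<lambda>m. (cmod (a m))\<^sup>2 / real p ^ m)"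
    by (simp add: power_one_over divide_inverse power_inverse)
  show "(\<lambda>m. (cmod (a m))\<^sup>2 * (1 / real p) ^ m) summable_on UNIV"
    unfolding eq using sm by (intro norm_summable_imp_summable_on) auto
  show "(\<Sum>\<^sub>\<infinity>m. (cmod (a m))\<^sup>2 * (1 / real p) ^ m) = local_square_sum a p"
    unfolding eq local_square_sum_def
    by (intro infsumI norm_summable_imp_has_sum summable_sums sm) (use sm in auto)
qed

lemma real_prod_PiE_has_sum:
  fixes f :: "'a \<Rightarrow> 'b \<Rightarrow> real"
  assumes "finite S" "\<And>x. x \<in> S \<Longrightarrow> f x summable_on B x" "\<And>x y. f x y \<ge> 0"
  shows "((\<lambda>g. \<Prod>x\<in>S. f x (g x)) has_sum (\<Prod>x\<in>S. infsum (f x) (B x))) (PiE S B)"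
proof -
  have "infsum (\<lambda>g. \<Prod>x\<in>S. f x (g x)) (PiE S B) = (\<Prod>x\<in>S. infsum (f x) (B x))"
    by (rule infsum_prod_PiE_abs) (use assms in auto)
  thus ?thesis using summable_on_prod_PiE_nonneg[of S f B] assms by (simp add: has_sum_iff)
qed

lemma osc_prod:
  assumes "finite S" "\<And>p. p \<in> S \<Longrightarrow> p > 0"
  shows "osc (- ln (real (\<Prod>p\<in>S. p ^ g p))) t = (\<Prod>p\<in>S. osc (- ln (real p)) t ^ g p)"
proof -
  have eq: "- ln (real (\<Prod>p\<in>S. p ^ g p)) = (\<Sum>p\<in>S. real (g p) * (- ln (real p)))"
    using assms by (simp add: ln_prod ln_realpow sum_negf)
  have "osc (\<Sum>p\<in>S. real (g p) * w p) t = (\<Prod>p\<in>S. osc (w p) t ^ g p)" for w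
    using assms(1)
  proof (induction S rule: finite_induct)
    case (insert x F)
    have "osc (real (g x) * w x) t = osc (w x) t ^ g x"
      by (simp add: osc_def exp_of_nat_mult[symmetric] mult_ac)
    thus ?case using insert by (simp add: osc_add)
  qed (simp add: osc_def)
  thus ?thesis unfolding eq .
qed

lemma nat_powr_critical_line:
  assumes "p > 0"
  shows "(of_nat p :: complex) powr (- Complex (1 / 2) t) = of_real (real p powr (- 1 / 2)) * osc (- ln (real p)) t"
proof -
  have "(of_nat p :: complex) powr (- Complex (1 / 2) t) = exp (of_real (ln (real p)) * (- Complex (1 / 2) t))"
    using assms by (simp add: powr_def mult.commute Ln_of_nat)
  also have "of_real (ln (real p)) * (- Complex (1 / 2) t) = of_real (- 1 / 2 * ln (real p)) + \<i> * of_real (- ln (real p) * t)"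
    by (simp add: complex_eq_iff)
  also have "exp \<dots> = of_real (real p powr (- 1 / 2)) * osc (- ln (real p)) t"
    using assms unfolding exp_add osc_def exp_of_real by (simp add: powr_def)
  finally show ?thesis .
qed

text \<open>An instance of \<open>dirichlet_series_mean_value\<close> indexed by exponent vectors g,
  with \<open>N g\<close> the corresponding integer and n^(-1/2) absorbed in \<open>b g\<close>.
  Each of the three sums that it asks for factors over the primes up to X.\<close>

lemma P_prod_mean_value:
  fixes q :: nat and l :: "(nat \<Rightarrow> complex) \<Rightarrow> nat"
  assumes "q > 0" "real q < X" "T > 0" "0 < \<delta>" "\<delta> \<le> 1 / 4"
  defines "k \<equiv> tuple_size q l"
  shows "\<bar>1 / T * integral {T..2 * T} (\<lambda>t. (cmod (P_prod X q l (Complex (1 / 2) t)))\<^sup>2)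
      - (\<Prod>p\<in>real_primes_upto X. local_square_sum (exp_coeff (local_exponent X q l p)) p)\<bar>
    \<le> 2 * T powr - \<delta> * (exp (majorant_const k * (\<Sum>p\<in>real_primes_upto X. real p powr - (1 / 2 - \<delta>))))\<^sup>2"
proof -
  define S where "S = real_primes_upto X"
  define G where "G = PiE S (\<lambda>_. UNIV :: nat set)"
  define N where "N g = (\<Prod>p\<in>S. p ^ g p)" for g
  define a where "a p = exp_coeff (local_exponent X q l p)" for p
  define b where "b g = (\<Prod>p\<in>S. a p (g p) * of_real ((real p powr (- 1 / 2)) ^ g p))" for g
  have fin: "finite S" by (simp add: S_def)
  have S2: "p \<ge> 2" if "p \<in> S" for p using that prime_ge_2_nat by (auto simp: S_def real_primes_upto_def)
  have S0: "p > 0" if "p \<in> S" for p using S2[OF that] by simp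
  have e: "norm (local_exponent X q l p j) \<le> real k" for p j
    unfolding k_def by (rule norm_local_exponent_le[OF assms(1)])
  have abs_sm: "(\<lambda>m. norm (a p m) * (real p powr - \<sigma>) ^ m) summable_on UNIV"
    and abs_le: "(\<Sum>\<^sub>\<infinity>m. norm (a p m) * (real p powr - \<sigma>) ^ m) \<le> exp (majorant_const k * real p powr - \<sigma>)"
    if "p \<in> S" "\<sigma> \<ge> 1 / 4" for p \<sigma>
    unfolding a_def by (rule local_abs_series[OF e S2[OF that(1)] that(2)])+
  \<comment> \<open>The exponent 1/2 - delta joins n^(-1/2) on the critical line with the weight
    n^delta of the mean value theorem.\<close>
  define V where "V = (\<Prod>p\<in>S. \<Sum>\<^sub>\<infinity>m. norm (a p m) * (real p powr - (1 / 2 - \<delta>)) ^ m)"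
  have "\<bar>1 / T * integral {T..2 * T} (\<lambda>t. (cmod (P_prod X q l (Complex (1 / 2) t)))\<^sup>2)
      - (\<Prod>p\<in>S. local_square_sum (a p) p)\<bar> \<le> 2 * T powr - \<delta> * V\<^sup>2"
  proof (rule dirichlet_series_mean_value[of N G])
    have "bij_betw (\<lambda>g. \<Prod>p\<in>S. p ^ g p) (PiE S (\<lambda>_. UNIV)) {n. n > 0 \<and> prime_factors n \<subseteq> S}"
      by (rule bij_betw_smooth_numbers[OF fin]) (auto simp: S_def real_primes_upto_def)
    thus "inj_on N G" unfolding N_def[abs_def] G_def by (rule bij_betw_imp_inj_on)
    show N0: "N g > 0" for g unfolding N_def using S0 by (intro prod_pos) auto
    have "cmod (b g) * real (N g) powr \<delta> = (\<Prod>p\<in>S. norm (a p (g p)) * (real p powr - (1 / 2 - \<delta>)) ^ g p)" for g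
    proof -
      have "real (N g) powr \<delta> = (\<Prod>p\<in>S. real (p ^ g p) powr \<delta>)"
        unfolding N_def of_nat_prod by (rule prod_powr_distrib)
      hence "cmod (b g) * real (N g) powr \<delta> = (\<Prod>p\<in>S. norm (a p (g p)) * (real p powr (- 1 / 2)) ^ g p * real (p ^ g p) powr \<delta>)"
        by (simp add: b_def prod_norm[symmetric] norm_mult norm_power prod.distrib)
      also have "\<dots> = (\<Prod>p\<in>S. norm (a p (g p)) * (real p powr - (1 / 2 - \<delta>)) ^ g p)"
      proof (intro prod.cong refl)
        fix p assume "p \<in> S"
        hence "real p > 0" using S0 by simp
        hence "real (p ^ g p) powr \<delta> = (real p powr \<delta>) ^ g p"
          by (simp add: powr_realpow[symmetric] powr_powr mult.commute)
        moreover have "real p powr (- 1 / 2) * real p powr \<delta> = real p powr - (1 / 2 - \<delta>)"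
          by (simp add: powr_add[symmetric])
        ultimately show "norm (a p (g p)) * (real p powr (- 1 / 2)) ^ g p * real (p ^ g p) powr \<delta> =
          norm (a p (g p)) * (real p powr - (1 / 2 - \<delta>)) ^ g p"
          by (simp only: power_mult_distrib[symmetric] mult.assoc)
      qed
      finally show ?thesis .
    qed
    moreover have "((\<lambda>g. \<Prod>p\<in>S. norm (a p (g p)) * (real p powr - (1 / 2 - \<delta>)) ^ g p) has_sum V) G"
      unfolding V_def G_def using assms fin by (intro real_prod_PiE_has_sum abs_sm) auto
    ultimately show "((\<lambda>g. cmod (b g) * real (N g) powr \<delta>) has_sum V) G" by simp
    show "((\<lambda>g. b g * osc (- ln (real (N g))) t) has_sum P_prod X q l (Complex (1 / 2) t)) G" for t
    proof -
      define z where "z p = (of_nat p :: complex) powr (- Complex (1 / 2) t)" for p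
      have z: "z p = of_real (real p powr (- 1 / 2)) * osc (- ln (real p)) t" if "p \<in> S" for p
        unfolding z_def by (rule nat_powr_critical_line[OF S0[OF that]])
      have z_norm: "norm (z p) = real p powr (- 1 / 2)" if "p \<in> S" for p
        using z[OF that] by (simp add: norm_mult)
      have z_lt: "norm (z p) < 1" if "p \<in> S" for p
        unfolding z_def by (rule norm_nat_powr_neg_less_1[OF S2[OF that]]) simp
      have sm: "(\<lambda>m. norm (a p m * z p ^ m)) summable_on UNIV" if "p \<in> S" for p
        using abs_sm[OF that, of "1/2"] z_norm[OF that] by (simp add: norm_mult norm_power)
      have val: "infsum (\<lambda>m. a p m * z p ^ m) UNIV = exp (log_series (local_exponent X q l p) (z p))" if "p \<in> S" for p
      proof -
        have "(\<lambda>m. a p m * z p ^ m) sums infsum (\<lambda>m. a p m * z p ^ m) UNIV"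
          by (rule has_sum_imp_sums[OF has_sum_infsum[OF abs_summable_summable[OF sm[OF that]]]])
        moreover have "(\<lambda>m. a p m * z p ^ m) sums exp (log_series (local_exponent X q l p) (z p))"
          unfolding a_def by (rule exp_coeff_sums[OF e z_lt[OF that]])
        ultimately show ?thesis by (rule sums_unique2)
      qed
      have "((\<lambda>g. \<Prod>p\<in>S. a p (g p) * z p ^ g p) has_sum (\<Prod>p\<in>S. infsum (\<lambda>m. a p m * z p ^ m) UNIV)) G"
        unfolding G_def by (rule prod_PiE_has_sum(2)[OF fin sm])
      also have "(\<Prod>p\<in>S. infsum (\<lambda>m. a p m * z p ^ m) UNIV) = P_prod X q l (Complex (1 / 2) t)"
        unfolding P_prod_eq_prod[OF assms(1,2), of "Complex (1 / 2) t" l, simplified] S_def[symmetric] z_def[symmetric]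
        by (intro prod.cong refl val)
      finally have "((\<lambda>g. \<Prod>p\<in>S. a p (g p) * z p ^ g p) has_sum P_prod X q l (Complex (1 / 2) t)) G" .
      moreover have "(\<Prod>p\<in>S. a p (g p) * z p ^ g p) = b g * osc (- ln (real (N g))) t" for g
      proof -
        have "(\<Prod>p\<in>S. a p (g p) * z p ^ g p) =
          (\<Prod>p\<in>S. a p (g p) * of_real ((real p powr (- 1 / 2)) ^ g p) * osc (- ln (real p)) t ^ g p)"
          by (intro prod.cong refl) (simp add: z power_mult_distrib)
        also have "\<dots> = (\<Prod>p\<in>S. a p (g p) * of_real ((real p powr (- 1 / 2)) ^ g p)) * (\<Prod>p\<in>S. osc (- ln (real p)) t ^ g p)"
          by (rule prod.distrib)
        also have "(\<Prod>p\<in>S. osc (- ln (real p)) t ^ g p) = osc (- ln (real (N g))) t"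
          unfolding N_def by (rule osc_prod[OF fin S0, symmetric])
        finally show ?thesis unfolding b_def .
      qed
      ultimately show ?thesis by simp
    qed
    have "(cmod (b g))\<^sup>2 = (\<Prod>p\<in>S. (cmod (a p (g p)))\<^sup>2 * (1 / real p) ^ g p)" for g
    proof -
      have "(cmod (b g))\<^sup>2 = (\<Prod>p\<in>S. (cmod (a p (g p)))\<^sup>2 * ((real p powr (- 1 / 2))\<^sup>2) ^ g p)"
      proof -
        have "cmod (b g) = (\<Prod>p\<in>S. cmod (a p (g p)) * (real p powr (- 1 / 2)) ^ g p)"
          by (simp add: b_def prod_norm[symmetric] norm_mult norm_power)
        thus ?thesis
          by (simp only: prod_power_distrib power_mult_distrib power_mult[symmetric] mult.commute[of _ 2])
      qed
      also have "\<dots> = (\<Prod>p\<in>S. (cmod (a p (g p)))\<^sup>2 * (1 / real p) ^ g p)"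
      proof (intro prod.cong refl)
        fix p assume "p \<in> S"
        hence "(real p powr (- 1 / 2))\<^sup>2 = 1 / real p"
          using S0[of p] by (simp add: power2_eq_square powr_add[symmetric] powr_minus_divide)
        thus "(cmod (a p (g p)))\<^sup>2 * ((real p powr (- 1 / 2))\<^sup>2) ^ g p = (cmod (a p (g p)))\<^sup>2 * (1 / real p) ^ g p"
          by simp
      qed
      finally show ?thesis .
    qed
    moreover have "((\<lambda>g. \<Prod>p\<in>S. (cmod (a p (g p)))\<^sup>2 * (1 / real p) ^ g p) has_sum
       (\<Prod>p\<in>S. \<Sum>\<^sub>\<infinity>m. (cmod (a p m))\<^sup>2 * (1 / real p) ^ m)) G"
      unfolding G_def a_def
      by (intro real_prod_PiE_has_sum fin local_square_series(2)[OF norm_exp_coeff_le_powr[OF e]] S2) auto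
    moreover have "(\<Prod>p\<in>S. \<Sum>\<^sub>\<infinity>m. (cmod (a p m))\<^sup>2 * (1 / real p) ^ m) = (\<Prod>p\<in>S. local_square_sum (a p) p)"
      unfolding a_def
      by (intro prod.cong refl local_square_series(3)[OF norm_exp_coeff_le_powr[OF e]] S2)
    ultimately show "((\<lambda>g. (cmod (b g))\<^sup>2) has_sum (\<Prod>p\<in>S. local_square_sum (a p) p)) G" by simp
  qed (use assms in auto)
  also have "2 * T powr - \<delta> * V\<^sup>2 \<le> 2 * T powr - \<delta> * (exp (majorant_const k * (\<Sum>p\<in>S. real p powr - (1 / 2 - \<delta>))))\<^sup>2"
  proof (intro mult_left_mono power_mono)
    have "V \<le> (\<Prod>p\<in>S. exp (majorant_const k * real p powr - (1 / 2 - \<delta>)))"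
      unfolding V_def using assms by (intro prod_mono conjI abs_le infsum_nonneg) auto
    also have "\<dots> = exp (majorant_const k * (\<Sum>p\<in>S. real p powr - (1 / 2 - \<delta>)))"
      by (simp add: exp_sum[OF fin] sum_distrib_left)
    finally show "V \<le> exp (majorant_const k * (\<Sum>p\<in>S. real p powr - (1 / 2 - \<delta>)))" .
    show "V \<ge> 0" unfolding V_def by (intro prod_nonneg ballI infsum_nonneg) auto
  qed auto
  finally show ?thesis by (simp add: S_def a_def)
qed

subsection \<open>The diagonal term\<close>

lemma local_square_sum_ge_1:
  assumes "\<And>m. norm (a m) \<le> C * 2 powr (real m / 8)" "p \<ge> 2" "a 0 = 1"
  shows "local_square_sum a p \<ge> 1"
proof -
  have "(\<Sum>m\<in>{0}. (cmod (a m))\<^sup>2 / real p ^ m) \<le> local_square_sum a p"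
    unfolding local_square_sum_def by (intro sum_le_suminf local_square_series(1)[OF assms(1,2)]) auto
  thus ?thesis using assms(3) by simp
qed

lemma square_powr_eighth: "(C * 2 powr (real m / 8))\<^sup>2 = C\<^sup>2 * 2 powr (real m / 4)"
  by (simp add: power_mult_distrib power2_eq_square powr_add[symmetric])

definition tail_const :: real where
  "tail_const = 2 powr (5 / 4) / (1 - 2 powr (- 5 / 8))"

text \<open>Only p^m > X matters, and then m >= 2 because p <= X. Split p^(-m) into (p^m)^(-1/8),
  which gives X^(-1/8); p^(-5/4), which is summable over p; and p^(-(7m/8 - 5/4)), a nonpositive
  power that at p >= 2 beats the growth 2^(m/4) with ratio 2^(-5/8).\<close>

lemma local_square_sum_diff:
  assumes a: "\<And>m. norm (a m) \<le> C * 2 powr (real m / 8)" and b: "\<And>m. norm (b m) \<le> C * 2 powr (real m / 8)"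
    and "p \<ge> 2" "real p \<le> X" and eq: "\<And>m. real p ^ m \<le> X \<Longrightarrow> a m = b m"
  shows "\<bar>local_square_sum a p - local_square_sum b p\<bar> \<le> C\<^sup>2 * tail_const * X powr (- 1 / 8) * real p powr (- 5 / 4)"
proof -
  define y :: real where "y = 2 powr (- 5 / 8)"
  have y: "0 < y" "y < 1"
  proof -
    have "(2::real) powr (- 5 / 8) < 2 powr 0" by (intro powr_less_mono) auto
    thus "y < 1" by (simp add: y_def)
  qed (simp add: y_def)
  define c where "c = C\<^sup>2 * X powr (- 1 / 8) * real p powr (- 5 / 4) * 2 powr (5 / 4)"
  have c0: "c \<ge> 0" by (simp add: c_def)
  have X: "X > 0" using assms by linarith
  let ?t = "\<lambda>m. (cmod (a m))\<^sup>2 / real p ^ m - (cmod (b m))\<^sup>2 / real p ^ m"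
  have le: "norm (?t m) \<le> c * y ^ m" for m
  proof (cases "real p ^ m \<le> X")
    case True
    thus ?thesis using eq[OF True] c0 y by simp
  next
    case False
    have "m \<noteq> 0" "m \<noteq> 1" using False assms by (auto intro: Nat.gr0I)
    hence m: "real m \<ge> 2" by simp
    have sq: "(cmod (a m))\<^sup>2 \<le> C\<^sup>2 * 2 powr (real m / 4)" "(cmod (b m))\<^sup>2 \<le> C\<^sup>2 * 2 powr (real m / 4)"
      unfolding square_powr_eighth[symmetric] by (intro power_mono a b norm_ge_zero)+
    have "norm (?t m) = \<bar>(cmod (a m))\<^sup>2 - (cmod (b m))\<^sup>2\<bar> / real p ^ m"
      by (simp add: diff_divide_distrib[symmetric])
    also have "\<bar>(cmod (a m))\<^sup>2 - (cmod (b m))\<^sup>2\<bar> \<le> C\<^sup>2 * 2 powr (real m / 4)"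
      using sq zero_le_power2[of "cmod (a m)"] zero_le_power2[of "cmod (b m)"] by linarith
    hence "\<bar>(cmod (a m))\<^sup>2 - (cmod (b m))\<^sup>2\<bar> / real p ^ m \<le> C\<^sup>2 * 2 powr (real m / 4) / real p ^ m"
      by (rule divide_right_mono) simp
    also have "\<dots> = C\<^sup>2 * 2 powr (real m / 4) * ((real p ^ m) powr (- 1 / 8) * (real p powr (- 5 / 4) * real p powr - (7 * real m / 8 - 5 / 4)))"
    proof -
      have "(real p ^ m) powr (- 1 / 8) * (real p powr (- 5 / 4) * real p powr - (7 * real m / 8 - 5 / 4)) = real p powr - real m"
      proof -
        have "(real p ^ m) powr (- 1 / 8) = real p powr (real m * (- 1 / 8))"
          using assms(3) by (subst powr_realpow[symmetric]) (simp_all add: powr_powr)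
        moreover have "real m * (- 1 / 8) + (- 5 / 4 + - (7 * real m / 8 - 5 / 4)) = - real m" by simp
        ultimately show ?thesis by (simp only: powr_add[symmetric])
      qed
      moreover have "real p powr - real m = 1 / real p ^ m"
        using assms(3) by (simp add: powr_minus powr_realpow divide_inverse)
      ultimately show ?thesis by (simp only: times_divide_eq_right mult_1_right)
    qed
    also have "\<dots> \<le> C\<^sup>2 * 2 powr (real m / 4) * (X powr (- 1 / 8) * (real p powr (- 5 / 4) * 2 powr - (7 * real m / 8 - 5 / 4)))"
      using False X m assms(3) by (intro mult_left_mono mult_mono powr_mono2') auto
    also have "\<dots> = c * (2 powr (real m / 4) * 2 powr - (7 * real m / 8 - 5 / 4) / 2 powr (5 / 4))"
      by (simp add: c_def)
    also have "2 powr (real m / 4) * 2 powr - (7 * real m / 8 - 5 / 4) / 2 powr (5 / 4) = y ^ m"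
      by (simp add: y_def powr_add[symmetric] powr_diff[symmetric] powr_realpow[symmetric] powr_powr)
    finally show ?thesis .
  qed
  have "local_square_sum a p - local_square_sum b p = (\<Sum>m. ?t m)"
    unfolding local_square_sum_def
    by (intro suminf_diff local_square_series(1)[OF a assms(3)] local_square_series(1)[OF b assms(3)])
  also have "norm \<dots> \<le> (\<Sum>m. c * y ^ m)"
    using y by (intro norm_suminf_le le summable_mult summable_geometric) auto
  also have "\<dots> = c * (1 / (1 - y))" using y by (simp add: suminf_mult suminf_geometric summable_geometric)
  finally show ?thesis by (simp add: c_def tail_const_def y_def mult_ac)
qed

definition second_const :: real where
  "second_const = 2 powr (1 / 2) / (1 - 2 powr (- 3 / 4))"

lemma second_const_pos: "second_const > 0"
proof -
  have "(2::real) powr (- 3 / 4) < 2 powr 0" by (intro powr_less_mono) auto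
  thus ?thesis by (simp add: second_const_def)
qed

text \<open>The terms with m >= 2 are dominated by p^(-2) times a geometric series of ratio 2^(1/4)
  / 2 = 2^(-3/4); the factor 2^(1/2) in \<open>second_const\<close> is 2^(m/4) at m = 2.\<close>

lemma local_square_sum_second_order:
  assumes a: "\<And>m. norm (a m) \<le> C * 2 powr (real m / 8)" and "p \<ge> 2" "a 0 = 1"
  shows "0 \<le> local_square_sum a p - 1 - (cmod (a 1))\<^sup>2 / real p"
    and "local_square_sum a p - 1 - (cmod (a 1))\<^sup>2 / real p \<le> C\<^sup>2 * second_const / real p ^ 2"
proof -
  define y :: real where "y = 2 powr (- 3 / 4)"
  have y: "0 < y" "y < 1"
  proof -
    have "(2::real) powr (- 3 / 4) < 2 powr 0" by (intro powr_less_mono) auto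
    thus "y < 1" by (simp add: y_def)
  qed (simp add: y_def)
  define f where "f m = (cmod (a m))\<^sup>2 / real p ^ m" for m
  have sm: "summable f" unfolding f_def by (rule local_square_series(1)[OF a assms(2)])
  have sm1: "summable (\<lambda>m. f (Suc m))" using sm by (subst summable_Suc_iff)
  have sm2: "summable (\<lambda>m. f (Suc (Suc m)))" using sm1 by (subst summable_Suc_iff)
  have "local_square_sum a p = suminf f" by (simp add: local_square_sum_def f_def[abs_def])
  hence eq: "local_square_sum a p - 1 - (cmod (a 1))\<^sup>2 / real p = (\<Sum>m. f (Suc (Suc m)))"
    using suminf_split_head[OF sm] suminf_split_head[OF sm1] assms(3) by (simp add: f_def)
  show "0 \<le> local_square_sum a p - 1 - (cmod (a 1))\<^sup>2 / real p"
    unfolding eq by (intro suminf_nonneg sm2) (simp add: f_def)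
  define c where "c = C\<^sup>2 * 2 powr (1 / 2) / real p ^ 2"
  have "f (Suc (Suc m)) \<le> c * y ^ m" for m
  proof -
    have "(cmod (a (Suc (Suc m))))\<^sup>2 \<le> C\<^sup>2 * 2 powr (real (Suc (Suc m)) / 4)"
      unfolding square_powr_eighth[symmetric] by (intro power_mono a norm_ge_zero)
    moreover have "real p ^ 2 * 2 ^ m \<le> real p ^ Suc (Suc m)"
      using assms(2) by (simp add: power2_eq_square mult.assoc mult_left_mono power_mono)
    ultimately have "f (Suc (Suc m)) \<le> C\<^sup>2 * 2 powr (real (Suc (Suc m)) / 4) / (real p ^ 2 * 2 ^ m)"
      unfolding f_def using assms(2) by (intro frac_le) (simp_all only: zero_le_mult_iff, auto)
    also have "\<dots> = c * (2 powr (real (Suc (Suc m)) / 4) / 2 powr (1 / 2) / 2 ^ m)" by (simp add: c_def)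
    also have "2 powr (real (Suc (Suc m)) / 4) / 2 powr (1 / 2) / 2 ^ m = y ^ m"
    proof -
      have "real (Suc (Suc m)) / 4 - 1 / 2 - real m = - 3 / 4 * real m" by (simp add: field_simps)
      moreover have "y ^ m = 2 powr (- 3 / 4 * real m)"
        unfolding y_def by (subst powr_realpow[symmetric]) (simp_all only: powr_powr, simp)
      moreover have "(2::real) ^ m = 2 powr real m" by (simp add: powr_realpow)
      ultimately show ?thesis by (simp only: powr_diff[symmetric])
    qed
    finally show ?thesis .
  qed
  hence "(\<Sum>m. f (Suc (Suc m))) \<le> (\<Sum>m. c * y ^ m)"
    using y by (intro suminf_le sm2 summable_mult summable_geometric) auto
  also have "\<dots> = c * (1 / (1 - y))" using y by (simp add: suminf_mult suminf_geometric summable_geometric)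
  finally show "local_square_sum a p - 1 - (cmod (a 1))\<^sup>2 / real p \<le> C\<^sup>2 * second_const / real p ^ 2"
    unfolding eq by (simp add: c_def second_const_def y_def mult_ac)
qed

lemma abs_ln_one_plus_minus_le:
  fixes u :: real
  assumes "u \<ge> 0"
  shows "\<bar>ln (1 + u) - u\<bar> \<le> u\<^sup>2"
proof (cases "u \<le> 1")
  case True thus ?thesis using abs_ln_one_plus_x_minus_x_bound_nonneg assms by blast
next
  case False
  have "ln (1 + u) \<le> u" "ln (1 + u) \<ge> 0" using assms ln_add_one_self_le_self by auto
  moreover have "u \<le> u\<^sup>2" using False by (simp add: power2_eq_square)
  ultimately show ?thesis by linarith
qed

section \<open>Local sums of \<open>d_coeff\<close>\<close>

definition local_d_sum :: "nat \<Rightarrow> ((nat \<Rightarrow> complex) \<Rightarrow> nat) \<Rightarrow> nat \<Rightarrow> real" where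
  "local_d_sum q l p = local_square_sum (\<lambda>m. d_coeff q l (p ^ m)) p"

context
  fixes q k :: nat and l :: "(nat \<Rightarrow> complex) \<Rightarrow> nat"
  assumes q: "q > 0" and k: "tuple_size q l = k"
begin

lemma norm_d_coeff_prime_power_le:
  assumes "prime p"
  shows "norm (d_coeff q l (p ^ m)) \<le> coeff_const k * 2 powr (real m / 8)"
  unfolding d_coeff_prime_power[OF q assms] k[symmetric]
  by (intro norm_exp_coeff_le_powr norm_weighted_sum_le)
    (use q in \<open>auto simp: dcharacters_def norm_power intro!: power_le_one norm_dcharacter_le\<close>)

lemma norm_d_coeff_prime_le:
  assumes "prime p"
  shows "norm (d_coeff q l p) \<le> real k"
  unfolding d_coeff_prime[OF q assms] k[symmetric]
  by (intro norm_weighted_sum_le) (use q in \<open>auto simp: dcharacters_def intro!: norm_dcharacter_le\<close>)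

lemma d_coeff_1:
  assumes "prime (p :: nat)"
  shows "d_coeff q l 1 = 1"
  using d_coeff_prime_power[OF q assms, of l 0] by simp

lemma d_coeff_prime_power_dvd:
  assumes "prime p" "p dvd q" "m > 0"
  shows "d_coeff q l (p ^ m) = 0"
proof -
  have "\<not> coprime p q" using assms by (meson coprime_common_divisor dvd_refl not_prime_unit)
  hence chi: "chi p = 0" if "chi \<in> dcharacters q" for chi
    using that dcharacter_eq_0_iff by (auto simp: dcharacters_def)
  have "d_coeff q l (p ^ m) = exp_coeff (\<lambda>_. 0) m"
    unfolding d_coeff_prime_power[OF q assms(1)] by (rule exp_coeff_cong) (simp add: chi power_0_left)
  also have "log_fps (\<lambda>_. 0) = 0" by (simp add: fps_eq_iff log_fps_def)
  hence "exp_coeff (\<lambda>_. 0) m = 0" using assms(3) by (simp add: exp_coeff_def)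
  finally show ?thesis .
qed

lemma local_d_sum_ge_1: "prime p \<Longrightarrow> local_d_sum q l p \<ge> 1"
  unfolding local_d_sum_def using d_coeff_1[of p]
  by (intro local_square_sum_ge_1[OF norm_d_coeff_prime_power_le]) (auto simp: prime_ge_2_nat)

lemma local_d_sum_dvd:
  assumes "prime p" "p dvd q"
  shows "local_d_sum q l p = 1"
proof -
  have "(\<lambda>m. (cmod (d_coeff q l (p ^ m)))\<^sup>2 / real p ^ m) = (\<lambda>m. if m = 0 then 1 else 0)"
    using d_coeff_prime_power_dvd[OF assms] d_coeff_1[OF assms(1)] by (auto simp: fun_eq_iff)
  moreover have "(\<Sum>m. if m = 0 then 1 else (0::real)) = 1"
    using sums_single[of 0 "\<lambda>_. 1::real"] by (simp add: sums_iff)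
  ultimately show ?thesis by (simp add: local_d_sum_def local_square_sum_def)
qed

text \<open>The local sum is 1 + v + R with v = |d_l(p)|^2 / p and R = O(1/p^2); the logarithm adds
  an error (v + R)^2, again O(1/p^2). All constants depend on k alone.\<close>

lemma ln_local_d_sum:
  assumes "prime p"
  shows "\<bar>ln (local_d_sum q l p) - (cmod (d_coeff q l p))\<^sup>2 / real p\<bar> \<le>
    ((coeff_const k)\<^sup>2 * second_const + ((real k)\<^sup>2 + (coeff_const k)\<^sup>2 * second_const)\<^sup>2) / real p ^ 2"
proof -
  have p: "p \<ge> 2" "p > 0" using prime_ge_2_nat[OF assms] by auto
  define C where "C = (coeff_const k)\<^sup>2 * second_const"
  have C: "C \<ge> 0" using second_const_pos by (simp add: C_def)
  define v where "v = (cmod (d_coeff q l p))\<^sup>2 / real p"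
  define R where "R = local_d_sum q l p - 1 - v"
  have R: "0 \<le> R" "R \<le> C / real p ^ 2"
    using local_square_sum_second_order[OF norm_d_coeff_prime_power_le[OF assms] p(1)] d_coeff_1[OF assms]
    by (auto simp: R_def v_def local_d_sum_def C_def)
  have v: "0 \<le> v" "v \<le> (real k)\<^sup>2 / real p"
    unfolding v_def using norm_d_coeff_prime_le[OF assms] by (auto intro!: divide_right_mono power_mono)
  have "C / real p ^ 2 \<le> C / real p"
    using p C by (intro divide_left_mono) (auto simp: power2_eq_square)
  hence "v + R \<le> ((real k)\<^sup>2 + C) / real p" using v R by (simp add: add_divide_distrib)
  hence "(v + R)\<^sup>2 \<le> (((real k)\<^sup>2 + C) / real p)\<^sup>2" using v R by (intro power_mono) auto
  moreover have "\<bar>ln (1 + (v + R)) - (v + R)\<bar> \<le> (v + R)\<^sup>2" using v R by (intro abs_ln_one_plus_minus_le) auto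
  moreover have "1 + (v + R) = local_d_sum q l p" by (simp add: R_def)
  ultimately have "\<bar>ln (local_d_sum q l p) - v\<bar> \<le> C / real p ^ 2 + ((real k)\<^sup>2 + C)\<^sup>2 / real p ^ 2"
    using R by (simp add: power_divide)
  thus ?thesis by (simp add: v_def C_def add_divide_distrib)
qed

lemma tuple_lambda_le: "real (tuple_lambda q l) \<le> (real k)\<^sup>2"
proof -
  have "real (l chi) * real (l chi) \<le> real (l chi) * real k" if "chi \<in> dcharacters q" for chi
  proof -
    have "l chi \<le> k" unfolding k[symmetric] tuple_size_def
      using that by (intro member_le_sum finite_dcharacters q) auto
    thus ?thesis by (intro mult_left_mono) auto
  qed
  hence "real (tuple_lambda q l) \<le> (\<Sum>chi\<in>dcharacters q. real (l chi) * real k)"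
    unfolding tuple_lambda_def of_nat_sum by (intro sum_mono) (simp add: power2_eq_square)
  also have "\<dots> = (real k)\<^sup>2"
    unfolding k[symmetric] tuple_size_def power2_eq_square of_nat_sum by (simp add: sum_distrib_right)
  finally show ?thesis .
qed

text \<open>In |d_l(p)|^2 the pairs with chi = chi' contribute exactly lambda, since |chi(p)| = 1
  for p not dividing q. Only products of a character with the conjugate of a different one are
  left.\<close>

lemma lambda_minus_d_square:
  assumes "prime p" "\<not> p dvd q"
  shows "complex_of_real (real (tuple_lambda q l) - (cmod (d_coeff q l p))\<^sup>2) =
    - (\<Sum>chi\<in>dcharacters q. \<Sum>chi'\<in>dcharacters q - {chi}. of_nat (l chi * l chi') * (chi p * cnj (chi' p)))"
proof -
  have cop: "coprime p q" using assms by (simp add: prime_imp_coprime_nat)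
  have fin: "finite (dcharacters q)" by (rule finite_dcharacters[OF q])
  have "complex_of_real ((cmod (d_coeff q l p))\<^sup>2) = d_coeff q l p * cnj (d_coeff q l p)"
    by (rule complex_norm_square)
  also have "\<dots> = (\<Sum>chi\<in>dcharacters q. \<Sum>chi'\<in>dcharacters q. (of_nat (l chi) * chi p) * cnj (of_nat (l chi') * chi' p))"
    unfolding d_coeff_prime[OF q assms(1)] cnj_sum by (rule sum_product)
  also have "\<dots> = (\<Sum>chi\<in>dcharacters q. of_nat ((l chi)\<^sup>2) +
      (\<Sum>chi'\<in>dcharacters q - {chi}. of_nat (l chi * l chi') * (chi p * cnj (chi' p))))"
  proof (intro sum.cong refl)
    fix chi assume chi: "chi \<in> dcharacters q"
    hence "chi p * cnj (chi p) = 1"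
      using dcharacter_times_cnj[of q chi p] cop q by (simp add: dcharacters_def principal_dcharacter_def)
    hence "(of_nat (l chi) * chi p) * cnj (of_nat (l chi) * chi p) = of_nat ((l chi)\<^sup>2)"
      by (simp add: power2_eq_square mult_ac)
    thus "(\<Sum>chi'\<in>dcharacters q. (of_nat (l chi) * chi p) * cnj (of_nat (l chi') * chi' p)) = of_nat ((l chi)\<^sup>2) +
      (\<Sum>chi'\<in>dcharacters q - {chi}. of_nat (l chi * l chi') * (chi p * cnj (chi' p)))"
      by (subst sum.remove[OF fin chi]) (simp add: mult_ac)
  qed
  also have "\<dots> = of_nat (tuple_lambda q l) +
      (\<Sum>chi\<in>dcharacters q. \<Sum>chi'\<in>dcharacters q - {chi}. of_nat (l chi * l chi') * (chi p * cnj (chi' p)))"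
    unfolding tuple_lambda_def of_nat_sum by (rule sum.distrib)
  finally show ?thesis by simp
qed

end

section \<open>Cancellation over primes\<close>

lemma dcharacter_times_cnj_nonprincipal:
  assumes "dcharacter q chi" "dcharacter q chi'" "q > 0" "chi \<noteq> chi'"
  shows "(\<lambda>n. chi n * cnj (chi' n)) \<noteq> principal_dcharacter q"
proof
  assume eq: "(\<lambda>n. chi n * cnj (chi' n)) = principal_dcharacter q"
  have "chi n = chi' n" for n
  proof -
    have "chi n = chi n * (chi' n * cnj (chi' n))"
      using dcharacter_times_principal[OF assms(1)] dcharacter_times_cnj[OF assms(2,3)] by simp
    also have "\<dots> = chi' n * (chi n * cnj (chi' n))" by simp
    also have "chi n * cnj (chi' n) = principal_dcharacter q n" using eq by metis
    also have "chi' n * principal_dcharacter q n = chi' n" by (rule dcharacter_times_principal[OF assms(2)])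
    finally show ?thesis .
  qed
  thus False using assms(4) by blast
qed

text \<open>There are finitely many characters, so the sum of their individual constants serves for
  all of them.\<close>

lemma uniform_primes_dcharacter_sum_bound:
  assumes "q > 0"
  obtains K where "K \<ge> 0" "\<And>psi a b. dcharacter q psi \<Longrightarrow> psi \<noteq> principal_dcharacter q \<Longrightarrow> a \<ge> 2 \<Longrightarrow>
    norm (\<Sum>p=a..b. (if prime p then 1 / real p else 0) *\<^sub>R psi p) \<le> K / ln (real a)"
proof -
  have ex: "\<exists>K. K \<ge> 0 \<and> (\<forall>a b. a \<ge> 2 \<longrightarrow>
    norm (\<Sum>p=a..b. (if prime p then 1 / real p else 0) *\<^sub>R psi p) \<le> K / ln (real a))"
    if "psi \<in> dcharacters q - {principal_dcharacter q}" for psi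
  proof -
    have psi: "dcharacter q psi" "psi \<noteq> principal_dcharacter q" using that by (auto simp: dcharacters_def)
    show ?thesis
    proof (rule primes_dcharacter_sum_bound[OF psi(1) assms psi(2)])
      fix K assume K: "K \<ge> 0" "\<And>a b. a \<ge> 2 \<Longrightarrow>
        norm (\<Sum>p=a..b. (if prime p then 1 / real p else 0) *\<^sub>R psi p) \<le> K / ln (real a)"
      show ?thesis by (intro exI[of _ K] conjI allI impI K)
    qed
  qed
  hence "\<forall>psi\<in>dcharacters q - {principal_dcharacter q}. \<exists>K. K \<ge> 0 \<and> (\<forall>a b. a \<ge> 2 \<longrightarrow>
    norm (\<Sum>p=a..b. (if prime p then 1 / real p else 0) *\<^sub>R psi p) \<le> K / ln (real a))"
    by (intro ballI ex)
  from bchoice[OF this] obtain K where K0: "\<forall>psi\<in>dcharacters q - {principal_dcharacter q}. K psi \<ge> 0 \<and> (\<forall>a b. a \<ge> 2 \<longrightarrow>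
    norm (\<Sum>p=a..b. (if prime p then 1 / real p else 0) *\<^sub>R psi p) \<le> K psi / ln (real a))" ..
  have K1: "K psi \<ge> 0" if "psi \<in> dcharacters q - {principal_dcharacter q}" for psi
    using bspec[OF K0 that] by (rule conjunct1)
  have K2: "norm (\<Sum>p=a..b. (if prime p then 1 / real p else 0) *\<^sub>R psi p) \<le> K psi / ln (real a)"
    if "psi \<in> dcharacters q - {principal_dcharacter q}" "a \<ge> 2" for psi a b
    using bspec[OF K0 that(1), THEN conjunct2, rule_format, OF that(2)] .
  define M where "M = (\<Sum>psi\<in>dcharacters q - {principal_dcharacter q}. K psi)"
  have fin: "finite (dcharacters q - {principal_dcharacter q})" using finite_dcharacters[OF assms] by simp
  show ?thesis
  proof (rule that[of M])
    show "M \<ge> 0" unfolding M_def by (intro sum_nonneg K1)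
    fix psi and a b :: nat assume psi: "dcharacter q psi" "psi \<noteq> principal_dcharacter q" and a: "a \<ge> 2"
    hence mem: "psi \<in> dcharacters q - {principal_dcharacter q}" by (simp add: dcharacters_def)
    have "K psi \<le> M" unfolding M_def by (rule member_le_sum[OF mem]) (use K1 fin in auto)
    hence "K psi / ln (real a) \<le> M / ln (real a)" using a by (intro divide_right_mono) auto
    thus "norm (\<Sum>p=a..b. (if prime p then 1 / real p else 0) *\<^sub>R psi p) \<le> M / ln (real a)"
      using K2[OF mem a, of b] by linarith
  qed
qed

text \<open>Starting the block beyond q excludes the primes dividing q, where lambda - |d_l(p)|^2 =
  lambda shows no cancellation. The weights l(chi) l(chi') add up to at most k^2, which makes the
  constant independent of the tuple.\<close>

lemma lambda_minus_d_square_sum_bound: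
  assumes q: "q > 0"
  obtains K where "K \<ge> 0" "\<And>l a b. tuple_size q l = k \<Longrightarrow> a \<ge> 2 \<Longrightarrow> a > q \<Longrightarrow>
    \<bar>\<Sum>p=a..b. if prime p then (real (tuple_lambda q l) - (cmod (d_coeff q l p))\<^sup>2) / real p else 0\<bar> \<le> K / ln (real a)"
proof -
  obtain K where K: "K \<ge> 0" "\<And>psi a b. dcharacter q psi \<Longrightarrow> psi \<noteq> principal_dcharacter q \<Longrightarrow> a \<ge> 2 \<Longrightarrow>
    norm (\<Sum>p=a..b. (if prime p then 1 / real p else 0) *\<^sub>R psi p) \<le> K / ln (real a)"
    using uniform_primes_dcharacter_sum_bound[OF q] by blast
  show ?thesis
  proof (rule that[of "(real k)\<^sup>2 * K"])
    fix l :: "(nat \<Rightarrow> complex) \<Rightarrow> nat" and a b :: nat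
    assume l: "tuple_size q l = k" and a: "a \<ge> 2" "a > q"
    let ?D = "dcharacters q"
    let ?u = "\<lambda>p. if prime p then 1 / real p else 0"
    have "complex_of_real (\<Sum>p=a..b. if prime p then (real (tuple_lambda q l) - (cmod (d_coeff q l p))\<^sup>2) / real p else 0)
      = (\<Sum>p=a..b. - (\<Sum>chi\<in>?D. \<Sum>chi'\<in>?D - {chi}. of_nat (l chi * l chi') * (?u p *\<^sub>R (chi p * cnj (chi' p)))))"
      unfolding of_real_sum
    proof (intro sum.cong refl)
      fix p assume p: "p \<in> {a..b}"
      show "complex_of_real (if prime p then (real (tuple_lambda q l) - (cmod (d_coeff q l p))\<^sup>2) / real p else 0) =
        - (\<Sum>chi\<in>?D. \<Sum>chi'\<in>?D - {chi}. of_nat (l chi * l chi') * (?u p *\<^sub>R (chi p * cnj (chi' p))))"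
      proof (cases "prime p")
        case True
        have "\<not> p dvd q" using p a q by (auto dest: dvd_imp_le)
        hence "complex_of_real (real (tuple_lambda q l) - (cmod (d_coeff q l p))\<^sup>2) * of_real (1 / real p) =
          - (\<Sum>chi\<in>?D. \<Sum>chi'\<in>?D - {chi}. of_nat (l chi * l chi') * (chi p * cnj (chi' p))) * of_real (1 / real p)"
          using lambda_minus_d_square[OF q l True] by simp
        also have "\<dots> = - (\<Sum>chi\<in>?D. \<Sum>chi'\<in>?D - {chi}. of_nat (l chi * l chi') * (?u p *\<^sub>R (chi p * cnj (chi' p))))"
          using True by (simp add: sum_divide_distrib scaleR_conv_of_real mult_ac)
        finally show ?thesis using True by simp
      qed auto
    qed
    also have "\<dots> = - (\<Sum>chi\<in>?D. \<Sum>chi'\<in>?D - {chi}. of_nat (l chi * l chi') * (\<Sum>p=a..b. ?u p *\<^sub>R (chi p * cnj (chi' p))))"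
      unfolding sum_negf sum_distrib_left
      by (subst sum.swap) (intro arg_cong[where f = uminus] sum.cong refl sum.swap)
    also have "norm \<dots> \<le> (\<Sum>chi\<in>?D. \<Sum>chi'\<in>?D. real (l chi) * real (l chi') * (K / ln (real a)))"
      unfolding norm_minus_cancel
    proof (intro sum_norm_le order.trans[OF sum_norm_le])
      fix chi chi' assume chi: "chi \<in> ?D" "chi' \<in> ?D - {chi}"
      have "norm (\<Sum>p=a..b. ?u p *\<^sub>R (chi p * cnj (chi' p))) \<le> K / ln (real a)"
        using chi q a
        by (intro K dcharacter_times dcharacter_cnj dcharacter_times_cnj_nonprincipal) (auto simp: dcharacters_def)
      hence "real (l chi) * real (l chi') * norm (\<Sum>p=a..b. ?u p *\<^sub>R (chi p * cnj (chi' p))) \<le>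
        real (l chi) * real (l chi') * (K / ln (real a))"
        by (intro mult_left_mono) auto
      thus "norm (of_nat (l chi * l chi') * (\<Sum>p=a..b. ?u p *\<^sub>R (chi p * cnj (chi' p)))) \<le>
        real (l chi) * real (l chi') * (K / ln (real a))"
        by (simp only: norm_mult norm_of_nat of_nat_mult)
    next
      fix chi assume "chi \<in> ?D"
      show "(\<Sum>chi'\<in>?D - {chi}. real (l chi) * real (l chi') * (K / ln (real a))) \<le>
        (\<Sum>chi'\<in>?D. real (l chi) * real (l chi') * (K / ln (real a)))"
        using finite_dcharacters[OF q] K(1) a by (intro sum_mono2) auto
    qed
    also have "\<dots> = (real k)\<^sup>2 * K / ln (real a)"
      unfolding l[symmetric] tuple_size_def power2_eq_square of_nat_sum sum_product
      by (simp add: sum_distrib_right sum_divide_distrib)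
    finally show "\<bar>\<Sum>p=a..b. if prime p then (real (tuple_lambda q l) - (cmod (d_coeff q l p))\<^sup>2) / real p else 0\<bar> \<le> (real k)\<^sup>2 * K / ln (real a)"
      by (simp only: norm_of_real)
  qed (use K in auto)
qed

section \<open>Logarithms of \<open>b_const\<close> and \<open>F_X\<close>\<close>

text \<open>At a prime p | q the value is 0 of itself, because d_l(p) = 0 and the local sum is 1;
  this agrees with the factor 1 in \<open>b_const\<close>.\<close>

definition b_log :: "nat \<Rightarrow> ((nat \<Rightarrow> complex) \<Rightarrow> nat) \<Rightarrow> nat \<Rightarrow> real" where
  "b_log q l n = (if prime n
     then (cmod (d_coeff q l n))\<^sup>2 * ln (1 - 1 / real n) + ln (local_d_sum q l n) else 0)"

definition F_log :: "nat \<Rightarrow> ((nat \<Rightarrow> complex) \<Rightarrow> nat) \<Rightarrow> nat \<Rightarrow> real" where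
  "F_log q l n = (if prime n
     then (real (tuple_lambda q l) - (cmod (d_coeff q l n))\<^sup>2) * ln (1 - 1 / real n) else 0)"

lemma abs_ln_one_minus_inverse_le:
  assumes "n \<ge> (2::nat)"
  shows "\<bar>ln (1 - 1 / real n) + 1 / real n\<bar> \<le> 2 / real n ^ 2"
  using neg_ln_one_minus_bounds[of "1 / real n"] assms by (auto simp: power_divide field_simps abs_le_iff)

lemma abs_sum_le_inverse_square:
  assumes "\<And>n. n \<ge> 2 \<Longrightarrow> \<bar>f n\<bar> \<le> C / real n ^ 2" "C \<ge> 0" "a \<ge> 2"
  shows "\<bar>\<Sum>n=a..b. f n\<bar> \<le> 2 * C / ln (real a)"
proof -
  have "\<bar>\<Sum>n=a..b. f n\<bar> \<le> (\<Sum>n=a..b. C * (1 / real n ^ 2))"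
    by (rule order.trans[OF sum_abs], rule sum_mono) (use assms in auto)
  also have "\<dots> = C * (\<Sum>n=a..b. 1 / real n ^ 2)" by (simp add: sum_distrib_left)
  also have "\<dots> \<le> C * (2 / real a)" using sum_inverse_squares_le[OF assms(3)] assms(2) by (intro mult_left_mono)
  also have "\<dots> \<le> C * (2 / ln (real a))"
    using assms ln_le_real[of a] by (intro mult_left_mono divide_left_mono mult_pos_pos) auto
  finally show ?thesis by (simp add: mult.commute)
qed

definition b_tail_const :: "nat \<Rightarrow> real" where
  "b_tail_const k = 2 * (real k)\<^sup>2 + (coeff_const k)\<^sup>2 * second_const + ((real k)\<^sup>2 + (coeff_const k)\<^sup>2 * second_const)\<^sup>2"

lemma b_tail_const_nonneg: "b_tail_const k \<ge> 0"
  unfolding b_tail_const_def using second_const_pos by (intro add_nonneg_nonneg mult_nonneg_nonneg) auto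

text \<open>The terms |d_l(p)|^2 / p of the two logarithms cancel, leaving O(1/p^2).\<close>

lemma b_log_block:
  assumes "q > 0" "tuple_size q l = k" "a \<ge> 2"
  shows "\<bar>\<Sum>n=a..b. b_log q l n\<bar> \<le> 2 * b_tail_const k / ln (real a)"
proof (rule abs_sum_le_inverse_square[OF _ b_tail_const_nonneg assms(3)])
  fix n :: nat assume n: "n \<ge> 2"
  show "\<bar>b_log q l n\<bar> \<le> b_tail_const k / real n ^ 2"
  proof (cases "prime n")
    case True
    define D where "D = (cmod (d_coeff q l n))\<^sup>2"
    have D: "0 \<le> D" "D \<le> (real k)\<^sup>2"
      unfolding D_def using norm_d_coeff_prime_le[OF assms(1,2) True] by (auto intro: power_mono)
    have "b_log q l n = D * (ln (1 - 1 / real n) + 1 / real n) + (ln (local_d_sum q l n) - D / real n)"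
      using True by (simp add: b_log_def D_def algebra_simps)
    hence "\<bar>b_log q l n\<bar> \<le> \<bar>D * (ln (1 - 1 / real n) + 1 / real n)\<bar> + \<bar>ln (local_d_sum q l n) - D / real n\<bar>" by simp
    moreover have "\<bar>D * (ln (1 - 1 / real n) + 1 / real n)\<bar> \<le> (real k)\<^sup>2 * (2 / real n ^ 2)"
      unfolding abs_mult using D abs_ln_one_minus_inverse_le[OF n] by (intro mult_mono) auto
    moreover note ln_local_d_sum[OF assms(1,2) True, folded D_def]
    ultimately have "\<bar>b_log q l n\<bar> \<le> (real k)\<^sup>2 * (2 / real n ^ 2) +
      ((coeff_const k)\<^sup>2 * second_const + ((real k)\<^sup>2 + (coeff_const k)\<^sup>2 * second_const)\<^sup>2) / real n ^ 2" by linarith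
    also have "\<dots> = b_tail_const k / real n ^ 2" by (simp add: b_tail_const_def add_divide_distrib)
    finally show ?thesis .
  qed (use b_tail_const_nonneg in \<open>simp add: b_log_def\<close>)
qed

text \<open>Up to O(1/p^2) the term is -(lambda - |d_l(p)|^2) / p, whose sum is small only through
  cancellation between characters.\<close>

lemma F_log_block:
  assumes q: "q > 0"
  obtains K where "K \<ge> 0" "\<And>l a b. tuple_size q l = k \<Longrightarrow> a \<ge> 2 \<Longrightarrow> a > q \<Longrightarrow>
    \<bar>\<Sum>n=a..b. F_log q l n\<bar> \<le> K / ln (real a)"
proof -
  obtain K where K: "K \<ge> 0" "\<And>l a b. tuple_size q l = k \<Longrightarrow> a \<ge> 2 \<Longrightarrow> a > q \<Longrightarrow>
    \<bar>\<Sum>p=a..b. if prime p then (real (tuple_lambda q l) - (cmod (d_coeff q l p))\<^sup>2) / real p else 0\<bar> \<le> K / ln (real a)"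
    by (rule lambda_minus_d_square_sum_bound[OF q, of k]) (rule that)
  show ?thesis
  proof (rule that[of "K + 2 * (2 * (real k)\<^sup>2)"])
    fix l :: "(nat \<Rightarrow> complex) \<Rightarrow> nat" and a b :: nat
    assume l: "tuple_size q l = k" and a: "a \<ge> 2" "a > q"
    define u where "u p = (if prime p then (real (tuple_lambda q l) - (cmod (d_coeff q l p))\<^sup>2) / real p else 0)" for p
    have "\<bar>\<Sum>n=a..b. F_log q l n + u n\<bar> \<le> 2 * (2 * (real k)\<^sup>2) / ln (real a)"
    proof (rule abs_sum_le_inverse_square[OF _ _ a(1)])
      fix n :: nat assume n: "n \<ge> 2"
      show "\<bar>F_log q l n + u n\<bar> \<le> 2 * (real k)\<^sup>2 / real n ^ 2"
      proof (cases "prime n")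
        case True
        define D where "D = (cmod (d_coeff q l n))\<^sup>2"
        have D: "0 \<le> D" "D \<le> (real k)\<^sup>2"
          unfolding D_def using norm_d_coeff_prime_le[OF q l True] by (auto intro: power_mono)
        have "F_log q l n + u n = (real (tuple_lambda q l) - D) * (ln (1 - 1 / real n) + 1 / real n)"
          using True by (simp add: F_log_def u_def D_def algebra_simps diff_divide_distrib)
        moreover have "\<bar>real (tuple_lambda q l) - D\<bar> \<le> (real k)\<^sup>2"
          using D tuple_lambda_le[OF q l] of_nat_0_le_iff[of "tuple_lambda q l", where ?'a = real] by linarith
        ultimately have "\<bar>F_log q l n + u n\<bar> \<le> (real k)\<^sup>2 * (2 / real n ^ 2)"
          using abs_ln_one_minus_inverse_le[OF n] by (simp only: abs_mult) (intro mult_mono; simp)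
        thus ?thesis by (simp add: mult.commute)
      qed (simp add: F_log_def u_def)
    qed simp
    moreover have "\<bar>\<Sum>n=a..b. u n\<bar> \<le> K / ln (real a)" unfolding u_def by (rule K(2)[OF l a])
    ultimately show "\<bar>\<Sum>n=a..b. F_log q l n\<bar> \<le> (K + 2 * (2 * (real k)\<^sup>2)) / ln (real a)"
      unfolding sum.distrib add_divide_distrib by linarith
  qed (use K in auto)
qed

lemma b_const_eq_exp:
  assumes "q > 0" "tuple_size q l = k" "summable (b_log q l)"
  shows "b_const q l = exp (suminf (b_log q l))"
proof -
  have "(if prime p \<and> \<not> p dvd q then (1 - 1 / real p) powr (cmod (d_coeff q l p))\<^sup>2 *
          (\<Sum>m. (cmod (d_coeff q l (p ^ m)))\<^sup>2 / real p ^ m) else 1) = exp (b_log q l p)" for p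
  proof (cases "prime p")
    case True
    have p: "1 - 1 / real p > 0" using prime_gt_1_nat[OF True] by simp
    have W: "local_d_sum q l p > 0" using local_d_sum_ge_1[OF assms(1,2) True] by linarith
    show ?thesis
    proof (cases "p dvd q")
      case False
      have "(\<Sum>m. (cmod (d_coeff q l (p ^ m)))\<^sup>2 / real p ^ m) = local_d_sum q l p"
        by (simp add: local_d_sum_def local_square_sum_def)
      moreover have "p \<noteq> Suc 0" using True by auto
      ultimately show ?thesis using True False p W by (simp add: b_log_def exp_add powr_def)
    next
      case True
      with \<open>prime p\<close> show ?thesis
        using d_coeff_prime_power_dvd[OF assms(1,2) \<open>prime p\<close> True, of 1] local_d_sum_dvd[OF assms(1,2) \<open>prime p\<close> True]
        by (simp add: b_log_def)
    qed
  qed (simp add: b_log_def)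
  thus ?thesis unfolding b_const_def by (simp add: prodinf_exp[OF assms(3)])
qed

lemma F_X_eq_exp:
  assumes "X > 1" "summable (F_log q l)"
  shows "F_X X q l = exp (real (tuple_lambda q l) * (euler_mascheroni + ln (ln X)) + suminf (F_log q l))"
proof -
  have "(if prime p then (1 - 1 / real p) powr (real (tuple_lambda q l) - (cmod (d_coeff q l p))\<^sup>2) else 1) = exp (F_log q l p)" for p
    using prime_gt_1_nat[of p] by (auto simp: F_log_def powr_def)
  hence "prodinf (\<lambda>p. if prime p then (1 - 1 / real p) powr (real (tuple_lambda q l) - (cmod (d_coeff q l p))\<^sup>2) else 1) =
    exp (suminf (F_log q l))" by (simp add: prodinf_exp[OF assms(2)])
  moreover have "(exp euler_mascheroni * ln X) ^ tuple_lambda q l = exp (real (tuple_lambda q l) * (euler_mascheroni + ln (ln X)))"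
    using assms(1) by (simp add: exp_of_nat_mult exp_add power_mult_distrib)
  ultimately show ?thesis unfolding F_X_def by (simp add: exp_add)
qed

lemma ln_powr_eighth_bound:
  assumes "X \<ge> (2::real)"
  shows "X powr (- 1 / 8) \<le> 8 / ln X"
proof -
  have "ln X / 8 = ln (X powr (1 / 8))" using assms by (simp add: ln_powr)
  also have "\<dots> \<le> X powr (1 / 8)" using ln_le_minus_one[of "X powr (1/8)"] assms by simp
  finally have "ln X \<le> 8 * X powr (1 / 8)" by simp
  hence "ln X * X powr (- 1 / 8) \<le> 8 * X powr (1 / 8) * X powr (- 1 / 8)" by (intro mult_right_mono) auto
  also have "\<dots> = 8" using assms by (simp add: powr_add[symmetric])
  finally show ?thesis using assms by (simp add: field_simps)
qed

text \<open>All comparisons are additive in logarithms. The four errors are the truncation of the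
  local coefficients, the tails of \<open>b_log\<close> and of \<open>F_log\<close> beyond X, and
  Mertens' third theorem multiplied by lambda. The lower bound 1 for the diagonal later turns an
  absolute error into a relative one.\<close>

lemma diagonal_asymptotics:
  assumes q: "q > 0"
  obtains K where "K \<ge> 0" "\<And>l X. tuple_size q l = k \<Longrightarrow> X \<ge> 2 \<Longrightarrow> real q ^ 2 < X \<Longrightarrow>
    1 \<le> (\<Prod>p\<in>real_primes_upto X. local_square_sum (exp_coeff (local_exponent X q l p)) p) \<and>
    b_const q l * F_X X q l > 0 \<and>
    \<bar>ln (\<Prod>p\<in>real_primes_upto X. local_square_sum (exp_coeff (local_exponent X q l p)) p) - ln (b_const q l * F_X X q l)\<bar> \<le> K / ln X"
proof -
  obtain KF where KF: "KF \<ge> 0" "\<And>l a b. tuple_size q l = k \<Longrightarrow> a \<ge> 2 \<Longrightarrow> a > q \<Longrightarrow>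
    \<bar>\<Sum>n=a..b. F_log q l n\<bar> \<le> KF / ln (real a)"
    by (rule F_log_block[OF q, of k]) (rule that)
  obtain KM where KM: "\<And>N. N \<ge> 2 \<Longrightarrow>
    \<bar>(\<Sum>n=1..N. mertens_term n) - ln (ln (real N)) - euler_mascheroni\<bar> \<le> KM / ln (real N)"
    using mertens_third by blast
  have KM0: "KM \<ge> 0"
  proof -
    have "0 \<le> KM / ln (real 2)" using order.trans[OF abs_ge_zero KM[of 2]] by simp
    thus ?thesis by (simp add: zero_le_divide_iff)
  qed
  define KB where "KB = 2 * b_tail_const k"
  define C where "C = (coeff_const k)\<^sup>2 * tail_const"
  define Z where "Z = (\<Sum>n. real n powr (- 5 / 4))"
  have smZ: "summable (\<lambda>n. real n powr (- 5 / 4))" by (simp add: summable_real_powr_iff)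
  have C0: "C \<ge> 0"
  proof -
    have "(2::real) powr (- 5 / 8) < 2 powr 0" by (intro powr_less_mono) auto
    thus ?thesis by (simp add: C_def tail_const_def)
  qed
  have Z0: "Z \<ge> 0" unfolding Z_def by (intro suminf_nonneg smZ) auto
  define K where "K = 8 * C * Z + KB + KF + (real k)\<^sup>2 * (2 * KM + 2)"
  have KB0: "KB \<ge> 0" by (simp add: KB_def b_tail_const_nonneg)
  show ?thesis
  proof (rule that[of K])
    show "K \<ge> 0" unfolding K_def using C0 Z0 KB0 KF(1) KM0 by simp
    fix l X assume l: "tuple_size q l = k" and X: "X \<ge> 2" "real q ^ 2 < X"
    define lam where "lam = real (tuple_lambda q l)"
    define D where "D p = local_square_sum (exp_coeff (local_exponent X q l p)) p" for p
    define W where "W p = local_d_sum q l p" for p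
    define S where "S = real_primes_upto X"
    define N where "N = nat \<lfloor>X\<rfloor>"
    have NX: "real N \<le> X" "X < real N + 1" using X unfolding N_def by linarith+
    have N2: "N \<ge> 2" using NX X by linarith
    \<comment> \<open>This leads to q <= N, so that blocks starting at N + 1 contain no prime
      dividing q.\<close>
    have "q ^ 2 \<le> N" using NX X by (simp add: N_def le_nat_floor)
    moreover have "q \<le> q ^ 2" using q by (simp add: power2_eq_square)
    ultimately have qN: "q \<le> N" by linarith
    have "real q \<le> real N" using qN by simp
    have S: "S = primes_le N" unfolding S_def real_primes_upto_def primes_le_def N_def using X
      by (auto simp: le_nat_floor le_nat_iff le_floor_iff)
    have Sp: "prime p" "p \<ge> 2" "real p \<le> X" if "p \<in> S" for p
      using that prime_ge_2_nat by (auto simp: S_def real_primes_upto_def)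
    have fin: "finite S" by (simp add: S_def)
    have lnX: "ln X > 0" using X by simp
    have lnN: "ln (real N) > 0" using N2 by simp
    \<comment> \<open>X < N + 1 <= N^2, so bounds in 1/ln N and in 1/ln X are interchangeable up to
      a factor 2.\<close>
    have "ln X \<le> ln (real N ^ 2)"
    proof (rule ln_mono)
      have "N * 2 \<le> N * N" using N2 by (intro mult_left_mono) auto
      hence "N + 1 \<le> N ^ 2" unfolding power2_eq_square using N2 by linarith
      hence "real N + 1 \<le> real N ^ 2" by (metis of_nat_1 of_nat_add of_nat_le_iff of_nat_power)
      thus "X \<le> real N ^ 2" using NX by linarith
    qed (use X in auto)
    hence lnXN: "ln X \<le> 2 * ln (real N)" using N2 by (simp add: ln_realpow)
    have e_le: "norm (local_exponent X q l p j) \<le> real k" for p j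
      using norm_local_exponent_le[OF q, of X l p j] l by simp
    note coeff = norm_exp_coeff_le_powr[OF e_le]
    have D1: "D p \<ge> 1" if "p \<in> S" for p
      unfolding D_def by (rule local_square_sum_ge_1[OF coeff Sp(2)[OF that]]) simp
    have W1: "W p \<ge> 1" if "p \<in> S" for p
      unfolding W_def by (rule local_d_sum_ge_1[OF q l Sp(1)[OF that]])
    have DW: "\<bar>D p - W p\<bar> \<le> C * X powr (- 1 / 8) * real p powr (- 5 / 4)" if "p \<in> S" for p
      unfolding D_def W_def local_d_sum_def C_def
    proof (rule local_square_sum_diff[OF coeff norm_d_coeff_prime_power_le[OF q l Sp(1)[OF that]] Sp(2,3)[OF that]])
      fix m assume "real p ^ m \<le> X"
      thus "exp_coeff (local_exponent X q l p) m = d_coeff q l (p ^ m)"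
        by (intro exp_coeff_local_exponent q Sp(1)[OF that]) simp
    qed
    \<comment> \<open>The logarithm is 1-Lipschitz on [1, infinity), and both local sums are at
      least 1.\<close>
    have lnDW: "\<bar>ln (D p) - ln (W p)\<bar> \<le> \<bar>D p - W p\<bar>" if "p \<in> S" for p
    proof -
      have *: "ln y - ln x \<le> y - x" if "1 \<le> x" "x \<le> y" for x y :: real
      proof -
        have "ln (y / x) \<le> y / x - 1" using that by (intro ln_le_minus_one) auto
        also have "\<dots> = (y - x) / x" using that by (simp add: field_simps)
        also have "\<dots> \<le> (y - x) / 1" using that by (intro divide_left_mono) auto
        finally show ?thesis using that by (simp add: ln_div)
      qed
      show ?thesis
        using *[OF D1[OF that], of "W p"] *[OF W1[OF that], of "D p"] D1[OF that] W1[OF that]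
        by (cases "D p \<le> W p") (auto simp: abs_if)
    qed
    have 1: "\<bar>(\<Sum>p\<in>S. ln (D p)) - (\<Sum>p\<in>S. ln (W p))\<bar> \<le> 8 * C * Z / ln X"
    proof -
      have "\<bar>(\<Sum>p\<in>S. ln (D p)) - (\<Sum>p\<in>S. ln (W p))\<bar> \<le> (\<Sum>p\<in>S. C * X powr (- 1 / 8) * real p powr (- 5 / 4))"
        unfolding sum_subtractf[symmetric]
        by (rule order.trans[OF sum_abs], rule sum_mono) (use lnDW DW order.trans in blast)
      also have "\<dots> = C * X powr (- 1 / 8) * (\<Sum>p\<in>S. real p powr (- 5 / 4))" by (simp add: sum_distrib_left)
      also have "\<dots> \<le> C * (8 / ln X) * Z"
        unfolding Z_def using C0 X(1) lnX
        by (intro mult_mono mult_left_mono ln_powr_eighth_bound sum_le_suminf smZ fin) (auto intro: sum_nonneg)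
      finally show ?thesis by (simp add: mult_ac)
    qed
    have blk_b: "norm (\<Sum>i=a..b. b_log q l i) \<le> KB / ln (real a)" if "2 \<le> a" for a b
      using b_log_block[OF q l that] by (simp add: KB_def)
    \<comment> \<open>The start q + 2 is both at least 2 and beyond q; it serves for summability.
      The rate is taken later from blocks starting beyond N.\<close>
    have blk_F: "norm (\<Sum>i=a..b. F_log q l i) \<le> KF / ln (real a)" if "Suc (q + 1) \<le> a" for a b
      using KF(2)[OF l, of a b] that q by simp
    have lim: "(\<lambda>n. c / ln (real n)) \<longlonglongrightarrow> 0" for c :: real by real_asymp
    note sb = summable_block_bound[OF blk_b lim] and sF = summable_block_bound[OF blk_F lim]
    have tail_b: "\<bar>suminf (b_log q l) - (\<Sum>i<Suc N. b_log q l i)\<bar> \<le> KB / ln X"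
    proof -
      have "\<bar>suminf (b_log q l) - (\<Sum>i<Suc N. b_log q l i)\<bar> \<le> KB / ln (real (Suc N))"
        using sb(2)[of "Suc N"] N2 by (simp del: sum.lessThan_Suc of_nat_Suc)
      also have "\<dots> \<le> KB / ln X" using KB0 NX X by (intro divide_left_mono mult_pos_pos ln_mono) auto
      finally show ?thesis .
    qed
    have blk_F': "norm (\<Sum>i=a..b. F_log q l i) \<le> KF / ln (real a)" if "Suc N \<le> a" for a b
      using KF(2)[OF l, of a b] that qN N2 by simp
    have tail_F: "\<bar>suminf (F_log q l) - (\<Sum>i<Suc N. F_log q l i)\<bar> \<le> KF / ln X"
    proof -
      have "\<bar>suminf (F_log q l) - (\<Sum>i<Suc N. F_log q l i)\<bar> \<le> KF / ln (real (Suc N))"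
        using summable_block_bound(2)[OF blk_F' lim, of "Suc N"] by (simp del: sum.lessThan_Suc of_nat_Suc)
      also have "\<dots> \<le> KF / ln X" using KF(1) NX X by (intro divide_left_mono mult_pos_pos ln_mono) auto
      finally show ?thesis .
    qed
    \<comment> \<open>The exponents |d_l(p)|^2 cancel between b and F, so only lambda multiplies the
      Mertens sum.\<close>
    have partial: "(\<Sum>i<Suc N. b_log q l i) + (\<Sum>i<Suc N. F_log q l i) = (\<Sum>p\<in>S. ln (W p)) - lam * (\<Sum>n=1..N. mertens_term n)"
    proof -
      have "(\<Sum>i<Suc N. b_log q l i) + (\<Sum>i<Suc N. F_log q l i) = (\<Sum>i<Suc N. if prime i then ln (W i) - lam * mertens_term i else 0)"
        unfolding sum.distrib[symmetric]
        by (intro sum.cong refl) (auto simp: b_log_def F_log_def W_def lam_def mertens_term_def algebra_simps)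
      also have "\<dots> = (\<Sum>p\<in>S. ln (W p) - lam * mertens_term p)"
        unfolding S by (intro sum.mono_neutral_cong_right) (auto simp: primes_le_def)
      also have "\<dots> = (\<Sum>p\<in>S. ln (W p)) - lam * (\<Sum>p\<in>S. mertens_term p)"
        by (simp add: sum_subtractf sum_distrib_left)
      also have "(\<Sum>p\<in>S. mertens_term p) = (\<Sum>n=1..N. mertens_term n)"
        unfolding S by (intro sum.mono_neutral_cong_left) (auto simp: primes_le_def mertens_term_def prime_gt_0_nat Suc_le_eq)
      finally show ?thesis .
    qed
    have mert: "\<bar>lam * ((\<Sum>n=1..N. mertens_term n) - euler_mascheroni - ln (ln X))\<bar> \<le> (real k)\<^sup>2 * (2 * KM + 2) / ln X"
    proof -
      have i: "1 / ln (real N) \<le> 2 / ln X" using lnXN lnX lnN by (simp add: field_simps)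
      have "KM / ln (real N) \<le> 2 * KM / ln X" using mult_left_mono[OF i KM0] by (simp add: mult_ac)
      moreover have "\<bar>ln (ln X) - ln (ln (real N))\<bar> \<le> 2 / ln X"
      proof -
        have "ln (ln (real N)) \<le> ln (ln X)" using NX N2 by auto
        moreover have "ln (ln X) \<le> ln (ln (real (Suc N)))" using NX X by auto
        moreover have "ln (ln (real (Suc N))) - ln (ln (real N)) \<le> 1 / (real N * ln (real N))" by (rule lnln_diff_bounds(2)[OF N2])
        moreover have "1 / (real N * ln (real N)) \<le> 1 / (1 * ln (real N))"
          using N2 lnN by (intro divide_left_mono mult_right_mono mult_pos_pos) auto
        ultimately show ?thesis using i by simp
      qed
      ultimately have "\<bar>(\<Sum>n=1..N. mertens_term n) - euler_mascheroni - ln (ln X)\<bar> \<le> 2 * KM / ln X + 2 / ln X"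
        using KM[OF N2] by linarith
      also have "\<dots> = (2 * KM + 2) / ln X" by (simp add: add_divide_distrib)
      finally have "lam * \<bar>(\<Sum>n=1..N. mertens_term n) - euler_mascheroni - ln (ln X)\<bar> \<le> (real k)\<^sup>2 * ((2 * KM + 2) / ln X)"
        using tuple_lambda_le[OF q l] KM0 lnX unfolding lam_def by (intro mult_mono) auto
      thus ?thesis by (simp add: abs_mult lam_def)
    qed
    have bF: "b_const q l * F_X X q l = exp (suminf (b_log q l) + (lam * (euler_mascheroni + ln (ln X)) + suminf (F_log q l)))"
      using b_const_eq_exp[OF q l sb(1)] F_X_eq_exp[OF _ sF(1), of X] X by (simp add: exp_add lam_def)
    have lnbF: "ln (b_const q l * F_X X q l) = suminf (b_log q l) + lam * (euler_mascheroni + ln (ln X)) + suminf (F_log q l)"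
      unfolding bF by simp
    have lnD: "ln (\<Prod>p\<in>S. D p) = (\<Sum>p\<in>S. ln (D p))"
    proof (rule ln_prod[OF fin])
      fix p assume "p \<in> S"
      thus "D p \<noteq> 0" using D1[of p] by linarith
    qed
    have "(\<Sum>p\<in>S. ln (D p)) - (suminf (b_log q l) + lam * (euler_mascheroni + ln (ln X)) + suminf (F_log q l)) =
      ((\<Sum>p\<in>S. ln (D p)) - (\<Sum>p\<in>S. ln (W p))) - (suminf (b_log q l) - (\<Sum>i<Suc N. b_log q l i))
      - (suminf (F_log q l) - (\<Sum>i<Suc N. F_log q l i)) + lam * ((\<Sum>n=1..N. mertens_term n) - euler_mascheroni - ln (ln X))"
      using partial by (simp only: algebra_simps)
    hence "\<bar>ln (\<Prod>p\<in>S. D p) - ln (b_const q l * F_X X q l)\<bar> \<le> 8 * C * Z / ln X + KB / ln X + KF / ln X + (real k)\<^sup>2 * (2 * KM + 2) / ln X"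
      unfolding lnD lnbF using 1 tail_b tail_F mert by linarith
    also have "\<dots> = K / ln X" by (simp add: K_def add_divide_distrib)
    finally have "\<bar>ln (\<Prod>p\<in>S. D p) - ln (b_const q l * F_X X q l)\<bar> \<le> K / ln X" .
    moreover have "1 \<le> (\<Prod>p\<in>S. D p)" using D1 by (intro prod_ge_1) auto
    moreover have "b_const q l * F_X X q l > 0" unfolding bF by simp
    ultimately show "1 \<le> (\<Prod>p\<in>real_primes_upto X. local_square_sum (exp_coeff (local_exponent X q l p)) p) \<and>
      b_const q l * F_X X q l > 0 \<and>
      \<bar>ln (\<Prod>p\<in>real_primes_upto X. local_square_sum (exp_coeff (local_exponent X q l p)) p) - ln (b_const q l * F_X X q l)\<bar> \<le> K / ln X"
      unfolding S_def D_def by blast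
  qed
qed

subsection \<open>The error term\<close>

text \<open>Comparison with the integral of x^(-s), carried out as an induction with the mean value
  theorem.\<close>

lemma sum_powr_neg_le:
  fixes s :: real
  assumes "0 < s" "s < 1"
  shows "(\<Sum>n=1..N. real n powr - s) \<le> real N powr (1 - s) / (1 - s)"
proof (induction N)
  case (Suc N)
  show ?case
  proof (cases "N = 0")
    case True
    thus ?thesis using assms by simp
  next
    case False
    have "\<exists>z. real N < z \<and> z < real (Suc N) \<and> real (Suc N) powr (1 - s) - real N powr (1 - s) =
        (real (Suc N) - real N) * ((1 - s) * z powr (- s))"
      using False by (intro MVT2) (auto intro!: derivative_eq_intros)
    then obtain z where z: "real N < z" "z < real (Suc N)"
      "real (Suc N) powr (1 - s) - real N powr (1 - s) = (1 - s) * z powr - s" by auto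
    have "real (Suc N) powr - s \<le> z powr - s" using z assms by (intro powr_mono2') auto
    also have "z powr - s = (real (Suc N) powr (1 - s) - real N powr (1 - s)) / (1 - s)"
      using z(3) assms by simp
    finally show ?thesis using Suc by (simp add: diff_divide_distrib del: of_nat_Suc)
  qed
qed (use assms in simp)

lemma sum_primes_powr_le:
  fixes d :: real
  assumes "0 < d" "d \<le> 1 / 4" "X \<ge> 2"
  shows "(\<Sum>p\<in>real_primes_upto X. real p powr - (1 / 2 - d)) \<le> 2 * X powr (1 / 2 + d)"
proof -
  define N where "N = nat \<lfloor>X\<rfloor>"
  have N: "real N \<le> X" using assms unfolding N_def by linarith
  have "(\<Sum>p\<in>real_primes_upto X. real p powr - (1 / 2 - d)) \<le> (\<Sum>n=1..N. real n powr - (1 / 2 - d))"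
    by (intro sum_mono2) (auto simp: real_primes_upto_def N_def le_nat_floor prime_gt_0_nat Suc_le_eq)
  also have "\<dots> \<le> real N powr (1 - (1 / 2 - d)) / (1 - (1 / 2 - d))"
    using assms by (intro sum_powr_neg_le) auto
  also have "\<dots> \<le> X powr (1 / 2 + d) / (1 / 2)"
    using assms N by (intro frac_le) (auto intro!: powr_mono2 simp: add.commute)
  finally show ?thesis by simp
qed

lemma bounded_of_tendsto_at_top:
  fixes f :: "real \<Rightarrow> real"
  assumes "continuous_on {a..} f" "(f \<longlongrightarrow> l) at_top"
  obtains C where "\<And>x. x \<ge> a \<Longrightarrow> f x \<le> C"
proof -
  have "eventually (\<lambda>x. f x < l + 1) at_top" using assms(2) by (intro order_tendstoD) auto
  then obtain b where b: "\<And>x. x \<ge> b \<Longrightarrow> f x < l + 1" by (auto simp: eventually_at_top_linorder)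
  have "compact (f ` {a..max a b})"
    using assms(1) by (intro compact_continuous_image) (auto intro: continuous_on_subset)
  hence "bdd_above (f ` {a..max a b})" by (intro bounded_imp_bdd_above compact_imp_bounded)
  then obtain C where C: "\<And>x. x \<in> {a..max a b} \<Longrightarrow> f x \<le> C" unfolding bdd_above_def by blast
  show ?thesis
  proof (rule that[of "max C (l + 1)"])
    fix x assume "x \<ge> a"
    show "f x \<le> max C (l + 1)"
    proof (cases "x \<ge> b")
      case True thus ?thesis using b[OF True] by simp
    next
      case False thus ?thesis using C[of x] \<open>x \<ge> a\<close> by simp
    qed
  qed
qed

text \<open>Since theta < 1, the term c L^theta is eventually at most half of d L, and the other
  half still beats every power of L.\<close>

lemma exp_powr_decay:
  fixes c d \<theta> \<kappa> :: real
  assumes "d > 0" "\<theta> < 1"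
  shows "((\<lambda>L. L powr \<kappa> * exp (c * L powr \<theta> - d * L)) \<longlongrightarrow> 0) at_top"
proof -
  have "((\<lambda>L::real. c * L powr (\<theta> - 1)) \<longlongrightarrow> 0) at_top"
    using assms by real_asymp
  hence "eventually (\<lambda>L::real. c * L powr (\<theta> - 1) < d / 2) at_top"
    using assms by (intro order_tendstoD) auto
  hence ev: "eventually (\<lambda>L::real. norm (L powr \<kappa> * exp (c * L powr \<theta> - d * L)) \<le> L powr \<kappa> * exp (- (d / 2) * L)) at_top"
    using eventually_gt_at_top[of 0]
  proof eventually_elim
    case (elim L)
    have "c * L powr \<theta> = c * L powr (\<theta> - 1) * L" using elim by (simp add: powr_diff)
    also have "\<dots> \<le> d / 2 * L" using elim by (intro mult_right_mono) auto
    finally have "c * L powr \<theta> - d * L \<le> - (d / 2) * L" by simp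
    thus ?case by (simp add: mult_left_mono)
  qed
  moreover have "((\<lambda>L::real. L powr \<kappa> * exp (- (d / 2) * L)) \<longlongrightarrow> 0) at_top"
    using assms by real_asymp
  ultimately show ?thesis by (rule Lim_null_comparison)
qed

text \<open>With \<open>X \<le> A (ln T)^{2 - \<epsilon>}\<close> the exponent \<open>X^{1/2 + \<delta>}\<close> is at most a constant times \<open>(ln T)^\<theta>\<close> with
  \<open>\<theta> < 1\<close>, so the error of the mean value theorem beats any power of \<open>ln T\<close>.\<close>

lemma mean_value_error_bound:
  fixes A \<epsilon> \<delta> c :: real
  assumes "A > 0" "c \<ge> 0" "\<delta> > 0" "(2 - \<epsilon>) * (1 / 2 + \<delta>) < 1"
  obtains C where "C \<ge> 0" "\<And>X T. X \<ge> 2 \<Longrightarrow> T \<ge> 2 \<Longrightarrow> X \<le> A * ln T powr (2 - \<epsilon>) \<Longrightarrow>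
    2 * T powr - \<delta> * (exp (c * X powr (1 / 2 + \<delta>)))\<^sup>2 * ln X \<le> C"
proof -
  define \<theta> where "\<theta> = (2 - \<epsilon>) * (1 / 2 + \<delta>)"
  define c' where "c' = 2 * (c * A powr (1 / 2 + \<delta>))"
  define f where "f L = 2 * A * (L powr (2 - \<epsilon>) * exp (c' * L powr \<theta> - \<delta> * L))" for L :: real
  have ln2: "ln 2 > (0::real)" by simp
  have lim: "(f \<longlongrightarrow> 2 * A * 0) at_top"
    unfolding f_def using assms by (intro tendsto_mult tendsto_const exp_powr_decay) (auto simp: \<theta>_def)
  have cont: "continuous_on {ln 2..} f"
    unfolding f_def by (intro continuous_intros) (use ln2 in \<open>auto simp: not_le intro: less_le_trans\<close>)
  obtain C where C: "\<And>L. L \<ge> ln 2 \<Longrightarrow> f L \<le> C"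
    by (rule bounded_of_tendsto_at_top[OF cont lim]) (rule that)
  show ?thesis
  proof (rule that[of "max C 0"])
    fix X T :: real assume X: "X \<ge> 2" and T: "T \<ge> 2" and le: "X \<le> A * ln T powr (2 - \<epsilon>)"
    define L where "L = ln T"
    have L: "L \<ge> ln 2" "L > 0" using T by (auto simp: L_def)
    have "X powr (1 / 2 + \<delta>) \<le> (A * L powr (2 - \<epsilon>)) powr (1 / 2 + \<delta>)"
      using X le assms by (intro powr_mono2) (auto simp: L_def)
    also have "\<dots> = A powr (1 / 2 + \<delta>) * L powr \<theta>"
      using assms by (simp add: powr_mult powr_powr \<theta>_def)
    finally have "c * X powr (1 / 2 + \<delta>) \<le> c * (A powr (1 / 2 + \<delta>) * L powr \<theta>)"
      using assms by (intro mult_left_mono) auto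
    hence e: "2 * (c * X powr (1 / 2 + \<delta>)) \<le> c' * L powr \<theta>" by (simp add: c'_def mult_ac)
    have "2 * T powr - \<delta> * (exp (c * X powr (1 / 2 + \<delta>)))\<^sup>2 * ln X =
      2 * exp (2 * (c * X powr (1 / 2 + \<delta>)) - \<delta> * L) * ln X"
    proof -
      have "T powr - \<delta> = exp (- (\<delta> * L))" using T by (simp add: L_def powr_def)
      moreover have "(exp y)\<^sup>2 = exp (2 * y)" for y :: real by (simp add: exp_double)
      moreover have "exp (2 * (c * X powr (1 / 2 + \<delta>)) - \<delta> * L) =
        exp (- (\<delta> * L)) * exp (2 * (c * X powr (1 / 2 + \<delta>)))" unfolding exp_add[symmetric] by simp
      ultimately show ?thesis by simp
    qed
    also have "\<dots> \<le> 2 * exp (c' * L powr \<theta> - \<delta> * L) * (A * L powr (2 - \<epsilon>))"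
    proof (intro mult_mono)
      have "ln X \<le> X" using X ln_le_minus_one[of X] by simp
      thus "ln X \<le> A * L powr (2 - \<epsilon>)" using le by (simp add: L_def)
    qed (use e X in auto)
    also have "\<dots> = f L" by (simp add: f_def mult_ac)
    also have "\<dots> \<le> max C 0" using C[OF L(1)] by simp
    finally show "2 * T powr - \<delta> * (exp (c * X powr (1 / 2 + \<delta>)))\<^sup>2 * ln X \<le> max C 0" .
  qed simp
qed

lemma abs_exp_minus_one_le:
  fixes u U :: real
  assumes "\<bar>u\<bar> \<le> U"
  shows "\<bar>exp u - 1\<bar> \<le> \<bar>u\<bar> * exp U"
proof (cases "u \<ge> 0")
  case True
  have "1 - u \<le> exp (- u)" using exp_ge_add_one_self[of "- u"] by simp
  hence "(1 - u) * exp u \<le> exp (- u) * exp u" by (intro mult_right_mono) auto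
  hence "exp u - 1 \<le> u * exp u" by (simp add: exp_minus algebra_simps)
  also have "\<dots> \<le> u * exp U" using True assms by (intro mult_left_mono) auto
  finally show ?thesis using True by simp
next
  case False
  have "1 - exp u \<le> - u" using exp_ge_add_one_self[of u] by linarith
  also have "\<dots> \<le> - u * exp U" using False assms mult_left_mono[of 1 "exp U" "- u"] by simp
  finally show ?thesis using False by simp
qed

text \<open>A is the constant implied in X << (ln T)^(2 - eps). Uniformity of the error term is
  expressed by choosing C before l, X and T.\<close>

theorem theorem3:
  fixes q k :: nat and \<epsilon> A :: real
  assumes "q > 0" and "\<epsilon> > 0" and "A > 0"
  shows "\<exists>C::real. \<forall>(l :: (nat \<Rightarrow> complex) \<Rightarrow> nat) (X::real) (T::real).
    tuple_size q l = k \<longrightarrow> X \<ge> 2 \<longrightarrow> T \<ge> 2 \<longrightarrow>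
    real q ^ 2 < X \<longrightarrow> X \<le> A * ln T powr (2 - \<epsilon>) \<longrightarrow>
    (\<exists>E::real. \<bar>E\<bar> \<le> C / ln X \<and>
       1 / T * integral {T..2 * T} (\<lambda>t. (cmod (P_prod X q l (Complex (1 / 2) t)))\<^sup>2)
         = b_const q l * F_X X q l * (1 + E))"
proof -
  obtain K where K: "K \<ge> 0" "\<And>l X. tuple_size q l = k \<Longrightarrow> X \<ge> 2 \<Longrightarrow> real q ^ 2 < X \<Longrightarrow>
    1 \<le> (\<Prod>p\<in>real_primes_upto X. local_square_sum (exp_coeff (local_exponent X q l p)) p) \<and>
    b_const q l * F_X X q l > 0 \<and>
    \<bar>ln (\<Prod>p\<in>real_primes_upto X. local_square_sum (exp_coeff (local_exponent X q l p)) p) - ln (b_const q l * F_X X q l)\<bar> \<le> K / ln X"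
    by (rule diagonal_asymptotics[OF assms(1), of k]) (rule that)
  \<comment> \<open>The bound 1/4 is the range of \<open>P_prod_mean_value\<close>. The bound eps/8
    gives 2 delta <= eps/4 < eps/2, which makes the exponent of ln T in the error term smaller than
    1.\<close>
  define \<delta> where "\<delta> = min (1 / 4) (\<epsilon> / 8)"
  have \<delta>: "0 < \<delta>" "\<delta> \<le> 1 / 4" "\<delta> \<le> \<epsilon> / 8" using assms by (auto simp: \<delta>_def)
  have "(2 - \<epsilon>) * (1 / 2 + \<delta>) = 1 + 2 * \<delta> - \<epsilon> / 2 - \<epsilon> * \<delta>" by (simp add: field_simps)
  moreover have "\<epsilon> * \<delta> > 0" using assms \<delta> by simp
  ultimately have \<theta>: "(2 - \<epsilon>) * (1 / 2 + \<delta>) < 1" using \<delta> assms by linarith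
  \<comment> \<open>The factor 2 comes from \<open>sum_primes_powr_le\<close>.\<close>
  define c where "c = 2 * majorant_const k"
  have c: "c \<ge> 0" using majorant_const_pos[of k] by (simp add: c_def)
  obtain C where C: "C \<ge> 0" "\<And>X T. X \<ge> 2 \<Longrightarrow> T \<ge> 2 \<Longrightarrow> X \<le> A * ln T powr (2 - \<epsilon>) \<Longrightarrow>
    2 * T powr - \<delta> * (exp (c * X powr (1 / 2 + \<delta>)))\<^sup>2 * ln X \<le> C"
    by (rule mean_value_error_bound[OF assms(3) c \<delta>(1) \<theta>]) (rule that)
  define U where "U = K / ln 2"
  show ?thesis
  proof (rule exI[of _ "(K + C) * exp U"], intro allI impI)
    fix l :: "(nat \<Rightarrow> complex) \<Rightarrow> nat" and X T :: real
    assume l: "tuple_size q l = k" and X: "X \<ge> 2" and T: "T \<ge> 2" and qX: "real q ^ 2 < X"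
      and XT: "X \<le> A * ln T powr (2 - \<epsilon>)"
    define M where "M = 1 / T * integral {T..2 * T} (\<lambda>t. (cmod (P_prod X q l (Complex (1 / 2) t)))\<^sup>2)"
    define D where "D = (\<Prod>p\<in>real_primes_upto X. local_square_sum (exp_coeff (local_exponent X q l p)) p)"
    define B where "B = b_const q l * F_X X q l"
    define u where "u = ln D - ln B"
    have D: "D \<ge> 1" and B: "B > 0" and u: "\<bar>u\<bar> \<le> K / ln X"
      using K(2)[OF l X qX] unfolding D_def B_def u_def by blast+
    have lnX: "ln X \<ge> ln 2" "ln X > 0" using X by auto
    have "K / ln X \<le> U" unfolding U_def using K(1) lnX by (intro divide_left_mono) auto
    hence uU: "\<bar>u\<bar> \<le> U" using u by linarith
    have DB: "D = B * exp u" using D B by (simp add: u_def exp_diff)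
    have "q \<le> q ^ 2" by (cases "q = 0") (auto simp: power2_eq_square)
    hence "real q \<le> real q ^ 2" by (metis of_nat_le_iff of_nat_power)
    hence "real q < X" using qX by linarith
    hence "\<bar>M - D\<bar> \<le> 2 * T powr - \<delta> * (exp (majorant_const k * (\<Sum>p\<in>real_primes_upto X. real p powr - (1 / 2 - \<delta>))))\<^sup>2"
      using P_prod_mean_value[OF assms(1) _ _ \<delta>(1,2), of X T l] T l unfolding M_def D_def by simp
    also have "\<dots> \<le> 2 * T powr - \<delta> * (exp (c * X powr (1 / 2 + \<delta>)))\<^sup>2"
    proof (intro mult_left_mono power_mono)
      have "majorant_const k * (\<Sum>p\<in>real_primes_upto X. real p powr - (1 / 2 - \<delta>)) \<le> majorant_const k * (2 * X powr (1 / 2 + \<delta>))"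
        using majorant_const_pos[of k] by (intro mult_left_mono sum_primes_powr_le \<delta> X) auto
      thus "exp (majorant_const k * (\<Sum>p\<in>real_primes_upto X. real p powr - (1 / 2 - \<delta>))) \<le> exp (c * X powr (1 / 2 + \<delta>))"
        by (simp add: c_def)
    qed auto
    also have "\<dots> \<le> C / ln X" using C(2)[OF X T XT] lnX by (simp add: field_simps)
    finally have MD: "\<bar>M - D\<bar> \<le> C / ln X" .
    \<comment> \<open>The diagonal D = B e^u is at least 1, so 1/B is bounded and the absolute error
      of the mean value is also a relative one.\<close>
    have "1 / B \<le> exp u" using D DB B by (simp add: field_simps)
    also have "\<dots> \<le> exp U" using uU by simp
    finally have iB: "1 / B \<le> exp U" .
    have "\<bar>M / B - 1\<bar> \<le> (K + C) * exp U / ln X"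
    proof -
      \<comment> \<open>The relative error splits into the diagonal discrepancy e^u - 1 and the
        off-diagonal contribution.\<close>
      have "M / B - 1 = (exp u - 1) + (M - D) * (1 / B)" using B DB by (simp add: field_simps)
      hence "\<bar>M / B - 1\<bar> \<le> \<bar>exp u - 1\<bar> + \<bar>M - D\<bar> * (1 / B)"
        using B abs_triangle_ineq[of "exp u - 1" "(M - D) * (1 / B)"] by (simp add: abs_mult)
      also have "\<dots> \<le> \<bar>u\<bar> * exp U + (C / ln X) * exp U"
        using B C(1) lnX by (intro add_mono abs_exp_minus_one_le[OF uU] mult_mono MD iB) auto
      also have "\<dots> \<le> (K / ln X) * exp U + (C / ln X) * exp U"
        using u by (intro add_right_mono mult_right_mono) auto
      also have "\<dots> = (K + C) * exp U / ln X" by (simp add: add_divide_distrib distrib_right)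
      finally show ?thesis .
    qed
    moreover have "M = B * (1 + (M / B - 1))" using B by simp
    ultimately show "\<exists>E. \<bar>E\<bar> \<le> (K + C) * exp U / ln X \<and>
       1 / T * integral {T..2 * T} (\<lambda>t. (cmod (P_prod X q l (Complex (1 / 2) t)))\<^sup>2)
         = b_const q l * F_X X q l * (1 + E)"
      unfolding M_def[symmetric] B_def[symmetric] by blast
  qed
qed

end
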